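(* Suppose that $E\subset\mathbb{R}^2$ is such that for every locally bounded superlinear function $\omega\colon\mathbb{R}\to\mathbb{R}$ there is a Lagrangian $L$ with $L(x,y,p)\ge\omega(p)$ for all $(x,y,p)\in\mathbb{R}^3$ whose universal singular set contains $E$. Then $E$ is purely unrectifiable.
   Context: A function $\omega\colon\mathbb{R}\to\mathbb{R}$ is superlinear if $\lim_{|p|\to\infty}\omega(p)/|p|=\infty$. A Lagrangian is a function $L\colon\mathbb{R}^3\to\mathbb{R}$ that is Borel measurable, bounded from below, locally bounded from above, and for which there is a superlinear function $\omega\colon\mathbb{R}\to\mathbb{R}$ with $L(x,y,p)\ge\omega(p)$ for all $(x,y,p)\in\mathbb{R}^3$. $AC[a,b]$ denotes the absolutely continuous real-valued functions on $[a,b]$. For $a<b$ and $u\in AC[a,b]$ put $\mathcal{L}(u;a,b)=\int_a^b L(x,u(x),u'(x))\,dx\in(-\infty,\infty]$, $\mathcal{L}(a,A;b,B)=\inf\{\mathcal{L}(v;a,b):v\in AC[a,b],\ v(a)=A,\ v(b)=B\}$, and define the excess $\mathcal{E}(u;a,b)=\mathcal{L}(u;a,b)-\mathcal{L}(a,u(a);b,u(b))$. A function $u\in C[a,b]$ is a generalized minimizer for $L$ on $[a,b]$ if its restriction to $(a,b)$ is a locally uniform limit of a sequence $u_n\in AC[a_n,b_n]$ with $\mathcal{E}(u_n;a_n,b_n)\to0$ (in particular $\limsup a_n\le a$ and $\liminf b_n\ge b$). The universal singular set of $L$ is the set of all $(x_0,y_0)\in\mathbb{R}^2$ for which there are $a\le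 x_0\le b$ with $a<b$ and a generalized minimizer $u$ for $L$ on $[a,b]$ such that $u(x_0)=y_0$ and $u$ has infinite derivative ($+\infty$ or $-\infty$; one-sided if $x_0$ is an endpoint) at $x_0$. A set $E\subset\mathbb{R}^2$ is purely unrectifiable if $\mathcal{H}^1(E\cap\{\gamma(t):t\in\mathbb{R}\})=0$ for every Lipschitz curve $\gamma\colon\mathbb{R}\to\mathbb{R}^2$, where $\mathcal{H}^1$ is one-dimensional Hausdorff measure. *)

theory Defs
  imports "HOL-Analysis.Analysis"
begin

definition superlinear :: "(real \<Rightarrow> real) \<Rightarrow> bool" where
  "superlinear \<omega> \<longleftrightarrow> filterlim (\<lambda>p. \<omega> p / \<bar>p\<bar>) at_top at_infinity"

definition locally_bounded :: "('a::topological_space \<Rightarrow> real) \<Rightarrow> bool" where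
  "locally_bounded f \<longleftrightarrow> (\<forall>x. \<exists>U. open U \<and> x \<in> U \<and> bounded (f ` U))"

definition locally_bounded_above :: "('a::topological_space \<Rightarrow> real) \<Rightarrow> bool" where
  "locally_bounded_above f \<longleftrightarrow> (\<forall>x. \<exists>U. open U \<and> x \<in> U \<and> bdd_above (f ` U))"

definition lagrangian :: "(real \<times> real \<times> real \<Rightarrow> real) \<Rightarrow> bool" where
  "lagrangian L \<longleftrightarrow>
     L \<in> borel_measurable borel \<and> bdd_below (range L) \<and> locally_bounded_above L \<and>
     (\<exists>\<omega>. superlinear \<omega> \<and> (\<forall>x y p. L (x, y, p) \<ge> \<omega> p))"

text \<open>A pair \<open>(s, t)\<close> in \<open>D\<close> stands for the interval with endpoints \<open>s \<le> t\<close>; the intervals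
  may share endpoints but do not overlap.\<close>

definition absolutely_continuous_on :: "real \<Rightarrow> real \<Rightarrow> (real \<Rightarrow> real) \<Rightarrow> bool" where
  "absolutely_continuous_on a b u \<longleftrightarrow>
     (\<forall>\<epsilon>>0. \<exists>\<delta>>0. \<forall>D. finite D \<and> (\<forall>(s, t)\<in>D. a \<le> s \<and> s \<le> t \<and> t \<le> b) \<and>
        disjoint_family_on (\<lambda>(s, t). {s<..<t}) D \<and> (\<Sum>(s, t)\<in>D. t - s) < \<delta> \<longrightarrow>
        (\<Sum>(s, t)\<in>D. \<bar>u t - u s\<bar>) < \<epsilon>)"

text \<open>The integral of a function that is bounded below on a set of finite measure, with values in
  \<open>(-\<infinity>, \<infinity>]\<close>: since \<^const>\<open>ennreal\<close> truncates negative reals to 0, the two terms are the integrals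
  of the positive and of the negative part, and only the first can be infinite.\<close>

definition extended_integral :: "'a measure \<Rightarrow> ('a \<Rightarrow> real) \<Rightarrow> ereal" where
  "extended_integral M f =
     enn2ereal (\<integral>\<^sup>+x. ennreal (f x) \<partial>M) - enn2ereal (\<integral>\<^sup>+x. ennreal (- f x) \<partial>M)"

text \<open>For absolutely continuous \<open>u\<close> the derivative exists almost everywhere in \<open>[a, b]\<close>; the
  unspecified value of \<^const>\<open>deriv\<close> on the remaining null set does not matter.\<close>

definition action :: "(real \<times> real \<times> real \<Rightarrow> real) \<Rightarrow> (real \<Rightarrow> real) \<Rightarrow> real \<Rightarrow> real \<Rightarrow> ereal" where
  "action L u a b = extended_integral (lebesgue_on {a..b}) (\<lambda>x. L (x, u x, deriv u x))"

definition min_action :: "(real \<times> real \<times> real \<Rightarrow> real) \<Rightarrow> real \<Rightarrow> real \<Rightarrow> real \<Rightarrow> real \<Rightarrow> ereal" where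
  "min_action L a A b B =
     (INF v\<in>{v. absolutely_continuous_on a b v \<and> v a = A \<and> v b = B}. action L v a b)"

definition excess :: "(real \<times> real \<times> real \<Rightarrow> real) \<Rightarrow> (real \<Rightarrow> real) \<Rightarrow> real \<Rightarrow> real \<Rightarrow> ereal" where
  "excess L u a b = action L u a b - min_action L a (u a) b (u b)"

text \<open>Locally uniform convergence on \<open>(a, b)\<close> is uniform convergence on compact subsets; on each of
  them \<open>u\<^sub>n\<close> has to be defined for all large \<open>n\<close>.\<close>

definition generalized_minimizer ::
  "(real \<times> real \<times> real \<Rightarrow> real) \<Rightarrow> (real \<Rightarrow> real) \<Rightarrow> real \<Rightarrow> real \<Rightarrow> bool" where
  "generalized_minimizer L u a b \<longleftrightarrow>
     a < b \<and> continuous_on {a..b} u \<and>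
     (\<exists>(as :: nat \<Rightarrow> real) (bs :: nat \<Rightarrow> real) (us :: nat \<Rightarrow> real \<Rightarrow> real).
        (\<forall>n. as n < bs n \<and> absolutely_continuous_on (as n) (bs n) (us n)) \<and>
        (\<lambda>n. excess L (us n) (as n) (bs n)) \<longlonglongrightarrow> 0 \<and>
        (\<forall>K. compact K \<and> K \<subseteq> {a<..<b} \<longrightarrow>
           (\<forall>\<^sub>F n in sequentially. K \<subseteq> {as n..bs n}) \<and> uniform_limit K us u sequentially))"

definition has_infinite_derivative_within :: "(real \<Rightarrow> real) \<Rightarrow> real \<Rightarrow> real set \<Rightarrow> bool" where
  "has_infinite_derivative_within u x S \<longleftrightarrow>
     filterlim (\<lambda>z. (u z - u x) / (z - x)) at_top (at x within S) \<or>
     filterlim (\<lambda>z. (u z - u x) / (z - x)) at_bot (at x within S)"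

definition universal_singular_set :: "(real \<times> real \<times> real \<Rightarrow> real) \<Rightarrow> (real \<times> real) set" where
  "universal_singular_set L =
     {(x, y). \<exists>a b u. a \<le> x \<and> x \<le> b \<and> a < b \<and> generalized_minimizer L u a b \<and> u x = y \<and>
        has_infinite_derivative_within u x {a..b}}"

text \<open>Boundedness of the covering sets is required explicitly because \<^const>\<open>diameter\<close> is
  unspecified on unbounded sets. Covers by finitely many sets are included through \<open>C n = {}\<close>,
  which has diameter 0.\<close>

definition hausdorff_measure_1 :: "'a::metric_space set \<Rightarrow> ennreal" where
  "hausdorff_measure_1 A =
     (SUP \<delta>\<in>{0<..}. INF C\<in>{C :: nat \<Rightarrow> 'a set. A \<subseteq> (\<Union>n. C n) \<and>
        (\<forall>n. bounded (C n) \<and> diameter (C n) \<le> \<delta>)}. \<Sum>n. ennreal (diameter (C n)))"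

definition purely_unrectifiable :: "(real \<times> real) set \<Rightarrow> bool" where
  "purely_unrectifiable E \<longleftrightarrow>
     (\<forall>(\<gamma> :: real \<Rightarrow> real \<times> real) C. C-lipschitz_on UNIV \<gamma> \<longrightarrow>
        hausdorff_measure_1 (E \<inter> range \<gamma>) = 0)"

end

theory Submission
  imports Defs
begin

text \<open>Let \<open>\<gamma> = (X, Y)\<close> be a Lipschitz curve, let \<open>L \<ge> \<omega>\<close> be a Lagrangian whose universal singular set
contains \<open>E\<close>, and let \<open>F = L + c \<ge> 0\<close>.  Reflecting time and values, one may suppose that the
generalized minimizer \<open>u\<close> through a point \<open>(x, y)\<close> of \<open>E\<close> has left derivative \<open>+\<infinity>\<close> there.

The idea is to watch one value function instead of the uncountably many minimizers.  Choose a
source \<open>(q, s)\<close> with \<open>q\<close> slightly less than \<open>x\<close> and \<open>s < u q\<close>, and let \<open>f x y\<close>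
(\<open>arrival_cost\<close>) be the infimal cost of the paths that start in the source, reach the height \<open>y\<close>
before time \<open>x\<close> and then wait.  Then reaching the height \<open>y - d\<close> instead of \<open>y\<close> saves more than
\<open>K * d\<close>, for every \<open>K\<close> and all small \<open>d\<close>.  Indeed, take a nearly optimal path \<open>v\<close> to \<open>(x, y)\<close>.
If \<open>v\<close> is still below \<open>y - d\<close> shortly before \<open>x\<close>, it has to climb by \<open>d\<close> in much less time
than \<open>d\<close>, and by superlinearity this costs more than \<open>K * d\<close>.  Otherwise \<open>v\<close>, having started
below \<open>u\<close>, has crossed \<open>u\<close>.  From the crossing on, \<open>v\<close> cannot be cheaper than the minimizer
\<open>u\<close>, because \<open>v\<close> can be led back to \<open>u\<close> just before \<open>x\<close> at negligible cost; so \<open>u\<close> may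
be followed instead, and \<open>u\<close> does make the steep climb (\<open>descent_step\<close>).  The source enters only
through \<open>s < u q\<close> and the steepness of \<open>u\<close> on \<open>[q, x]\<close>.  Hence rational sources are enough, and each of
these countably many functions serves all the minimizers that pass above its source.

Along \<open>\<gamma>\<close> the value \<open>f (X t) (Y t)\<close> therefore drops, at every such parameter \<open>t\<close>, faster than
every linear function.  A finite function can do this only on a null set of parameters
(\<open>steep_decrease_negligible\<close>).  Two directions of motion have to be treated.

\<^item> Where \<open>X' t \<noteq> 0\<close>, move along \<open>\<gamma>\<close> forward in time (\<open>gain_forward\<close>).  A path that has
  been stopped at a lower height has time to reach the new point of \<open>\<gamma>\<close> with bounded slope, at
  a cost proportional to the time, since \<open>L\<close> is locally bounded above.

\<^item> Where \<open>X' t = 0 \<noteq> Y' t\<close>, move along \<open>\<gamma>\<close> downwards (\<open>gain_downward\<close>).  The new point may come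
  earlier in time, but only by a small fraction of the change in height.  A path that reaches the
  new height too late for it would have to climb so steeply afterwards that its cost is
  large, provided that \<open>\<omega>\<close> grows fast enough compared with the rate at which \<open>\<gamma>\<close> becomes
  vertical.  This is where the freedom to choose \<open>\<omega>\<close> is used: \<open>\<omega>\<close> is made from \<open>\<gamma>\<close>
  (\<open>staircase_growth\<close>), the rate being uniform off a set of small measure by an argument of
  Egorov's kind (\<open>vertical_scales\<close>).

The remaining parameters are those where \<open>\<gamma>\<close> is not differentiable, a null set whose image has
length zero because \<open>\<gamma>\<close> is Lipschitz, and those with \<open>\<gamma>' t = 0\<close>, whose image has length zero
by Vitali's covering lemma.

Costs involve the derivatives of absolutely continuous functions.  That such functions are
differentiable almost everywhere and are the integrals of their derivatives is derived from the
theorem of Radon and Nikodym, applied to the measures whose distribution functions are the total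
variation \<open>V\<close> of \<open>u\<close> and \<open>V - u\<close>.\<close>

section \<open>Families of non-overlapping intervals\<close>

definition interval_family :: "real \<Rightarrow> real \<Rightarrow> (real \<times> real) set \<Rightarrow> bool" where
  "interval_family a b D \<longleftrightarrow> finite D \<and> (\<forall>(s, t)\<in>D. a \<le> s \<and> s \<le> t \<and> t \<le> b) \<and>
     disjoint_family_on (\<lambda>(s, t). {s<..<t}) D"

definition variation_over :: "(real \<Rightarrow> real) \<Rightarrow> (real \<times> real) set \<Rightarrow> real" where
  "variation_over u D = (\<Sum>(s, t)\<in>D. \<bar>u t - u s\<bar>)"

definition total_length :: "(real \<times> real) set \<Rightarrow> real" where
  "total_length D = (\<Sum>(s, t)\<in>D. t - s)"

lemma absolutely_continuous_on_alt:
  "absolutely_continuous_on a b u \<longleftrightarrow>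
     (\<forall>\<epsilon>>0. \<exists>\<delta>>0. \<forall>D. interval_family a b D \<and> total_length D < \<delta> \<longrightarrow> variation_over u D < \<epsilon>)"
  unfolding absolutely_continuous_on_def interval_family_def variation_over_def total_length_def
  by (simp add: conj_assoc)

lemma interval_family_finite: "interval_family a b D \<Longrightarrow> finite D"
  by (simp add: interval_family_def)

lemma interval_familyD: "interval_family a b D \<Longrightarrow> (s, t) \<in> D \<Longrightarrow> a \<le> s \<and> s \<le> t \<and> t \<le> b"
  by (auto simp: interval_family_def)

lemma interval_family_disjointD:
  assumes "interval_family a b D" "(s, t) \<in> D" "(s', t') \<in> D" "max s s' < min t t'"
  shows "(s, t) = (s', t')"
proof (rule ccontr)
  assume "(s, t) \<noteq> (s', t')"
  then have "{s<..<t} \<inter> {s'<..<t'} = {}"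
    using assms unfolding interval_family_def disjoint_family_on_def by fastforce
  moreover have "(max s s' + min t t') / 2 \<in> {s<..<t} \<inter> {s'<..<t'}"
    using assms(4) by (auto simp: max_def min_def split: if_splits)
  ultimately show False by auto
qed

lemma interval_familyI:
  assumes "finite D" "\<And>s t. (s, t) \<in> D \<Longrightarrow> a \<le> s \<and> s \<le> t \<and> t \<le> b"
    and "\<And>s t s' t'. (s, t) \<in> D \<Longrightarrow> (s', t') \<in> D \<Longrightarrow> max s s' < min t t' \<Longrightarrow> (s, t) = (s', t')"
  shows "interval_family a b D"
proof -
  have "disjoint_family_on (\<lambda>(s, t). {s<..<t}) D"
    unfolding disjoint_family_on_def
  proof (intro ballI impI, rule ccontr)
    fix I J assume D: "I \<in> D" "J \<in> D" "I \<noteq> J" "(case I of (s, t) \<Rightarrow> {s<..<t}) \<inter> (case J of (s, t) \<Rightarrow> {s<..<t}) \<noteq> {}"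
    obtain s t s' t' where IJ: "I = (s, t)" "J = (s', t')" by (metis surj_pair)
    with D(4) have "max s s' < min t t'" by (simp add: not_le)
    with assms(3) D IJ show False by blast
  qed
  with assms show ?thesis by (auto simp: interval_family_def)
qed

text \<open>The images of the intervals of a family under a monotone map.  Intervals that collapse to a point
are left out: distinct intervals of the family could collapse to the same point, whereas on the
others the map is injective, so that sums over the image are sums over the family.\<close>

definition push_family :: "(real \<Rightarrow> real) \<Rightarrow> (real \<times> real) set \<Rightarrow> (real \<times> real) set" where
  "push_family \<kappa> D = (\<lambda>(s, t). (\<kappa> s, \<kappa> t)) ` {(s, t)\<in>D. \<kappa> s < \<kappa> t}"

lemma push_family_unique:
  fixes \<kappa> :: "real \<Rightarrow> real"
  assumes D: "interval_family a b D" and mono: "\<And>x y. x \<le> y \<Longrightarrow> \<kappa> x \<le> \<kappa> y"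
    and st: "(s, t) \<in> D" "(s', t') \<in> D" and m: "max (\<kappa> s) (\<kappa> s') < min (\<kappa> t) (\<kappa> t')"
  shows "(s, t) = (s', t')"
proof -
  have "max s s' < min t t'"
  proof (rule ccontr)
    assume "\<not> max s s' < min t t'"
    then have "t \<le> s \<or> t' \<le> s \<or> t \<le> s' \<or> t' \<le> s'" by (auto simp: max_def min_def split: if_splits)
    then have "\<kappa> t \<le> \<kappa> s \<or> \<kappa> t' \<le> \<kappa> s \<or> \<kappa> t \<le> \<kappa> s' \<or> \<kappa> t' \<le> \<kappa> s'" using mono by blast
    moreover have "\<kappa> s < \<kappa> t \<and> \<kappa> s < \<kappa> t' \<and> \<kappa> s' < \<kappa> t \<and> \<kappa> s' < \<kappa> t'"
      using m by (auto simp: max_def min_def split: if_splits)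
    ultimately show False by linarith
  qed
  with D st show ?thesis by (meson interval_family_disjointD)
qed

lemma interval_family_push:
  assumes D: "interval_family a b D" and mono: "\<And>x y. x \<le> y \<Longrightarrow> \<kappa> x \<le> \<kappa> y"
    and range: "\<And>x. a \<le> x \<Longrightarrow> x \<le> b \<Longrightarrow> a' \<le> \<kappa> x \<and> \<kappa> x \<le> b'"
  shows "interval_family a' b' (push_family \<kappa> D)"
proof (rule interval_familyI)
  have "finite {(s, t)\<in>D. \<kappa> s < \<kappa> t}"
    by (rule finite_subset[OF _ interval_family_finite[OF D]]) auto
  then show "finite (push_family \<kappa> D)" unfolding push_family_def by simp
  show "a' \<le> p \<and> p \<le> q \<and> q \<le> b'" if pq: "(p, q) \<in> push_family \<kappa> D" for p q
  proof -
    obtain s t where st: "(s, t) \<in> D" "p = \<kappa> s" "q = \<kappa> t" "\<kappa> s < \<kappa> t" using pq unfolding push_family_def by auto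
    then have "a \<le> s \<and> s \<le> t \<and> t \<le> b" using D interval_familyD by blast
    then show ?thesis using st range[of s] range[of t] by auto
  qed
  show "(p, q) = (p', q')"
    if pq: "(p, q) \<in> push_family \<kappa> D" "(p', q') \<in> push_family \<kappa> D" "max p p' < min q q'" for p q p' q'
  proof -
    obtain s t where st: "(s, t) \<in> D" "p = \<kappa> s" "q = \<kappa> t" using pq(1) unfolding push_family_def by auto
    obtain s' t' where st': "(s', t') \<in> D" "p' = \<kappa> s'" "q' = \<kappa> t'" using pq(2) unfolding push_family_def by auto
    have "(s, t) = (s', t')" using push_family_unique[OF D mono st(1) st'(1)] pq(3) st st' by simp
    then show ?thesis using st st' by simp
  qed
qed

lemma sum_push_family:
  fixes F :: "real \<Rightarrow> real \<Rightarrow> real"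
  assumes D: "interval_family a b D" and mono: "\<And>x y. x \<le> y \<Longrightarrow> \<kappa> x \<le> \<kappa> y" and F: "\<And>p. F p p = 0"
  shows "(\<Sum>(s, t)\<in>push_family \<kappa> D. F s t) = (\<Sum>(s, t)\<in>D. F (\<kappa> s) (\<kappa> t))"
proof -
  let ?D0 = "{(s, t)\<in>D. \<kappa> s < \<kappa> t}"
  have inj: "inj_on (\<lambda>(s, t). (\<kappa> s, \<kappa> t)) ?D0"
  proof (rule inj_onI)
    fix I J assume IJ: "I \<in> ?D0" "J \<in> ?D0" "(\<lambda>(s, t). (\<kappa> s, \<kappa> t)) I = (\<lambda>(s, t). (\<kappa> s, \<kappa> t)) J"
    obtain s t s' t' where eq: "I = (s, t)" "J = (s', t')" by (metis surj_pair)
    with IJ show "I = J" using push_family_unique[where s = s and t = t and s' = s' and t' = t', OF D mono] by auto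
  qed
  have "(\<Sum>(s, t)\<in>push_family \<kappa> D. F s t) = (\<Sum>(s, t)\<in>?D0. F (\<kappa> s) (\<kappa> t))"
    unfolding push_family_def by (subst sum.reindex[OF inj]) (simp add: case_prod_unfold)
  also have "\<dots> = (\<Sum>(s, t)\<in>D. F (\<kappa> s) (\<kappa> t))"
  proof (rule sum.mono_neutral_left[OF interval_family_finite[OF D]])
    show "\<forall>I\<in>D - ?D0. (case I of (s, t) \<Rightarrow> F (\<kappa> s) (\<kappa> t)) = 0"
    proof
      fix I assume I: "I \<in> D - ?D0"
      obtain s t where st: "I = (s, t)" by fastforce
      then have "\<kappa> s \<le> \<kappa> t" using I interval_familyD[OF D, of s t] mono by blast
      with I st have "\<kappa> s = \<kappa> t" by auto
      with F st show "(case I of (s, t) \<Rightarrow> F (\<kappa> s) (\<kappa> t)) = 0" by simp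
    qed
  qed auto
  finally show ?thesis .
qed

section \<open>Absolutely continuous functions\<close>

text \<open>The clamps \<open>\<lambda>x. min x c\<close> and \<open>\<lambda>x. max x c\<close> satisfy the hypotheses on \<open>\<kappa>\<close>; composing with them
freezes a function on one side of \<open>c\<close>.\<close>

lemma absolutely_continuous_on_compose:
  assumes u: "absolutely_continuous_on a' b' u" and mono: "\<And>x y. x \<le> y \<Longrightarrow> \<kappa> x \<le> \<kappa> y"
    and short: "\<And>x y. x \<le> y \<Longrightarrow> \<kappa> y - \<kappa> x \<le> y - x"
    and range: "\<And>x. a \<le> x \<Longrightarrow> x \<le> b \<Longrightarrow> a' \<le> \<kappa> x \<and> \<kappa> x \<le> b'"
  shows "absolutely_continuous_on a b (\<lambda>x. u (\<kappa> x))"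
  unfolding absolutely_continuous_on_alt
proof (intro allI impI)
  fix \<epsilon> :: real assume "\<epsilon> > 0"
  then obtain \<delta> where \<delta>: "\<delta> > 0" "\<And>D. interval_family a' b' D \<Longrightarrow> total_length D < \<delta> \<Longrightarrow> variation_over u D < \<epsilon>"
    using u unfolding absolutely_continuous_on_alt by meson
  show "\<exists>\<delta>>0. \<forall>D. interval_family a b D \<and> total_length D < \<delta> \<longrightarrow> variation_over (\<lambda>x. u (\<kappa> x)) D < \<epsilon>"
  proof (intro exI conjI allI impI)
    fix D assume D: "interval_family a b D \<and> total_length D < \<delta>"
    note D1 = D[THEN conjunct1]
    have "total_length (push_family \<kappa> D) = (\<Sum>(s, t)\<in>D. \<kappa> t - \<kappa> s)"
      unfolding total_length_def by (rule sum_push_family[OF D1 mono]) simp_all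
    also have "\<dots> \<le> total_length D"
      unfolding total_length_def using D1 by (intro sum_mono) (auto dest: interval_familyD intro: short)
    finally have "total_length (push_family \<kappa> D) < \<delta>" using D by simp
    then have "variation_over u (push_family \<kappa> D) < \<epsilon>"
      using \<delta>(2) interval_family_push[where \<kappa> = \<kappa>, OF D1 mono range] by blast
    moreover have "variation_over u (push_family \<kappa> D) = variation_over (\<lambda>x. u (\<kappa> x)) D"
      unfolding variation_over_def by (rule sum_push_family[OF D1 mono]) simp_all
    ultimately show "variation_over (\<lambda>x. u (\<kappa> x)) D < \<epsilon>" by simp
  qed (rule \<delta>(1))
qed

lemma absolutely_continuous_on_add:
  assumes "absolutely_continuous_on a b u" "absolutely_continuous_on a b v"
  shows "absolutely_continuous_on a b (\<lambda>x. u x + v x)"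
  unfolding absolutely_continuous_on_alt
proof (intro allI impI)
  fix \<epsilon> :: real assume "\<epsilon> > 0"
  then have e: "\<epsilon> / 2 > 0" by simp
  obtain \<delta> where \<delta>: "\<delta> > 0" "\<And>D. interval_family a b D \<Longrightarrow> total_length D < \<delta> \<Longrightarrow> variation_over u D < \<epsilon> / 2"
    using assms(1) e unfolding absolutely_continuous_on_alt by meson
  obtain \<delta>' where \<delta>': "\<delta>' > 0" "\<And>D. interval_family a b D \<Longrightarrow> total_length D < \<delta>' \<Longrightarrow> variation_over v D < \<epsilon> / 2"
    using assms(2) e unfolding absolutely_continuous_on_alt by meson
  show "\<exists>\<delta>>0. \<forall>D. interval_family a b D \<and> total_length D < \<delta> \<longrightarrow> variation_over (\<lambda>x. u x + v x) D < \<epsilon>"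
  proof (intro exI conjI allI impI)
    show "min \<delta> \<delta>' > 0" using \<delta> \<delta>' by simp
    fix D assume D: "interval_family a b D \<and> total_length D < min \<delta> \<delta>'"
    have "variation_over (\<lambda>x. u x + v x) D \<le> variation_over u D + variation_over v D"
      unfolding variation_over_def sum.distrib[symmetric] by (rule sum_mono) auto
    also have "\<dots> < \<epsilon>" using \<delta>(2)[of D] \<delta>'(2)[of D] D by simp
    finally show "variation_over (\<lambda>x. u x + v x) D < \<epsilon>" .
  qed
qed

lemma absolutely_continuous_on_uminus:
  "absolutely_continuous_on a b u \<Longrightarrow> absolutely_continuous_on a b (\<lambda>x. - u x)"
proof -
  have "\<bar>- u t - - u s\<bar> = \<bar>u t - u s\<bar>" for s t by linarith
  then show "absolutely_continuous_on a b u \<Longrightarrow> ?thesis" unfolding absolutely_continuous_on_def by simp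
qed

lemma absolutely_continuous_on_cong:
  assumes u: "absolutely_continuous_on a b u" and eq: "\<And>x. a \<le> x \<Longrightarrow> x \<le> b \<Longrightarrow> v x = u x"
  shows "absolutely_continuous_on a b v"
proof -
  have "variation_over v D = variation_over u D" if "interval_family a b D" for D
    unfolding variation_over_def using that eq by (intro sum.cong) (auto dest!: interval_familyD)
  with u show ?thesis unfolding absolutely_continuous_on_alt by metis
qed

lemma absolutely_continuous_on_subinterval:
  assumes u: "absolutely_continuous_on a b u" and "a \<le> c" "d \<le> b"
  shows "absolutely_continuous_on c d u"
proof -
  have "interval_family a b D" if "interval_family c d D" for D
    using that assms(2,3) unfolding interval_family_def by fastforce
  with u show ?thesis unfolding absolutely_continuous_on_alt by meson
qed

lemma lipschitz_imp_absolutely_continuous_on: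
  assumes "\<And>x y. a \<le> x \<Longrightarrow> x \<le> y \<Longrightarrow> y \<le> b \<Longrightarrow> \<bar>u y - u x\<bar> \<le> C * (y - x)"
  shows "absolutely_continuous_on a b u"
  unfolding absolutely_continuous_on_alt
proof (intro allI impI)
  fix \<epsilon> :: real assume e: "\<epsilon> > 0"
  show "\<exists>\<delta>>0. \<forall>D. interval_family a b D \<and> total_length D < \<delta> \<longrightarrow> variation_over u D < \<epsilon>"
  proof (intro exI conjI allI impI)
    show "\<epsilon> / (\<bar>C\<bar> + 1) > 0" using e by auto
    fix D assume D: "interval_family a b D \<and> total_length D < \<epsilon> / (\<bar>C\<bar> + 1)"
    have "variation_over u D \<le> (\<Sum>(s, t)\<in>D. (\<bar>C\<bar> + 1) * (t - s))"
      unfolding variation_over_def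
    proof (rule sum_mono, clarsimp)
      fix s t assume "(s, t) \<in> D"
      then have st: "a \<le> s" "s \<le> t" "t \<le> b" using D interval_familyD by blast+
      then have "\<bar>u t - u s\<bar> \<le> C * (t - s)" by (rule assms)
      also have "\<dots> \<le> (\<bar>C\<bar> + 1) * (t - s)" using st by (intro mult_right_mono) auto
      finally show "\<bar>u t - u s\<bar> \<le> (\<bar>C\<bar> + 1) * (t - s)" .
    qed
    also have "\<dots> = (\<bar>C\<bar> + 1) * total_length D"
      unfolding total_length_def by (simp add: sum_distrib_left case_prod_unfold)
    also have "\<dots> < \<epsilon>" using D by (simp add: field_simps)
    finally show "variation_over u D < \<epsilon>" .
  qed
qed

lemma absolutely_continuous_on_imp_continuous_on:
  assumes u: "absolutely_continuous_on a b u"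
  shows "continuous_on {a..b} u"
  unfolding continuous_on_iff
proof (intro ballI allI impI)
  fix x \<epsilon> :: real assume x: "x \<in> {a..b}" and e: "\<epsilon> > 0"
  then obtain \<delta> where \<delta>: "\<delta> > 0" "\<And>D. interval_family a b D \<Longrightarrow> total_length D < \<delta> \<Longrightarrow> variation_over u D < \<epsilon>"
    using u unfolding absolutely_continuous_on_alt by meson
  have "dist (u x') (u x) < \<epsilon>" if "x' \<in> {a..b}" "dist x' x < \<delta>" for x'
  proof -
    have "interval_family a b {(min x x', max x x')}" 
      using that x by (intro interval_familyI) (auto simp: min_def max_def)
    then have "variation_over u {(min x x', max x x')} < \<epsilon>"
      using that by (intro \<delta>) (auto simp: total_length_def dist_real_def min_def max_def)
    then show ?thesis by (auto simp: variation_over_def dist_real_def min_def max_def split: if_splits)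
  qed
  with \<delta>(1) show "\<exists>d>0. \<forall>x'\<in>{a..b}. dist x' x < d \<longrightarrow> dist (u x') (u x) < \<epsilon>" by blast
qed

text \<open>The concatenation is the sum of \<open>u\<close> frozen after \<open>c\<close> and \<open>v\<close> frozen before \<open>c\<close>, up to a
constant.\<close>

lemma absolutely_continuous_on_glue:
  assumes u: "absolutely_continuous_on a c u" and v: "absolutely_continuous_on c b v"
    and "a \<le> c" "c \<le> b" "u c = v c"
  shows "absolutely_continuous_on a b (\<lambda>x. if x \<le> c then u x else v x)"
proof (rule absolutely_continuous_on_cong)
  have "absolutely_continuous_on a b (\<lambda>x. u (min x c))"
    by (rule absolutely_continuous_on_compose[OF u]) (use assms in \<open>auto simp: min_def\<close>)
  moreover have "absolutely_continuous_on a b (\<lambda>x. v (max x c))"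
    by (rule absolutely_continuous_on_compose[OF v]) (use assms in \<open>auto simp: max_def\<close>)
  moreover have "absolutely_continuous_on a b (\<lambda>x. - v c)"
    by (rule lipschitz_imp_absolutely_continuous_on[where C = 0]) auto
  ultimately show "absolutely_continuous_on a b (\<lambda>x. u (min x c) + v (max x c) + - v c)"
    by (intro absolutely_continuous_on_add)
qed (use assms in \<open>auto simp: min_def max_def\<close>)

section \<open>Total variation\<close>

definition total_variation :: "(real \<Rightarrow> real) \<Rightarrow> real \<Rightarrow> real \<Rightarrow> real" where
  "total_variation u a x = (SUP D\<in>{D. interval_family a x D}. variation_over u D)"

lemma interval_family_empty [simp]: "interval_family a b {}"
  by (simp add: interval_family_def disjoint_family_on_def)

lemma variation_over_split:
  assumes D: "interval_family a b D"
  shows "variation_over u D \<le>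
    variation_over u (push_family (\<lambda>x. min x c) D) + variation_over u (push_family (\<lambda>x. max x c) D)"
proof -
  have 1: "variation_over u (push_family (\<lambda>x. min x c) D) = (\<Sum>(s, t)\<in>D. \<bar>u (min t c) - u (min s c)\<bar>)"
    unfolding variation_over_def by (rule sum_push_family[OF D]) (auto simp: min_def)
  have 2: "variation_over u (push_family (\<lambda>x. max x c) D) = (\<Sum>(s, t)\<in>D. \<bar>u (max t c) - u (max s c)\<bar>)"
    unfolding variation_over_def by (rule sum_push_family[OF D]) (auto simp: max_def)
  have 3: "\<bar>u t - u s\<bar> \<le> \<bar>u (min t c) - u (min s c)\<bar> + \<bar>u (max t c) - u (max s c)\<bar>" for s t
    by (auto simp: min_def max_def)
  show ?thesis unfolding 1 2 sum.distrib[symmetric]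
    unfolding variation_over_def by (rule sum_mono) (use 3 in auto)
qed

lemma interval_family_push_min:
  "interval_family a b D \<Longrightarrow> a \<le> c \<Longrightarrow> interval_family a c (push_family (\<lambda>x. min x c) D)"
  by (erule interval_family_push) (auto simp: min_def)

lemma interval_family_push_max:
  "interval_family a b D \<Longrightarrow> c \<le> b \<Longrightarrow> interval_family c b (push_family (\<lambda>x. max x c) D)"
  by (erule interval_family_push) (auto simp: max_def)

lemma total_length_le:
  assumes D: "interval_family c d D" and "c \<le> d"
  shows "total_length D \<le> d - c"
proof -
  have "total_length D = (\<Sum>p\<in>D. measure lborel (case p of (s, t) \<Rightarrow> {s<..<t}))"
    unfolding total_length_def using assms by (intro sum.cong) (auto dest!: interval_familyD)
  also have "\<dots> = measure lborel (\<Union>p\<in>D. case p of (s, t) \<Rightarrow> {s<..<t})"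
    using assms by (intro measure_finite_Union[symmetric])
      (auto simp: interval_family_def)
  also have "\<dots> \<le> measure lborel {c..d}"
  proof (rule measure_mono_fmeasurable)
    show "(\<Union>p\<in>D. case p of (s, t) \<Rightarrow> {s<..<t}) \<in> sets lborel"
      using assms by (intro sets.finite_UN) (auto simp: interval_family_def)
    show "{c..d} \<in> fmeasurable lborel" by (auto simp: fmeasurable_def emeasure_lborel_Icc_eq)
  qed (use assms in \<open>fastforce dest!: interval_familyD\<close>)
  also have "\<dots> = d - c" using assms by simp
  finally show ?thesis .
qed

text \<open>On intervals shorter than the \<open>\<delta>\<close> that belongs to \<open>\<epsilon> = 1\<close> the variation is at most 1, and
bounds on adjacent intervals add up; bisection does the rest.\<close>

lemma absolutely_continuous_on_bounded_variation:
  assumes u: "absolutely_continuous_on a b u" and "a \<le> b"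
  shows "\<exists>B. \<forall>D. interval_family a b D \<longrightarrow> variation_over u D \<le> B"
proof -
  define P where "P c d \<longleftrightarrow> (a \<le> c \<and> d \<le> b \<longrightarrow> (\<exists>B. \<forall>D. interval_family c d D \<longrightarrow> variation_over u D \<le> B))" for c d
  obtain \<delta> where \<delta>: "\<delta> > 0" "\<And>D. interval_family a b D \<Longrightarrow> total_length D < \<delta> \<Longrightarrow> variation_over u D < 1"
    using u unfolding absolutely_continuous_on_alt by (meson zero_less_one)
  have "P a b"
  proof (rule Bolzano[OF \<open>a \<le> b\<close>])
    fix p q r assume PQ: "P p q" "P q r" "p \<le> q" "q \<le> r"
    show "P p r" unfolding P_def
    proof
      assume *: "a \<le> p \<and> r \<le> b"
      obtain B1 where B1: "\<And>D. interval_family p q D \<Longrightarrow> variation_over u D \<le> B1" using PQ * unfolding P_def by auto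
      obtain B2 where B2: "\<And>D. interval_family q r D \<Longrightarrow> variation_over u D \<le> B2" using PQ * unfolding P_def by auto
      have "variation_over u D \<le> B1 + B2" if "interval_family p r D" for D
      proof -
        show ?thesis using variation_over_split[OF that, of u q]
          B1[OF interval_family_push_min[OF that PQ(3)]] B2[OF interval_family_push_max[OF that PQ(4)]] by linarith
      qed
      then show "\<exists>B. \<forall>D. interval_family p r D \<longrightarrow> variation_over u D \<le> B" by blast
    qed
  next
    fix x assume "a \<le> x" "x \<le> b"
    show "\<exists>d>0. \<forall>p q. p \<le> x \<and> x \<le> q \<and> q - p < d \<longrightarrow> P p q"
    proof (intro exI conjI allI impI)
      fix p q assume pq: "p \<le> x \<and> x \<le> q \<and> q - p < \<delta>"
      have "variation_over u D \<le> 1" if "interval_family p q D" "a \<le> p" "q \<le> b" for D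
      proof -
        have "interval_family a b D" using that unfolding interval_family_def by fastforce
        moreover have "total_length D < \<delta>" using total_length_le[OF that(1)] pq by linarith
        ultimately show ?thesis using \<delta>(2) by fastforce
      qed
      then show "P p q" unfolding P_def by blast
    qed (rule \<delta>(1))
  qed
  then show ?thesis unfolding P_def by simp
qed


context
  fixes u :: "real \<Rightarrow> real" and a b :: real
  assumes u: "absolutely_continuous_on a b u" and ab: "a \<le> b"
begin

lemma bdd_above_variation_over:
  assumes "x \<le> b"
  shows "bdd_above (variation_over u ` {D. interval_family a x D})"
proof -
  obtain B where "\<And>D. interval_family a b D \<Longrightarrow> variation_over u D \<le> B"
    using absolutely_continuous_on_bounded_variation[OF u ab] by blast
  moreover have "interval_family a b D" if "interval_family a x D" for D
    using that assms unfolding interval_family_def by fastforce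
  ultimately show ?thesis by (intro bdd_aboveI2[where M = B]) auto
qed

lemma variation_over_le_total_variation:
  "x \<le> b \<Longrightarrow> interval_family a x D \<Longrightarrow> variation_over u D \<le> total_variation u a x"
  unfolding total_variation_def by (rule cSUP_upper) (auto intro: bdd_above_variation_over)

lemma total_variation_increment_ge:
  assumes "a \<le> x" "x \<le> y" "y \<le> b"
  shows "total_variation u a x + \<bar>u y - u x\<bar> \<le> total_variation u a y"
proof (cases "x = y")
  case False
  then have xy: "x < y" using assms by simp
  have "total_variation u a x \<le> total_variation u a y - \<bar>u y - u x\<bar>"
    unfolding total_variation_def[of u a x]
  proof (rule cSUP_least)
    show "{D. interval_family a x D} \<noteq> {}" using interval_family_empty by blast
    fix D assume "D \<in> {D. interval_family a x D}"
    then have D: "interval_family a x D" by simp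
    have fam: "interval_family a y (insert (x, y) D)"
    proof (rule interval_familyI)
      show "finite (insert (x, y) D)" using interval_family_finite[OF D] by simp
      show "a \<le> s \<and> s \<le> t \<and> t \<le> y" if "(s, t) \<in> insert (x, y) D" for s t
        using that D assms by (auto dest!: interval_familyD)
      show "(s, t) = (s', t')"
        if "(s, t) \<in> insert (x, y) D" "(s', t') \<in> insert (x, y) D" "max s s' < min t t'" for s t s' t'
        using that interval_familyD[OF D, of s t] interval_familyD[OF D, of s' t']
          interval_family_disjointD[OF D, of s t s' t'] by auto
    qed
    have "(x, y) \<notin> D" using interval_familyD[OF D] xy by force
    then have "variation_over u (insert (x, y) D) = \<bar>u y - u x\<bar> + variation_over u D"
      unfolding variation_over_def using interval_family_finite[OF D] by simp
    then show "variation_over u D \<le> total_variation u a y - \<bar>u y - u x\<bar>"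
      using variation_over_le_total_variation[OF assms(3) fam] by linarith
  qed
  then show ?thesis by linarith
qed simp

text \<open>A family in \<open>[a, t]\<close> that nearly attains the variation is cut at \<open>s\<close>; its part in \<open>[a, s]\<close> is
bounded by the variation on \<open>[a, s]\<close>, so the part in \<open>[s, t]\<close> accounts for the increment.\<close>

lemma total_variation_increment_le:
  assumes "a \<le> s" "s \<le> t" "t \<le> b" "e > 0"
  obtains D where "interval_family s t D" "\<And>p q. (p, q) \<in> D \<Longrightarrow> p < q"
    "total_variation u a t - total_variation u a s \<le> variation_over u D + e"
proof -
  have "\<exists>D\<in>{D. interval_family a t D}. total_variation u a t - e < variation_over u D"
    using assms bdd_above_variation_over[of t] interval_family_empty[of a t]
    by (subst less_cSUP_iff[symmetric]) (auto simp: total_variation_def simp del: interval_family_empty)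
  then obtain D where D: "interval_family a t D" "total_variation u a t - e < variation_over u D" by blast
  show ?thesis
  proof
    show "interval_family s t (push_family (\<lambda>x. max x s) D)"
      using D assms by (intro interval_family_push_max)
    have "variation_over u (push_family (\<lambda>x. min x s) D) \<le> total_variation u a s"
      using D assms by (intro variation_over_le_total_variation interval_family_push_min) auto
    then show "total_variation u a t - total_variation u a s \<le> variation_over u (push_family (\<lambda>x. max x s) D) + e"
      using variation_over_split[OF D(1), of u s] D(2) by linarith
  qed (auto simp: push_family_def)
qed

text \<open>Refine each interval of a given short family by a family that nearly attains the increment of the
variation on it.  The union of the refinements is again short, so the absolute continuity of \<open>u\<close>
applies to it.\<close>

lemma absolutely_continuous_on_total_variation:
  "absolutely_continuous_on a b (total_variation u a)"
  unfolding absolutely_continuous_on_alt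
proof (intro allI impI)
  fix \<epsilon> :: real assume "\<epsilon> > 0"
  then have e4: "\<epsilon> / 4 > 0" by simp
  obtain \<delta> where \<delta>: "\<delta> > 0" "\<And>D. interval_family a b D \<Longrightarrow> total_length D < \<delta> \<Longrightarrow> variation_over u D < \<epsilon> / 4"
    using u e4 unfolding absolutely_continuous_on_alt by meson
  show "\<exists>\<delta>>0. \<forall>D. interval_family a b D \<and> total_length D < \<delta> \<longrightarrow> variation_over (total_variation u a) D < \<epsilon>"
  proof (intro exI conjI allI impI)
    fix D assume D': "interval_family a b D \<and> total_length D < \<delta>"
    note D = D'[THEN conjunct1]
    have fin: "finite D" using D by (rule interval_family_finite)
    define e where "e = \<epsilon> / (4 * (real (card D) + 1))"
    have "e > 0" using \<open>\<epsilon> > 0\<close> by (simp add: e_def)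
    have "\<forall>I\<in>D. \<exists>E. interval_family (fst I) (snd I) E \<and> (\<forall>p q. (p, q) \<in> E \<longrightarrow> p < q) \<and>
        total_variation u a (snd I) - total_variation u a (fst I) \<le> variation_over u E + e"
    proof
      fix I assume "I \<in> D"
      then have I: "a \<le> fst I" "fst I \<le> snd I" "snd I \<le> b" using interval_familyD[OF D, of "fst I" "snd I"] by auto
      show "\<exists>E. interval_family (fst I) (snd I) E \<and> (\<forall>p q. (p, q) \<in> E \<longrightarrow> p < q) \<and>
        total_variation u a (snd I) - total_variation u a (fst I) \<le> variation_over u E + e"
        by (rule total_variation_increment_le[OF I \<open>e > 0\<close>]) blast
    qed
    then obtain E where E: "\<And>I. I \<in> D \<Longrightarrow> interval_family (fst I) (snd I) (E I)"
        "\<And>I p q. I \<in> D \<Longrightarrow> (p, q) \<in> E I \<Longrightarrow> p < q"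
        "\<And>I. I \<in> D \<Longrightarrow> total_variation u a (snd I) - total_variation u a (fst I) \<le> variation_over u (E I) + e"
      by (metis (lifting) bchoice)
    define U where "U = (\<Union>I\<in>D. E I)"
    have overlap: "I = J \<and> (p, q) = (p', q')"
      if "I \<in> D" "J \<in> D" "(p, q) \<in> E I" "(p', q') \<in> E J" "max p p' < min q q'" for I J p q p' q'
    proof -
      have "I = J"
        using interval_family_disjointD[OF D, of "fst I" "snd I" "fst J" "snd J"] that
          interval_familyD[OF E(1), of I p q] interval_familyD[OF E(1), of J p' q'] by (auto simp: prod_eq_iff)
      then show ?thesis using interval_family_disjointD[OF E(1), of I p q p' q'] that by auto
    qed
    have finE: "finite (E I)" if "I \<in> D" for I using E(1)[OF that] by (rule interval_family_finite)
    have "interval_family a b U"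
    proof (rule interval_familyI)
      show "finite U" unfolding U_def using fin finE by blast
      show "a \<le> p \<and> p \<le> q \<and> q \<le> b" if pq: "(p, q) \<in> U" for p q
      proof -
        obtain I where I: "I \<in> D" "(p, q) \<in> E I" using pq U_def by blast
        then show ?thesis using interval_familyD[OF E(1)[OF I(1)] I(2)] interval_familyD[OF D, of "fst I" "snd I"] by auto
      qed
      show "(p, q) = (p', q')" if "(p, q) \<in> U" "(p', q') \<in> U" "max p p' < min q q'" for p q p' q'
        using that overlap unfolding U_def by blast
    qed
    moreover have sumU: "(\<Sum>x\<in>U. F x) = (\<Sum>I\<in>D. \<Sum>x\<in>E I. F x)" for F :: "real \<times> real \<Rightarrow> real"
      unfolding U_def
    proof (rule sum.UNION_disjoint[OF fin], use finE in blast, intro ballI impI)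
      fix I J assume IJ: "I \<in> D" "J \<in> D" "I \<noteq> J"
      show "E I \<inter> E J = {}"
      proof (rule ccontr)
        assume "E I \<inter> E J \<noteq> {}"
        then obtain p q where "(p, q) \<in> E I" "(p, q) \<in> E J" by auto
        then show False using overlap[of I J p q p q] E(2)[of I p q] IJ by auto
      qed
    qed
    moreover have "total_length U < \<delta>"
    proof -
      have "total_length U = (\<Sum>I\<in>D. total_length (E I))" unfolding total_length_def by (rule sumU)
      also have "\<dots> \<le> (\<Sum>I\<in>D. snd I - fst I)"
        using interval_familyD[OF D] by (intro sum_mono total_length_le E) (metis prod.collapse)+
      also have "\<dots> = total_length D" unfolding total_length_def by (simp add: case_prod_unfold)
      finally show ?thesis using D' by simp
    qed
    ultimately have less: "variation_over u U < \<epsilon> / 4" using \<delta>(2) by blast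
    have "variation_over (total_variation u a) D = (\<Sum>I\<in>D. total_variation u a (snd I) - total_variation u a (fst I))"
      unfolding variation_over_def
    proof (rule sum.cong)
      fix I assume "I \<in> D"
      then have I: "a \<le> fst I" "fst I \<le> snd I" "snd I \<le> b" using interval_familyD[OF D, of "fst I" "snd I"] by auto
      then show "(case I of (s, t) \<Rightarrow> \<bar>total_variation u a t - total_variation u a s\<bar>) = total_variation u a (snd I) - total_variation u a (fst I)"
        using total_variation_increment_ge[OF I] by (simp add: case_prod_unfold)
    qed simp
    also have "\<dots> \<le> (\<Sum>I\<in>D. variation_over u (E I) + e)" by (rule sum_mono) (rule E)
    also have "\<dots> = variation_over u U + real (card D) * e"
      unfolding sum.distrib by (simp add: variation_over_def sumU)
    also have "real (card D) * e \<le> \<epsilon> / 4"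
      using \<open>\<epsilon> > 0\<close> by (simp add: e_def field_simps)
    finally show "variation_over (total_variation u a) D < \<epsilon>" using less \<open>\<epsilon> > 0\<close> by linarith
  qed (rule \<delta>(1))
qed

end


section \<open>Differentiation of absolutely continuous functions\<close>

text \<open>An open set of measure less than \<open>\<delta>\<close> around \<open>N\<close> contains a countable family of
non-overlapping intervals covering the points of \<open>N\<close> in \<open>[c, d]\<close>, and on each finite subfamily
the increments of \<open>F\<close> add up to less than \<open>\<epsilon>\<close>.\<close>

lemma interval_measure_null:
  assumes mono: "\<And>x y. x \<le> y \<Longrightarrow> F x \<le> F y" and cont: "continuous_on UNIV F"
    and ac: "absolutely_continuous_on c d F" and "c < d" and N: "N \<in> null_sets lborel"
  shows "emeasure (interval_measure F) (N \<inter> {c..d}) = 0"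
proof -
  let ?\<mu> = "interval_measure F"
  have Nb: "N \<in> sets borel" using N by auto
  have "emeasure ?\<mu> (N \<inter> {c..d}) \<le> 0 + ennreal \<epsilon>" if "\<epsilon> > 0" for \<epsilon>
  proof -
    obtain \<delta> where \<delta>: "\<delta> > 0" "\<And>D. interval_family c d D \<Longrightarrow> total_length D < \<delta> \<Longrightarrow> variation_over F D < \<epsilon>"
      using ac \<open>\<epsilon> > 0\<close> unfolding absolutely_continuous_on_alt by meson
    have "N \<in> sets lebesgue" using Nb by simp
    then obtain T where T: "open T" "N \<subseteq> T" "T - N \<in> lmeasurable" "emeasure lebesgue (T - N) < ennreal \<delta>"
      using \<delta>(1) by (rule sets_lebesgue_outer_open)
    have "emeasure lborel T = emeasure lborel (T - N)"
      by (rule emeasure_Diff_null_set[symmetric]) (use N T in auto)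
    then have T\<delta>: "emeasure lborel T < ennreal \<delta>"
      using T Nb by simp
    define g where "g x = (if x \<in> T then T else UNIV)" for x
    have "gauge g" using T(1) by (auto simp: gauge_def g_def)
    moreover have "N \<inter> {c..d} \<subseteq> cbox c d" "box c d \<noteq> {}" using \<open>c < d\<close> by auto
    ultimately obtain \<D> where \<D>: "countable \<D>" "\<Union>\<D> \<subseteq> cbox c d"
      "\<And>K. K \<in> \<D> \<Longrightarrow> interior K \<noteq> {} \<and> (\<exists>c d. K = cbox c d)"
      "pairwise (\<lambda>A B. interior A \<inter> interior B = {}) \<D>"
      "\<And>K. K \<in> \<D> \<Longrightarrow> \<exists>x \<in> (N \<inter> {c..d}) \<inter> K. K \<subseteq> g x" "N \<inter> {c..d} \<subseteq> \<Union>\<D>"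
      using covering_lemma[of "N \<inter> {c..d}" c d g] by (metis (no_types, lifting))
    have DT: "K \<subseteq> T" if "K \<in> \<D>" for K
      using \<D>(5)[OF that] T(2) unfolding g_def by fastforce
    have DI: "\<exists>p q. K = {p..q} \<and> p < q" if "K \<in> \<D>" for K
      using \<D>(3)[OF that] by (metis cbox_interval interior_cbox box_real(1) greaterThanLessThan_empty_iff not_le)
    define p where "p K = Inf K" for K :: "real set"
    define q where "q K = Sup K" for K :: "real set"
    have pq: "K = {p K..q K}" "p K < q K" if "K \<in> \<D>" for K
      using DI[OF that] by (auto simp: p_def q_def)
    have fin: "emeasure ?\<mu> (\<Union>\<K>) \<le> ennreal \<epsilon>" if K: "\<K> \<subseteq> \<D>" "finite \<K>" for \<K>
    proof -
      define D where "D = (\<lambda>K. (p K, q K)) ` \<K>"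
      have inj: "inj_on (\<lambda>K. (p K, q K)) \<K>"
        using pq K(1) unfolding inj_on_def by (metis Pair_inject subsetD)
      have same: "K = L" if "K \<in> \<K>" "L \<in> \<K>" "max (p K) (p L) < min (q K) (q L)" for K L
      proof (rule ccontr)
        assume "K \<noteq> L"
        then have "interior K \<inter> interior L = {}" using \<D>(4) K(1) that unfolding pairwise_def by blast
        moreover have "interior K = {p K<..<q K}" "interior L = {p L<..<q L}"
          using pq K(1) that by (metis interior_atLeastAtMost_real subsetD)+
        ultimately show False using that(3) by simp
      qed
      have fam: "interval_family c d D"
      proof (rule interval_familyI)
        show "finite D" using K(2) by (simp add: D_def)
        show "c \<le> s \<and> s \<le> t \<and> t \<le> d" if st: "(s, t) \<in> D" for s t
        proof -
          obtain L where L: "L \<in> \<K>" "s = p L" "t = q L" using st unfolding D_def by auto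
          then have L2: "L \<in> \<D>" using K(1) by blast
          then have "{p L..q L} \<subseteq> {c..d}" using pq(1)[OF L2] \<D>(2) by auto
          then show ?thesis using pq(2)[OF L2] L by auto
        qed
        show "(s, t) = (s', t')" if st: "(s, t) \<in> D" "(s', t') \<in> D" "max s s' < min t t'" for s t s' t'
        proof -
          obtain K' where K': "K' \<in> \<K>" "s = p K'" "t = q K'" using st(1) unfolding D_def by auto
          obtain L where L: "L \<in> \<K>" "s' = p L" "t' = q L" using st(2) unfolding D_def by auto
          show ?thesis using same[OF K'(1) L(1)] st(3) K' L by simp
        qed
      qed
      have "total_length D < \<delta>"
      proof -
        have "total_length D = (\<Sum>K\<in>\<K>. q K - p K)"
          unfolding total_length_def D_def by (subst sum.reindex[OF inj]) (simp add: case_prod_unfold)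
        also have "\<dots> = (\<Sum>K\<in>\<K>. measure lborel {p K<..<q K})"
          using pq(2) K(1) by (intro sum.cong) (auto simp: subset_iff less_imp_le)
        also have "\<dots> = measure lborel (\<Union>K\<in>\<K>. {p K<..<q K})"
        proof (rule measure_finite_Union[symmetric])
          show "emeasure lborel {p K<..<q K} \<noteq> \<infinity>" for K
            by (cases "p K \<le> q K") auto
          show "disjoint_family_on (\<lambda>K. {p K<..<q K}) \<K>"
            unfolding disjoint_family_on_def using same by fastforce
        qed (use K in auto)
        also have "\<dots> < \<delta>"
        proof -
          have "(\<Union>K\<in>\<K>. {p K<..<q K}) \<subseteq> T"
            using DT pq(1) K(1) by (smt (verit, ccfv_SIG) UN_least greaterThanLessThan_subseteq_atLeastAtMost_iff subset_eq)
          then have "emeasure lborel (\<Union>K\<in>\<K>. {p K<..<q K}) \<le> emeasure lborel T"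
            using T(1) by (intro emeasure_mono) auto
          then have "emeasure lborel (\<Union>K\<in>\<K>. {p K<..<q K}) < ennreal \<delta>" using T\<delta> by simp
          then show ?thesis unfolding measure_def
            by (cases "emeasure lborel (\<Union>K\<in>\<K>. {p K<..<q K})") (auto simp: ennreal_less_iff)
        qed
        finally show ?thesis .
      qed
      then have var: "variation_over F D < \<epsilon>" using \<delta>(2) fam by blast
      have "emeasure ?\<mu> (\<Union>\<K>) \<le> (\<Sum>K\<in>\<K>. emeasure ?\<mu> K)"
      proof -
        have "L \<in> sets borel" if "L \<in> \<K>" for L using pq(1)[of L] K(1) that by (metis atLeastAtMost_borel subsetD)
        then show ?thesis using emeasure_subadditive_finite[of \<K> "\<lambda>K. K" ?\<mu>] K(2) by auto
      qed
      also have "\<dots> = (\<Sum>K\<in>\<K>. ennreal (F (q K) - F (p K)))"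
      proof (rule sum.cong)
        fix L assume "L \<in> \<K>"
        then have L: "L \<in> \<D>" using K(1) by blast
        then show "emeasure ?\<mu> L = ennreal (F (q L) - F (p L))"
          using emeasure_interval_measure_Icc[of "p L" "q L" F] mono cont pq[OF L] by simp
      qed simp
      also have "\<dots> = ennreal (\<Sum>K\<in>\<K>. F (q K) - F (p K))"
        using pq(2) K(1) mono by (intro sum_ennreal) (auto simp: less_imp_le)
      also have "\<dots> \<le> ennreal (variation_over F D)"
        unfolding variation_over_def D_def
        by (subst sum.reindex[OF inj]) (auto simp: case_prod_unfold intro!: ennreal_leI sum_mono)
      also have "\<dots> \<le> ennreal \<epsilon>" using var by (intro ennreal_leI) simp
      finally show ?thesis .
    qed
    have "emeasure ?\<mu> (\<Union>\<D>) \<le> ennreal \<epsilon>"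
    proof (cases "\<D> = {}")
      case False
      define A where "A n = (\<Union>i<n. from_nat_into \<D> i)" for n :: nat
      have inD: "from_nat_into \<D> i \<in> \<D>" for i using False by (rule from_nat_into)
      have "\<Union>\<D> = (\<Union>i. from_nat_into \<D> i)"
        using range_from_nat_into[OF False \<D>(1)] by simp
      also have "\<dots> = (\<Union>n. A n)" unfolding A_def by blast
      finally have eq: "\<Union>\<D> = (\<Union>n. A n)" .
      have "(SUP n. emeasure ?\<mu> (A n)) = emeasure ?\<mu> (\<Union>n. A n)"
      proof (rule SUP_emeasure_incseq)
        have "from_nat_into \<D> i \<in> sets borel" for i
          using pq(1)[OF inD[of i]] by (metis atLeastAtMost_borel)
        then show "range A \<subseteq> sets ?\<mu>" unfolding A_def by auto
        show "incseq A" unfolding A_def incseq_def by fastforce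
      qed
      moreover have "emeasure ?\<mu> (A n) \<le> ennreal \<epsilon>" for n
        using fin[of "from_nat_into \<D> ` {..<n}"] inD unfolding A_def by auto
      ultimately show ?thesis unfolding eq by (metis SUP_least)
    qed simp
    moreover have "emeasure ?\<mu> (N \<inter> {c..d}) \<le> emeasure ?\<mu> (\<Union>\<D>)"
    proof (rule emeasure_mono[OF \<D>(6)])
      have "K \<in> sets borel" if "K \<in> \<D>" for K using pq(1)[OF that] by (metis atLeastAtMost_borel)
      then show "\<Union>\<D> \<in> sets ?\<mu>" using \<D>(1) by (auto intro: sets.countable_Union)
    qed
    ultimately show ?thesis by simp
  qed
  then show ?thesis by (metis ennreal_le_epsilon le_zero_eq)
qed

lemma monotone_absolutely_continuous_density:
  assumes mono: "\<And>x y. a \<le> x \<Longrightarrow> x \<le> y \<Longrightarrow> y \<le> b \<Longrightarrow> V x \<le> V y"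
    and ac: "absolutely_continuous_on a b V" and "a \<le> b"
  obtains g where "integrable lborel g" "\<And>x. a \<le> x \<Longrightarrow> x \<le> b \<Longrightarrow> (g has_integral (V x - V a)) {a..x}"
proof -
  define F where "F x = V (max a (min b x))" for x
  have F_eq: "F x = V x" if "a \<le> x" "x \<le> b" for x using that by (simp add: F_def)
  have F_mono: "F x \<le> F y" if "x \<le> y" for x y
    unfolding F_def using that \<open>a \<le> b\<close> by (intro mono) (auto simp: min_def max_def)
  have F_ac: "absolutely_continuous_on c d F" for c d
    unfolding F_def by (rule absolutely_continuous_on_compose[OF ac]) (use \<open>a \<le> b\<close> in \<open>auto simp: min_def max_def\<close>)
  have F_cont: "continuous_on UNIV F"
    unfolding F_def
    by (rule continuous_on_compose2[OF absolutely_continuous_on_imp_continuous_on[OF ac]])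
      (use \<open>a \<le> b\<close> in \<open>auto intro!: continuous_intros\<close>)
  let ?\<mu> = "interval_measure F"
  have "absolutely_continuous lborel ?\<mu>"
    unfolding absolutely_continuous_def
  proof
    fix N :: "real set" assume N: "N \<in> null_sets lborel"
    have "emeasure ?\<mu> (\<Union>n. N \<inter> {- real n - 1..real n + 1}) = 0"
      using N by (intro emeasure_UN_eq_0 interval_measure_null[OF F_mono F_cont F_ac]) auto
    moreover have "(\<Union>n. N \<inter> {- real n - 1..real n + 1}) = N"
    proof -
      have "\<exists>n. x \<in> {- real n - 1..real n + 1}" for x
      proof -
        obtain n where "\<bar>x\<bar> \<le> real n" using real_arch_simple by blast
        then show ?thesis by (intro exI[of _ n]) auto
      qed
      then show ?thesis by blast
    qed
    ultimately show "N \<in> null_sets ?\<mu>" using N by (simp add: null_sets_def)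
  qed
  moreover have "sets ?\<mu> = sets lborel" by simp
  ultimately obtain f where f: "f \<in> borel_measurable lborel" "density lborel f = ?\<mu>"
    using sigma_finite_measure.Radon_Nikodym[OF sigma_finite_lborel] by blast
  have nn: "(\<integral>\<^sup>+t. f t * indicator {a..x} t \<partial>lborel) = ennreal (V x - V a)" if "a \<le> x" "x \<le> b" for x
  proof -
    have "emeasure ?\<mu> {a..x} = (\<integral>\<^sup>+t. f t * indicator {a..x} t \<partial>lborel)"
      unfolding f(2)[symmetric] by (rule emeasure_density[OF f(1)]) simp
    then show ?thesis using emeasure_interval_measure_Icc[OF that(1) F_mono F_cont] F_eq that \<open>a \<le> b\<close> by simp
  qed
  have fin: "AE t in lborel. f t * indicator {a..b} t \<noteq> \<infinity>"
    using f nn[of b] \<open>a \<le> b\<close> by (intro nn_integral_noteq_infinite) auto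
  define g where "g t = enn2real (f t * indicator {a..b} t)" for t
  have [measurable]: "f \<in> borel_measurable borel" using f by simp
  have g_meas [measurable]: "g \<in> borel_measurable borel" unfolding g_def by measurable
  have g_nn: "(\<integral>\<^sup>+t. ennreal (g t * indicator {a..x} t) \<partial>lborel) = ennreal (V x - V a)" if "a \<le> x" "x \<le> b" for x
  proof -
    have "(\<integral>\<^sup>+t. ennreal (g t * indicator {a..x} t) \<partial>lborel) = (\<integral>\<^sup>+t. f t * indicator {a..x} t \<partial>lborel)"
    proof (rule nn_integral_cong_AE, use fin in eventually_elim)
      fix t assume "f t * indicator {a..b} t \<noteq> \<infinity>"
      then show "ennreal (g t * indicator {a..x} t) = f t * indicator {a..x} t"
        using that by (auto simp: g_def indicator_def less_top)
    qed
    then show ?thesis using nn that by simp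
  qed
  have gb: "g t * indicator {a..b} t = g t" for t by (simp add: g_def indicator_def)
  have g_int: "integrable lborel g"
  proof (rule integrableI_nonneg)
    have "(\<integral>\<^sup>+t. ennreal (g t) \<partial>lborel) = ennreal (V b - V a)" using g_nn[of b] gb \<open>a \<le> b\<close> by simp
    then show "(\<integral>\<^sup>+t. ennreal (g t) \<partial>lborel) < \<infinity>" by simp
  qed (auto simp: g_def)
  have "(g has_integral (V x - V a)) {a..x}" if "a \<le> x" "x \<le> b" for x
  proof -
    have si: "set_integrable lborel {a..x} g"
      unfolding set_integrable_def using g_int by (intro integrable_mult_indicator) auto
    have "(LINT t:{a..x}|lborel. g t) = V x - V a"
      unfolding set_lebesgue_integral_def
      by (subst integral_eq_nn_integral)
        (use g_nn[OF that] mono[OF order.refl that] in \<open>auto simp: g_def mult.commute\<close>)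
    then show ?thesis using set_borel_integral_eq_integral[OF si] by (simp add: has_integral_iff)
  qed
  with g_int show ?thesis by (rule that)
qed

text \<open>Jordan's decomposition: \<open>u\<close> is the difference of its total variation \<open>V\<close> and \<open>V - u\<close>, and both
are increasing and absolutely continuous.\<close>

lemma absolutely_continuous_density:
  assumes ac: "absolutely_continuous_on a b u" and "a \<le> b"
  obtains g where "integrable lborel g" "\<And>x. a \<le> x \<Longrightarrow> x \<le> b \<Longrightarrow> (g has_integral (u x - u a)) {a..x}"
proof -
  let ?V = "total_variation u a"
  note V_ac = absolutely_continuous_on_total_variation[OF assms]
  note inc = total_variation_increment_ge[OF assms]
  obtain g where g: "integrable lborel g" "\<And>x. a \<le> x \<Longrightarrow> x \<le> b \<Longrightarrow> (g has_integral (?V x - ?V a)) {a..x}"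
    using monotone_absolutely_continuous_density[of a b ?V] V_ac inc \<open>a \<le> b\<close> by (smt (verit, best))
  have W_ac: "absolutely_continuous_on a b (\<lambda>x. ?V x + - u x)"
    by (intro absolutely_continuous_on_add absolutely_continuous_on_uminus V_ac ac)
  obtain h where h: "integrable lborel h"
      "\<And>x. a \<le> x \<Longrightarrow> x \<le> b \<Longrightarrow> (h has_integral ((?V x + - u x) - (?V a + - u a))) {a..x}"
    using monotone_absolutely_continuous_density[of a b "\<lambda>x. ?V x + - u x"] W_ac inc \<open>a \<le> b\<close> by (smt (verit, best))
  show ?thesis
  proof
    show "integrable lborel (\<lambda>x. g x - h x)" using g h by auto
    fix x assume "a \<le> x" "x \<le> b"
    from has_integral_diff[OF g(2)[OF this] h(2)[OF this]]
    show "((\<lambda>x. g x - h x) has_integral (u x - u a)) {a..x}" by (simp add: algebra_simps)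
  qed
qed

text \<open>The fundamental theorem of calculus holds with the density of \<open>u\<close>.  Lebesgue's differentiation theorem,
applied to the density and to its reflection, gives the right and the left derivatives.\<close>

theorem absolutely_continuous_on_derivative:
  assumes ac: "absolutely_continuous_on a b u" and "a \<le> b"
  obtains g where "integrable lborel g" "\<And>x. a \<le> x \<Longrightarrow> x \<le> b \<Longrightarrow> (g has_integral (u x - u a)) {a..x}"
    "AE x in lebesgue. x \<in> {a<..<b} \<longrightarrow> (u has_real_derivative g x) (at x)"
proof -
  obtain g where g: "integrable lborel g" "\<And>x. a \<le> x \<Longrightarrow> x \<le> b \<Longrightarrow> (g has_integral (u x - u a)) {a..x}"
    using absolutely_continuous_density[OF assms] by blast
  have gi: "g integrable_on {c..d}" for c d
  proof -
    have "set_integrable lborel {c..d} g"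
      unfolding set_integrable_def using g(1) by (intro integrable_mult_indicator) auto
    then show ?thesis by (rule set_borel_integral_eq_integral)
  qed
  have inc: "integral {x..y} g = u y - u x" if "a \<le> x" "x \<le> y" "y \<le> b" for x y
  proof -
    have "integral {a..x} g + integral {x..y} g = integral {a..y} g"
      using that gi by (intro Henstock_Kurzweil_Integration.integral_combine) auto
    moreover have "integral {a..x} g = u x - u a" "integral {a..y} g = u y - u a"
      using g(2)[of x] g(2)[of y] that by (auto simp: has_integral_iff)
    ultimately show ?thesis by linarith
  qed
  have "\<And>c d. g integrable_on cbox c d" using gi by simp
  then obtain N where N: "negligible N"
    "\<And>x e. x \<notin> N \<Longrightarrow> 0 < e \<Longrightarrow> \<exists>d>0. \<forall>h. 0 < h \<and> h < d \<longrightarrow>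
       norm (integral (cbox x (x + h *\<^sub>R One)) g /\<^sub>R h ^ DIM(real) - g x) < e"
    using integrable_ccontinuous_explicit[of g] by metis
  have gi': "(\<lambda>x. g (- x)) integrable_on cbox c d" for c d
    using gi[of "- d" "- c"] Henstock_Kurzweil_Integration.integrable_reflect_real[where f = g and a = "- d" and b = "- c"] by simp
  obtain N' where N': "negligible N'"
    "\<And>x e. x \<notin> N' \<Longrightarrow> 0 < e \<Longrightarrow> \<exists>d>0. \<forall>h. 0 < h \<and> h < d \<longrightarrow>
       norm (integral (cbox x (x + h *\<^sub>R One)) (\<lambda>x. g (- x)) /\<^sub>R h ^ DIM(real) - g (- x)) < e"
    using integrable_ccontinuous_explicit[of "\<lambda>x. g (- x)"] gi' by metis
  have neg: "negligible (N \<union> uminus ` N')"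
    using N(1) N'(1) by (auto intro!: negligible_differentiable_image_negligible derivative_intros)
  have der: "(u has_real_derivative g x) (at x)" if x: "x \<in> {a<..<b}" "x \<notin> N \<union> uminus ` N'" for x
    unfolding DERIV_def LIM_eq
  proof (intro allI impI)
    fix e :: real assume "e > 0"
    have xN: "x \<notin> N" "- x \<notin> N'" using x(2) by (auto simp: image_iff)
    obtain d1 where d1: "d1 > 0" "\<And>h. 0 < h \<Longrightarrow> h < d1 \<Longrightarrow> \<bar>integral {x..x + h} g / h - g x\<bar> < e"
      using N(2)[OF xN(1) \<open>e > 0\<close>] by (auto simp: divide_inverse_commute)
    obtain d2 where d2: "d2 > 0" "\<And>h. 0 < h \<Longrightarrow> h < d2 \<Longrightarrow> \<bar>integral {- x..- x + h} (\<lambda>x. g (- x)) / h - g x\<bar> < e"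
      using N'(2)[OF xN(2) \<open>e > 0\<close>] by (auto simp: divide_inverse_commute)
    define d where "d = Min {d1, d2, x - a, b - x}"
    have d: "d > 0" "d \<le> d1" "d \<le> d2" "d \<le> x - a" "d \<le> b - x" using x(1) d1(1) d2(1) by (auto simp: d_def)
    show "\<exists>s>0. \<forall>h. h \<noteq> 0 \<and> norm (h - 0) < s \<longrightarrow> norm ((u (x + h) - u x) / h - g x) < e"
    proof (intro exI conjI allI impI)
      fix h :: real assume h: "h \<noteq> 0 \<and> norm (h - 0) < d"
      show "norm ((u (x + h) - u x) / h - g x) < e"
      proof (cases "h > 0")
        case True
        then have "integral {x..x + h} g = u (x + h) - u x" using h d x(1) by (intro inc) auto
        then show ?thesis using d1(2)[OF True] h d by auto
      next
        case False
        define k where "k = - h"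
        have k: "k > 0" "k < d" using h False by (auto simp: k_def)
        have "integral {- x..- x + k} (\<lambda>x. g (- x)) = integral {x - k..x} g"
          using Henstock_Kurzweil_Integration.integral_reflect_real[of "x" "x - k" g] by (simp add: algebra_simps)
        also have "\<dots> = u x - u (x - k)" using k d x(1) by (intro inc) auto
        finally have eq: "integral {- x..- x + k} (\<lambda>x. g (- x)) = u x - u (x - k)" .
        have "(u (x + h) - u x) / h = integral {- x..- x + k} (\<lambda>x. g (- x)) / k"
          unfolding eq using k by (simp add: k_def field_simps)
        then show ?thesis using d2(2)[OF k(1)] k d by auto
      qed
    qed (rule d(1))
  qed
  have "AE x in lebesgue. x \<notin> N \<union> uminus ` N'"
    using neg by (intro AE_not_in) (simp add: negligible_iff_null_sets)
  then have "AE x in lebesgue. x \<in> {a<..<b} \<longrightarrow> (u has_real_derivative g x) (at x)"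
    by eventually_elim (use der in blast)
  with g show ?thesis by (rule that)
qed


section \<open>The cost of a path\<close>

text \<open>The integral is taken over the open interval, where the derivative depends on the values of the
path in that interval only; this makes the cost of a concatenation the sum of the costs.\<close>

definition cost :: "(real \<times> real \<times> real \<Rightarrow> real) \<Rightarrow> (real \<Rightarrow> real) \<Rightarrow> real \<Rightarrow> real \<Rightarrow> ennreal" where
  "cost F u a b = (\<integral>\<^sup>+x. ennreal (F (x, u x, deriv u x)) * indicator {a<..<b} x \<partial>lebesgue)"

lemma AE_lebesgue_neq: "AE x in lebesgue. x \<noteq> (c :: real)"
  by (rule AE_completion) (rule AE_lborel_singleton)

text \<open>Borel functions that stand for a path and its derivative.  They turn costs into integrals of Borel
functions, to which linearity and substitution apply.\<close>

definition borel_representation :: "real \<Rightarrow> real \<Rightarrow> (real \<Rightarrow> real) \<Rightarrow> (real \<Rightarrow> real) \<Rightarrow> (real \<Rightarrow> real) \<Rightarrow> bool" where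
  "borel_representation a b u v g \<longleftrightarrow> v \<in> borel_measurable borel \<and> integrable lborel g \<and>
     (\<forall>x\<in>{a..b}. v x = u x) \<and> (\<forall>x\<in>{a..b}. (g has_integral (u x - u a)) {a..x}) \<and>
     (AE x in lebesgue. x \<in> {a<..<b} \<longrightarrow> (u has_real_derivative g x) (at x))"

lemma borel_representation_exists:
  assumes ac: "absolutely_continuous_on a b u" and "a \<le> b"
  obtains v g where "borel_representation a b u v g"
proof -
  obtain g where g: "integrable lborel g" "\<And>x. a \<le> x \<Longrightarrow> x \<le> b \<Longrightarrow> (g has_integral (u x - u a)) {a..x}"
    "AE x in lebesgue. x \<in> {a<..<b} \<longrightarrow> (u has_real_derivative g x) (at x)"
    using absolutely_continuous_on_derivative[OF assms] by blast
  define v where "v x = u (max a (min b x))" for x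
  have "continuous_on UNIV v"
    unfolding v_def
    by (rule continuous_on_compose2[OF absolutely_continuous_on_imp_continuous_on[OF ac]])
      (use \<open>a \<le> b\<close> in \<open>auto intro!: continuous_intros\<close>)
  then have "v \<in> borel_measurable borel" by (rule borel_measurable_continuous_onI)
  with g have "borel_representation a b u v g"
    unfolding borel_representation_def by (auto simp: v_def)
  then show ?thesis by (rule that)
qed

lemma borel_representation_cost:
  assumes "borel_representation a b u v g" "a \<le> c" "d \<le> b"
  shows "cost F u c d = (\<integral>\<^sup>+x. ennreal (F (x, v x, g x)) * indicator {c<..<d} x \<partial>lborel)"
proof -
  have v: "\<And>x. x \<in> {a..b} \<Longrightarrow> v x = u x"
    and ae: "AE x in lebesgue. x \<in> {a<..<b} \<longrightarrow> (u has_real_derivative g x) (at x)"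
    using assms(1) by (auto simp: borel_representation_def)
  have "cost F u c d = (\<integral>\<^sup>+x. ennreal (F (x, v x, g x)) * indicator {c<..<d} x \<partial>lebesgue)"
    unfolding cost_def
  proof (rule nn_integral_cong_AE, use ae in eventually_elim)
    fix x assume *: "x \<in> {a<..<b} \<longrightarrow> (u has_real_derivative g x) (at x)"
    show "ennreal (F (x, u x, deriv u x)) * indicator {c<..<d} x = ennreal (F (x, v x, g x)) * indicator {c<..<d} x"
      using * v[of x] assms(2,3) by (cases "x \<in> {c<..<d}") (auto dest!: DERIV_imp_deriv)
  qed
  then show ?thesis by (simp add: nn_integral_completion)
qed

lemma borel_representation_measurable:
  assumes "borel_representation a b u v g"
  shows "v \<in> borel_measurable borel" "g \<in> borel_measurable borel" "integrable lborel g"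
  using assms by (auto simp: borel_representation_def)

lemma integrand_measurable [measurable]:
  assumes "F \<in> borel_measurable borel" "v \<in> borel_measurable borel" "g \<in> borel_measurable borel"
  shows "(\<lambda>x::real. F (x, v x :: real, g x :: real) :: real) \<in> borel_measurable borel"
  using assms by (intro measurable_compose[OF _ assms(1)] borel_measurable_Pair) auto

lemma cost_split:
  assumes ac: "absolutely_continuous_on a b u" and "a \<le> c" "c \<le> b" and F: "F \<in> borel_measurable borel"
  shows "cost F u a b = cost F u a c + cost F u c b"
proof -
  have "a \<le> b" using assms by simp
  then obtain v g where vg: "borel_representation a b u v g"
    using borel_representation_exists[OF ac \<open>a \<le> b\<close>] by metis
  note meas = borel_representation_measurable[OF vg]
  note cost_vg = borel_representation_cost[OF vg]
  have [measurable]: "(\<lambda>x. F (x, v x, g x)) \<in> borel_measurable borel"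
    using F meas by (intro integrand_measurable) auto
  have "cost F u a b = (\<integral>\<^sup>+x. ennreal (F (x, v x, g x)) * indicator {a<..<c} x + ennreal (F (x, v x, g x)) * indicator {c<..<b} x \<partial>lborel)"
    unfolding cost_vg[OF order.refl order.refl]
  proof (rule nn_integral_cong_AE, use AE_lborel_singleton[of c] in eventually_elim)
    fix x assume "x \<noteq> c"
    then show "ennreal (F (x, v x, g x)) * indicator {a<..<b} x =
      ennreal (F (x, v x, g x)) * indicator {a<..<c} x + ennreal (F (x, v x, g x)) * indicator {c<..<b} x"
      using assms by (auto simp: indicator_def)
  qed
  also have "\<dots> = cost F u a c + cost F u c b"
    using assms by (subst nn_integral_add) (auto simp: cost_vg)
  finally show ?thesis .
qed

lemma cost_cong:
  assumes "\<And>x. a < x \<Longrightarrow> x < b \<Longrightarrow> u x = v x"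
  shows "cost F u a b = cost F v a b"
  unfolding cost_def
proof (rule nn_integral_cong)
  fix x
  show "ennreal (F (x, u x, deriv u x)) * indicator {a<..<b} x = ennreal (F (x, v x, deriv v x)) * indicator {a<..<b} x"
  proof (cases "x \<in> {a<..<b}")
    case True
    then have "\<forall>\<^sub>F y in nhds x. y \<in> {a<..<b}" by (intro eventually_nhds_in_open) auto
    then have "\<forall>\<^sub>F y in nhds x. u y = v y" by eventually_elim (use assms in auto)
    then have "deriv u x = deriv v x" by (rule deriv_cong_ev) simp
    with True assms show ?thesis by auto
  qed simp
qed

lemma cost_empty [simp]: "b \<le> a \<Longrightarrow> cost F u a b = 0"
  by (simp add: cost_def)

lemma cost_mono_interval: "a \<le> c \<Longrightarrow> d \<le> b \<Longrightarrow> cost F u c d \<le> cost F u a b"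
  unfolding cost_def by (intro nn_integral_mono) (auto simp: indicator_def)

lemma cost_affine_le:
  assumes u: "\<And>x. a < x \<Longrightarrow> x < b \<Longrightarrow> u x = y0 + m * (x - x0)" and "a \<le> b"
    and F: "\<And>x. a < x \<Longrightarrow> x < b \<Longrightarrow> F (x, y0 + m * (x - x0), m) \<le> B"
  shows "cost F u a b \<le> ennreal (B * (b - a))"
proof -
  let ?l = "\<lambda>x. y0 + m * (x - x0)"
  have "deriv ?l x = m" for x
    by (rule DERIV_imp_deriv) (auto intro!: derivative_eq_intros)
  then have "cost F ?l a b \<le> (\<integral>\<^sup>+x. ennreal B * indicator {a<..<b} x \<partial>lebesgue)"
    unfolding cost_def by (intro nn_integral_mono) (auto simp: indicator_def intro!: ennreal_leI F)
  also have "\<dots> = ennreal (B * (b - a))"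
    using \<open>a \<le> b\<close> by (simp add: nn_integral_cmult_indicator ennreal_mult'')
  finally show ?thesis using cost_cong[of a b u ?l F] u by simp
qed

text \<open>The climb is the integral of the derivative, to whose absolute value the growth condition applies;
the constant in that condition becomes an error proportional to the time taken.\<close>

lemma cost_ge_climb:
  assumes ac: "absolutely_continuous_on a b u" and "a \<le> b" and F: "F \<in> borel_measurable borel"
    and nonneg: "K \<ge> 0" "C \<ge> 0" and growth: "\<And>x y p. F (x, y, p) \<ge> K * \<bar>p\<bar> - C"
  shows "ennreal (K * \<bar>u b - u a\<bar>) \<le> cost F u a b + ennreal (C * (b - a))"
proof -
  obtain v g where vg: "borel_representation a b u v g"
    using borel_representation_exists[OF ac \<open>a \<le> b\<close>] by metis
  note meas = borel_representation_measurable[OF vg]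
  note cost_vg = borel_representation_cost[OF vg]
  have [measurable]: "(\<lambda>x. F (x, v x, g x)) \<in> borel_measurable borel"
    using F meas by (intro integrand_measurable) auto
  have si: "set_integrable lborel {a..b} g"
    unfolding set_integrable_def using meas(3) by (intro integrable_mult_indicator) auto
  have "u b - u a = (LINT x:{a..b}|lborel. g x)"
    using vg \<open>a \<le> b\<close> set_borel_integral_eq_integral[OF si] by (simp add: has_integral_iff borel_representation_def)
  then have "ennreal \<bar>u b - u a\<bar> \<le> (\<integral>\<^sup>+x. ennreal (norm (indicator {a..b} x *\<^sub>R g x)) \<partial>lborel)"
    using integral_norm_bound_ennreal[of lborel "\<lambda>x. indicator {a..b} x *\<^sub>R g x"] si
    by (simp add: set_lebesgue_integral_def set_integrable_def)
  then have "ennreal (K * \<bar>u b - u a\<bar>) \<le> ennreal K * (\<integral>\<^sup>+x. ennreal (norm (indicator {a..b} x *\<^sub>R g x)) \<partial>lborel)"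
    using nonneg by (simp add: ennreal_mult mult_left_mono)
  also have "\<dots> = (\<integral>\<^sup>+x. ennreal K * ennreal (norm (indicator {a..b} x *\<^sub>R g x)) \<partial>lborel)"
    using meas by (intro nn_integral_cmult[symmetric]) auto
  also have "\<dots> \<le> (\<integral>\<^sup>+x. ennreal (F (x, v x, g x)) * indicator {a<..<b} x + ennreal C * indicator {a<..<b} x \<partial>lborel)"
  proof (rule nn_integral_mono_AE, use AE_lborel_singleton[of a] AE_lborel_singleton[of b] in eventually_elim)
    fix x assume "x \<noteq> a" "x \<noteq> b"
    have "ennreal (K * \<bar>g x\<bar>) \<le> ennreal (F (x, v x, g x)) + ennreal C"
    proof (cases "F (x, v x, g x) \<ge> 0")
      case True
      then show ?thesis
        using growth[of "g x" x "v x"] nonneg by (simp add: ennreal_plus[symmetric] ennreal_leI del: ennreal_plus)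
    next
      case False
      then have "ennreal (K * \<bar>g x\<bar>) \<le> ennreal C"
        using growth[of "g x" x "v x"] by (intro ennreal_leI) linarith
      then show ?thesis by (simp add: add_increasing)
    qed
    then show "ennreal K * ennreal (norm (indicator {a..b} x *\<^sub>R g x))
        \<le> ennreal (F (x, v x, g x)) * indicator {a<..<b} x + ennreal C * indicator {a<..<b} x"
      using \<open>x \<noteq> a\<close> \<open>x \<noteq> b\<close> nonneg by (auto simp: indicator_def ennreal_mult)
  qed
  also have "\<dots> = cost F u a b + ennreal (C * (b - a))"
    using \<open>a \<le> b\<close> nonneg
    by (subst nn_integral_add) (auto simp: cost_vg nn_integral_cmult_indicator ennreal_mult)
  finally show ?thesis .
qed

lemma cost_glue:
  assumes "a \<le> c" "c \<le> b" "absolutely_continuous_on a c u" "absolutely_continuous_on c b v" "u c = v c"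
    and "F \<in> borel_measurable borel"
  shows "cost F (\<lambda>x. if x \<le> c then u x else v x) a b = cost F u a c + cost F v c b"
proof -
  let ?w = "\<lambda>x. if x \<le> c then u x else v x"
  have "cost F ?w a b = cost F ?w a c + cost F ?w c b"
    using assms by (intro cost_split absolutely_continuous_on_glue)
  moreover have "cost F ?w a c = cost F u a c" by (rule cost_cong) simp
  moreover have "cost F ?w c b = cost F v c b" by (rule cost_cong) simp
  ultimately show ?thesis by simp
qed

section \<open>Near-minimizers and reflections\<close>

definition near_minimizer ::
  "(real \<times> real \<times> real \<Rightarrow> real) \<Rightarrow> real \<Rightarrow> (real \<Rightarrow> real) \<Rightarrow> real \<Rightarrow> real \<Rightarrow> bool" where
  "near_minimizer F \<epsilon> u a b \<longleftrightarrow> absolutely_continuous_on a b u \<and> cost F u a b < \<infinity> \<and>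
     (\<forall>v. absolutely_continuous_on a b v \<and> v a = u a \<and> v b = u b \<longrightarrow> cost F u a b \<le> cost F v a b + ennreal \<epsilon>)"

text \<open>A competitor on a part is a competitor on the whole after gluing, and the cost of the rest, being
finite, can be cancelled.\<close>

lemma near_minimizer_subinterval:
  assumes u: "near_minimizer F \<epsilon> u a b" and "a \<le> c" "c \<le> d" "d \<le> b" and F: "F \<in> borel_measurable borel"
  shows "near_minimizer F \<epsilon> u c d"
  unfolding near_minimizer_def
proof (intro conjI allI impI)
  have ac: "absolutely_continuous_on a b u" and fin: "cost F u a b < \<infinity>"
    using u by (auto simp: near_minimizer_def)
  have ac': "absolutely_continuous_on s t u" if "a \<le> s" "t \<le> b" for s t
    using ac that by (rule absolutely_continuous_on_subinterval)
  show "absolutely_continuous_on c d u" using assms by (intro ac')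
  show "cost F u c d < \<infinity>" using cost_mono_interval[of a c d b F u] fin assms by (meson order.strict_trans1)
  fix v assume v: "absolutely_continuous_on c d v \<and> v c = u c \<and> v d = u d"
  let ?w = "\<lambda>x. if x \<le> d then v x else u x"
  let ?z = "\<lambda>x. if x \<le> c then u x else ?w x"
  have w: "absolutely_continuous_on c b ?w"
    by (rule absolutely_continuous_on_glue) (use v assms in \<open>auto intro: ac'\<close>)
  have z: "absolutely_continuous_on a b ?z"
    by (rule absolutely_continuous_on_glue[OF _ w]) (use v assms in \<open>auto intro: ac'\<close>)
  have "?z a = u a" "?z b = u b" using assms v by auto
  with z have le: "cost F u a b \<le> cost F ?z a b + ennreal \<epsilon>"
    using u unfolding near_minimizer_def by blast
  have "cost F ?z a b = cost F u a c + cost F ?w c b"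
    by (rule cost_glue[OF _ _ _ w]) (use v assms in \<open>auto intro: ac'\<close>)
  also have "cost F ?w c b = cost F v c d + cost F u d b"
    by (rule cost_glue) (use v assms in \<open>auto intro: ac'\<close>)
  finally have "cost F ?z a b = cost F u a c + (cost F v c d + cost F u d b)" .
  moreover have "cost F u a b = cost F u a c + (cost F u c d + cost F u d b)"
    using cost_split[OF ac, of c] cost_split[OF ac'[of c b], of d] assms by simp
  ultimately have "cost F u a c + cost F u d b + cost F u c d \<le> cost F u a c + cost F u d b + (cost F v c d + ennreal \<epsilon>)"
    using le by (simp add: ac_simps)
  moreover have "cost F u a c + cost F u d b < \<infinity>"
    using cost_mono_interval[of a a c b F u] cost_mono_interval[of a d b b F u] fin assms
    by (auto intro: order.strict_trans1)
  ultimately show "cost F u c d \<le> cost F v c d + ennreal \<epsilon>"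
    by (auto simp: ennreal_add_left_cancel_le)
qed

text \<open>Adding the constant \<open>c\<close> makes the integrand nonnegative, and the action changes by \<open>c * (b - a)\<close>
independently of the path; so minimizing the action is minimizing the cost of \<open>L + c\<close>.\<close>

lemma action_eq_cost:
  assumes ac: "absolutely_continuous_on a b u" and "a \<le> b" and L: "L \<in> borel_measurable borel"
    and c: "c \<ge> 0" "\<And>z. L z \<ge> - c"
  shows "action L u a b = enn2ereal (cost (\<lambda>z. L z + c) u a b) - ereal (c * (b - a))"
proof -
  obtain v g where vg: "borel_representation a b u v g"
    using borel_representation_exists[OF ac \<open>a \<le> b\<close>] by metis
  note meas = borel_representation_measurable[OF vg]
  note cost_vg = borel_representation_cost[OF vg]
  have [measurable]: "(\<lambda>x. L (x, v x, g x)) \<in> borel_measurable borel"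
    using L meas by (intro integrand_measurable) auto
  have part: "(\<integral>\<^sup>+x. ennreal (G (x, u x, deriv u x)) \<partial>lebesgue_on {a..b}) = cost G u a b" for G
  proof -
    have "(\<integral>\<^sup>+x. ennreal (G (x, u x, deriv u x)) \<partial>lebesgue_on {a..b})
        = (\<integral>\<^sup>+x. ennreal (G (x, u x, deriv u x)) * indicator {a..b} x \<partial>lebesgue)"
      by (rule nn_integral_restrict_space) auto
    also have "\<dots> = cost G u a b"
      unfolding cost_def
      by (rule nn_integral_cong_AE, use AE_lebesgue_neq[of a] AE_lebesgue_neq[of b] in eventually_elim)
        (auto simp: indicator_def)
    finally show ?thesis .
  qed
  let ?P = "cost L u a b" and ?N = "cost (\<lambda>z. - L z) u a b" and ?Q = "cost (\<lambda>z. L z + c) u a b"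
  have act: "action L u a b = enn2ereal ?P - enn2ereal ?N"
    unfolding action_def extended_integral_def by (simp add: part[of L] part[of "\<lambda>z. - L z"])
  have N_le: "?N \<le> ennreal (c * (b - a))"
  proof -
    have "?N \<le> (\<integral>\<^sup>+x. ennreal c * indicator {a<..<b} x \<partial>lborel)"
      unfolding cost_vg[OF order.refl order.refl] using c(2)
      by (intro nn_integral_mono) (auto simp: indicator_def minus_le_iff intro!: ennreal_leI)
    also have "\<dots> = ennreal (c * (b - a))" using \<open>a \<le> b\<close> c by (simp add: nn_integral_cmult_indicator ennreal_mult)
    finally show ?thesis .
  qed
  have "?Q + ?N = (\<integral>\<^sup>+x. ennreal (L (x, v x, g x) + c) * indicator {a<..<b} x + ennreal (- L (x, v x, g x)) * indicator {a<..<b} x \<partial>lborel)"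
    unfolding cost_vg[OF order.refl order.refl] by (rule nn_integral_add[symmetric]) auto
  also have "\<dots> = (\<integral>\<^sup>+x. ennreal (L (x, v x, g x)) * indicator {a<..<b} x + ennreal c * indicator {a<..<b} x \<partial>lborel)"
  proof (rule nn_integral_cong)
    fix x
    let ?l = "L (x, v x, g x)"
    have "ennreal (?l + c) + ennreal (- ?l) = ennreal ?l + ennreal c"
      using c(2)[of "(x, v x, g x)"] c(1)
      by (cases "?l \<ge> 0") (auto simp: ennreal_neg ennreal_plus[symmetric] simp del: ennreal_plus)
    then show "ennreal (?l + c) * indicator {a<..<b} x + ennreal (- ?l) * indicator {a<..<b} x
        = ennreal ?l * indicator {a<..<b} x + ennreal c * indicator {a<..<b} x"
      by (simp add: indicator_def)
  qed
  also have "\<dots> = ?P + ennreal (c * (b - a))"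
    unfolding cost_vg[OF order.refl order.refl] using \<open>a \<le> b\<close> c
    by (subst nn_integral_add) (auto simp: nn_integral_cmult_indicator ennreal_mult)
  finally have eq: "?Q + ?N = ?P + ennreal (c * (b - a))" .
  obtain n where n: "?N = ennreal n" "n \<ge> 0" using N_le by (metis ennreal_cases ennreal_less_top leD top.not_eq_extremum)
  have cn: "c * (b - a) \<ge> 0" using c \<open>a \<le> b\<close> by simp
  show ?thesis
  proof (cases ?P)
    case (real p)
    have "?P + ennreal (c * (b - a)) = ennreal (p + c * (b - a))"
      using real cn by (simp add: ennreal_plus[symmetric] del: ennreal_plus)
    then have "?Q \<noteq> top" using eq by (metis ennreal_add_eq_top ennreal_neq_top)
    then obtain q where q: "?Q = ennreal q" "q \<ge> 0" by (metis ennreal_cases)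
    then have "q + n = p + c * (b - a)"
      using eq n real cn by (simp add: ennreal_plus[symmetric] del: ennreal_plus)
    then show ?thesis unfolding act using real q n by (simp add: enn2ereal_ennreal)
  next
    case top
    then have "?Q = top" using eq n by (auto simp: ennreal_add_eq_top)
    then show ?thesis unfolding act using top n by (simp add: enn2ereal_ennreal)
  qed
qed

lemma near_minimizer_of_excess:
  assumes ac: "absolutely_continuous_on a b u" and "a \<le> b" and L: "L \<in> borel_measurable borel"
    and c: "c \<ge> 0" "\<And>z. L z \<ge> - c" and ex: "excess L u a b < ereal \<epsilon>" and "\<epsilon> \<ge> 0"
  shows "near_minimizer (\<lambda>z. L z + c) \<epsilon> u a b"
  unfolding near_minimizer_def
proof (intro conjI allI impI)
  let ?F = "\<lambda>z. L z + c"
  have act: "action L v a b = enn2ereal (cost ?F v a b) - ereal (c * (b - a))"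
    if "absolutely_continuous_on a b v" for v
    using action_eq_cost[OF that \<open>a \<le> b\<close> L c] .
  show "absolutely_continuous_on a b u" by (rule ac)
  have "cost ?F u a b \<noteq> \<infinity>"
  proof
    assume "cost ?F u a b = \<infinity>"
    then have "action L u a b = \<infinity>" using act[OF ac] by simp
    then have "excess L u a b = \<infinity>" unfolding excess_def by simp
    with ex show False by simp
  qed
  then show fin: "cost ?F u a b < \<infinity>" by (simp add: top.not_eq_extremum)
  fix v assume v: "absolutely_continuous_on a b v \<and> v a = u a \<and> v b = u b"
  show "cost ?F u a b \<le> cost ?F v a b + ennreal \<epsilon>"
  proof (cases "cost ?F v a b")
    case (real q)
    obtain p where p: "cost ?F u a b = ennreal p" "p \<ge> 0" using fin by (metis ennreal_cases less_irrefl infinity_ennreal_def)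
    have "min_action L a (u a) b (u b) \<le> action L v a b"
      unfolding min_action_def by (rule INF_lower) (use v in auto)
    moreover have "action L v a b = ereal (q - c * (b - a))"
      using act v real by (simp add: enn2ereal_ennreal)
    moreover have "action L u a b = ereal (p - c * (b - a))"
      using act[OF ac] p by (simp add: enn2ereal_ennreal)
    ultimately have "p \<le> q + \<epsilon>"
      using ex unfolding excess_def by (cases "min_action L a (u a) b (u b)") auto
    then show ?thesis using p real \<open>\<epsilon> \<ge> 0\<close> by (simp add: ennreal_plus[symmetric] ennreal_leI del: ennreal_plus)
  qed simp
qed


definition reflect_value :: "(real \<times> real \<times> real \<Rightarrow> real) \<Rightarrow> real \<times> real \<times> real \<Rightarrow> real" where
  "reflect_value F = (\<lambda>(x, y, p). F (x, - y, - p))"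

definition reflect_time :: "(real \<times> real \<times> real \<Rightarrow> real) \<Rightarrow> real \<times> real \<times> real \<Rightarrow> real" where
  "reflect_time F = (\<lambda>(x, y, p). F (- x, y, - p))"

lemma reflect_measurable:
  assumes "F \<in> borel_measurable borel"
  shows "reflect_value F \<in> borel_measurable borel" "reflect_time F \<in> borel_measurable borel"
proof -
  have "(\<lambda>z::real \<times> real \<times> real. (fst z, - fst (snd z), - snd (snd z))) \<in> borel_measurable borel"
    "(\<lambda>z::real \<times> real \<times> real. (- fst z, fst (snd z), - snd (snd z))) \<in> borel_measurable borel"
    by (intro borel_measurable_continuous_onI continuous_intros)+
  from this[THEN measurable_compose, OF assms]
  show "reflect_value F \<in> borel_measurable borel" "reflect_time F \<in> borel_measurable borel"
    by (simp_all add: reflect_value_def reflect_time_def case_prod_unfold)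
qed

lemma cost_reflect_value:
  assumes ac: "absolutely_continuous_on a b u" and "a \<le> b"
  shows "cost (reflect_value F) (\<lambda>x. - u x) a b = cost F u a b"
proof -
  obtain v g where vg: "borel_representation a b u v g"
    using borel_representation_exists[OF ac \<open>a \<le> b\<close>] by metis
  then have ae: "AE x in lebesgue. x \<in> {a<..<b} \<longrightarrow> (u has_real_derivative g x) (at x)"
    by (simp add: borel_representation_def)
  show ?thesis unfolding cost_def
  proof (rule nn_integral_cong_AE, use ae in eventually_elim)
    fix x assume *: "x \<in> {a<..<b} \<longrightarrow> (u has_real_derivative g x) (at x)"
    have "deriv (\<lambda>x. - u x) x = - deriv u x" if "x \<in> {a<..<b}"
    proof -
      have "(u has_real_derivative g x) (at x)" using * that by blast
      then have "deriv u x = g x" "deriv (\<lambda>x. - u x) x = - g x"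
        by (auto intro!: DERIV_imp_deriv derivative_eq_intros)
      then show ?thesis by simp
    qed
    then show "ennreal (reflect_value F (x, - u x, deriv (\<lambda>x. - u x) x)) * indicator {a<..<b} x
        = ennreal (F (x, u x, deriv u x)) * indicator {a<..<b} x"
      by (cases "x \<in> {a<..<b}") (auto simp: reflect_value_def)
  qed
qed

lemma AE_lebesgue_uminus:
  assumes "AE x in lebesgue. P (x :: real)"
  shows "AE x in lebesgue. P (- x)"
proof -
  obtain N where N: "{x. \<not> P x} \<subseteq> N" "N \<in> null_sets lebesgue"
    using assms unfolding eventually_ae_filter by auto
  have "negligible (uminus ` N)"
    using N(2) by (auto simp: negligible_iff_null_sets[symmetric]
        intro!: negligible_differentiable_image_negligible derivative_intros)
  then have "AE x in lebesgue. x \<notin> uminus ` N"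
    by (intro AE_not_in) (simp add: negligible_iff_null_sets)
  then show ?thesis
    by eventually_elim (use N(1) in \<open>force simp: image_iff\<close>)
qed

lemma cost_reflect_time:
  assumes ac: "absolutely_continuous_on a b u" and "a \<le> b" and F: "F \<in> borel_measurable borel"
  shows "cost (reflect_time F) (\<lambda>x. u (- x)) (- b) (- a) = cost F u a b"
proof -
  obtain v g where vg: "borel_representation a b u v g"
    using borel_representation_exists[OF ac \<open>a \<le> b\<close>] by metis
  then have ae: "AE x in lebesgue. x \<in> {a<..<b} \<longrightarrow> (u has_real_derivative g x) (at x)"
    and v: "\<And>x. x \<in> {a..b} \<Longrightarrow> v x = u x"
    by (simp_all add: borel_representation_def)
  note meas = borel_representation_measurable[OF vg]
  have [measurable]: "(\<lambda>x. F (x, v x, g x)) \<in> borel_measurable borel"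
    using F meas by (intro integrand_measurable) auto
  have "cost F u a b = (\<integral>\<^sup>+x. ennreal (F (x, v x, g x)) * indicator {a<..<b} x \<partial>lborel)"
    by (rule borel_representation_cost[OF vg]) auto
  also have "\<dots> = (\<integral>\<^sup>+x. ennreal (F (- x, v (- x), g (- x))) * indicator {a<..<b} (- x) \<partial>lborel)"
    by (subst nn_integral_real_affine[where c = "-1" and t = 0]) auto
  also have "\<dots> = (\<integral>\<^sup>+x. ennreal (F (- x, v (- x), g (- x))) * indicator {a<..<b} (- x) \<partial>lebesgue)"
    by (simp add: nn_integral_completion)
  also have "\<dots> = cost (reflect_time F) (\<lambda>x. u (- x)) (- b) (- a)"
    unfolding cost_def
  proof (rule nn_integral_cong_AE, use AE_lebesgue_uminus[OF ae] in eventually_elim)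
    fix x assume *: "- x \<in> {a<..<b} \<longrightarrow> (u has_real_derivative g (- x)) (at (- x))"
    show "ennreal (F (- x, v (- x), g (- x))) * indicator {a<..<b} (- x)
        = ennreal (reflect_time F (x, u (- x), deriv (\<lambda>x. u (- x)) x)) * indicator {- b<..<- a} x"
    proof (cases "- x \<in> {a<..<b}")
      case True
      then have "((\<lambda>x. u (- x)) has_real_derivative - g (- x)) (at x)"
        using * by (simp add: DERIV_mirror)
      then have "deriv (\<lambda>x. u (- x)) x = - g (- x)" by (rule DERIV_imp_deriv)
      then show ?thesis using True v[of "- x"] by (auto simp: reflect_time_def)
    next
      case False
      then show ?thesis by (auto simp: indicator_def)
    qed
  qed
  finally show ?thesis by simp
qed

lemma absolutely_continuous_on_reflect:
  assumes u: "absolutely_continuous_on a b u"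
  shows "absolutely_continuous_on (- b) (- a) (\<lambda>x. u (- x))"
  unfolding absolutely_continuous_on_alt
proof (intro allI impI)
  fix \<epsilon> :: real assume "\<epsilon> > 0"
  then obtain \<delta> where \<delta>: "\<delta> > 0" "\<And>D. interval_family a b D \<Longrightarrow> total_length D < \<delta> \<Longrightarrow> variation_over u D < \<epsilon>"
    using u unfolding absolutely_continuous_on_alt by meson
  show "\<exists>\<delta>>0. \<forall>D. interval_family (- b) (- a) D \<and> total_length D < \<delta> \<longrightarrow> variation_over (\<lambda>x. u (- x)) D < \<epsilon>"
  proof (intro exI conjI allI impI)
    fix D assume D: "interval_family (- b) (- a) D \<and> total_length D < \<delta>"
    define D' where "D' = (\<lambda>(s, t). (- t, - s)) ` D"
    have inj: "inj_on (\<lambda>(s, t). (- t, - s :: real)) D" by (auto simp: inj_on_def)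
    have mem: "(s, t) \<in> D' \<longleftrightarrow> (- t, - s) \<in> D" for s t
      unfolding D'_def by force
    have "interval_family a b D'"
    proof (rule interval_familyI)
      show "finite D'" using D interval_family_finite unfolding D'_def by blast
      show "a \<le> s \<and> s \<le> t \<and> t \<le> b" if "(s, t) \<in> D'" for s t
        using that interval_familyD[of "- b" "- a" D "- t" "- s"] D by (auto simp: mem)
      show "(s, t) = (s', t')" if "(s, t) \<in> D'" "(s', t') \<in> D'" "max s s' < min t t'" for s t s' t'
        using that interval_family_disjointD[of "- b" "- a" D "- t" "- s" "- t'" "- s'"] D by (auto simp: mem)
    qed
    moreover have "total_length D' = total_length D"
      unfolding total_length_def D'_def by (subst sum.reindex[OF inj]) (auto simp: case_prod_unfold)
    moreover have "variation_over u D' = variation_over (\<lambda>x. u (- x)) D"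
      unfolding variation_over_def D'_def
      by (subst sum.reindex[OF inj]) (auto simp: case_prod_unfold abs_minus_commute)
    ultimately show "variation_over (\<lambda>x. u (- x)) D < \<epsilon>" using D \<delta>(2)[of D'] by simp
  qed (rule \<delta>(1))
qed

lemma near_minimizer_reflect_value:
  assumes u: "near_minimizer F \<epsilon> u a b" and "a \<le> b"
  shows "near_minimizer (reflect_value F) \<epsilon> (\<lambda>x. - u x) a b"
  unfolding near_minimizer_def
proof (intro conjI allI impI)
  have ac: "absolutely_continuous_on a b u" using u by (simp add: near_minimizer_def)
  show "absolutely_continuous_on a b (\<lambda>x. - u x)" using ac by (rule absolutely_continuous_on_uminus)
  show "cost (reflect_value F) (\<lambda>x. - u x) a b < \<infinity>"
    using u \<open>a \<le> b\<close> by (subst cost_reflect_value) (auto simp: near_minimizer_def)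
  fix v assume v: "absolutely_continuous_on a b v \<and> v a = - u a \<and> v b = - u b"
  then have ac': "absolutely_continuous_on a b (\<lambda>x. - v x)" by (auto intro: absolutely_continuous_on_uminus)
  then have "cost F u a b \<le> cost F (\<lambda>x. - v x) a b + ennreal \<epsilon>"
    using u v unfolding near_minimizer_def by simp
  then show "cost (reflect_value F) (\<lambda>x. - u x) a b \<le> cost (reflect_value F) v a b + ennreal \<epsilon>"
    using cost_reflect_value[OF ac \<open>a \<le> b\<close>, of F] cost_reflect_value[OF ac' \<open>a \<le> b\<close>, of F] by simp
qed

lemma near_minimizer_reflect_time:
  assumes u: "near_minimizer F \<epsilon> u a b" and "a \<le> b" and F: "F \<in> borel_measurable borel"
  shows "near_minimizer (reflect_time F) \<epsilon> (\<lambda>x. u (- x)) (- b) (- a)"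
  unfolding near_minimizer_def
proof (intro conjI allI impI)
  have ac: "absolutely_continuous_on a b u" using u by (simp add: near_minimizer_def)
  show "absolutely_continuous_on (- b) (- a) (\<lambda>x. u (- x))" using ac by (rule absolutely_continuous_on_reflect)
  show "cost (reflect_time F) (\<lambda>x. u (- x)) (- b) (- a) < \<infinity>"
    using u \<open>a \<le> b\<close> F by (subst cost_reflect_time) (auto simp: near_minimizer_def)
  fix v assume v: "absolutely_continuous_on (- b) (- a) v \<and> v (- b) = u (- (- b)) \<and> v (- a) = u (- (- a))"
  then have ac': "absolutely_continuous_on a b (\<lambda>x. v (- x))"
    using absolutely_continuous_on_reflect[of "- b" "- a" v] by simp
  then have "cost F u a b \<le> cost F (\<lambda>x. v (- x)) a b + ennreal \<epsilon>"
    using u v unfolding near_minimizer_def by simp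
  then show "cost (reflect_time F) (\<lambda>x. u (- x)) (- b) (- a) \<le> cost (reflect_time F) v (- b) (- a) + ennreal \<epsilon>"
    using cost_reflect_time[OF ac \<open>a \<le> b\<close> F] cost_reflect_time[OF ac' \<open>a \<le> b\<close> F] by simp
qed

text \<open>What is left of a generalized minimizer once the approximating sequence is forgotten: on every
compact part it is uniformly close to near-minimizers.\<close>

definition near_minimizable :: "(real \<times> real \<times> real \<Rightarrow> real) \<Rightarrow> (real \<Rightarrow> real) \<Rightarrow> real \<Rightarrow> real \<Rightarrow> bool" where
  "near_minimizable F u a b \<longleftrightarrow> (\<forall>c d \<epsilon>. a < c \<and> c < d \<and> d < b \<and> 0 < \<epsilon> \<longrightarrow>
     (\<exists>v. near_minimizer F \<epsilon> v c d \<and> (\<forall>t\<in>{c..d}. \<bar>v t - u t\<bar> < \<epsilon>)))"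

lemma generalized_minimizer_near_minimizable:
  assumes gm: "generalized_minimizer L u a b" and L: "L \<in> borel_measurable borel"
    and c: "c \<ge> 0" "\<And>z. L z \<ge> - c"
  shows "near_minimizable (\<lambda>z. L z + c) u a b"
  unfolding near_minimizable_def
proof (intro allI impI)
  fix p q \<epsilon> :: real assume pq: "a < p \<and> p < q \<and> q < b \<and> 0 < \<epsilon>"
  obtain as bs us where s: "\<forall>n. as n < bs n \<and> absolutely_continuous_on (as n) (bs n) (us n)"
    "(\<lambda>n. excess L (us n) (as n) (bs n)) \<longlonglongrightarrow> 0"
    "\<forall>K. compact K \<and> K \<subseteq> {a<..<b} \<longrightarrow>
       (\<forall>\<^sub>F n in sequentially. K \<subseteq> {as n..bs n}) \<and> uniform_limit K us u sequentially"
    using gm unfolding generalized_minimizer_def by (elim conjE exE) (rule that; assumption)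
  have K: "compact {p..q}" "{p..q} \<subseteq> {a<..<b}" using pq by auto
  have "\<forall>\<^sub>F n in sequentially. {p..q} \<subseteq> {as n..bs n}" using s(3) K by blast
  moreover have "\<forall>\<^sub>F n in sequentially. \<forall>x\<in>{p..q}. dist (us n x) (u x) < \<epsilon>"
  proof -
    have "uniform_limit {p..q} us u sequentially" using s(3) K by blast
    then show ?thesis using pq unfolding uniform_limit_iff by blast
  qed
  moreover have "\<forall>\<^sub>F n in sequentially. excess L (us n) (as n) (bs n) < ereal \<epsilon>"
    using pq by (intro order_tendstoD(2)[OF s(2)]) auto
  ultimately have "\<forall>\<^sub>F n in sequentially. {p..q} \<subseteq> {as n..bs n} \<and> (\<forall>x\<in>{p..q}. dist (us n x) (u x) < \<epsilon>)
      \<and> excess L (us n) (as n) (bs n) < ereal \<epsilon>"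
    by eventually_elim blast
  then obtain n where n: "{p..q} \<subseteq> {as n..bs n}" "\<forall>x\<in>{p..q}. dist (us n x) (u x) < \<epsilon>"
      "excess L (us n) (as n) (bs n) < ereal \<epsilon>"
    unfolding eventually_sequentially by blast
  have n': "as n \<le> p" "q \<le> bs n" "as n \<le> bs n"
    using n(1) pq spec[OF s(1), of n] by auto
  have F: "(\<lambda>z. L z + c) \<in> borel_measurable borel" using L by measurable
  have "near_minimizer (\<lambda>z. L z + c) \<epsilon> (us n) (as n) (bs n)"
    using spec[OF s(1), of n] pq by (intro near_minimizer_of_excess[OF _ n'(3) L c n(3)]) simp_all
  then have "near_minimizer (\<lambda>z. L z + c) \<epsilon> (us n) p q"
    by (rule near_minimizer_subinterval[OF _ n'(1) _ n'(2) F]) (use pq in simp)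
  then show "\<exists>v. near_minimizer (\<lambda>z. L z + c) \<epsilon> v p q \<and> (\<forall>t\<in>{p..q}. \<bar>v t - u t\<bar> < \<epsilon>)"
    using n(2) by (auto simp: dist_real_def)
qed

lemma near_minimizable_reflect_value:
  assumes "near_minimizable F u a b"
  shows "near_minimizable (reflect_value F) (\<lambda>x. - u x) a b"
  unfolding near_minimizable_def
proof (intro allI impI)
  fix c d \<epsilon> :: real assume *: "a < c \<and> c < d \<and> d < b \<and> 0 < \<epsilon>"
  then obtain v where "near_minimizer F \<epsilon> v c d" "\<forall>t\<in>{c..d}. \<bar>v t - u t\<bar> < \<epsilon>"
    using assms unfolding near_minimizable_def by blast
  then show "\<exists>v. near_minimizer (reflect_value F) \<epsilon> v c d \<and> (\<forall>t\<in>{c..d}. \<bar>v t - - u t\<bar> < \<epsilon>)"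
    using * near_minimizer_reflect_value[of F \<epsilon> v c d]
    by (intro exI[of _ "\<lambda>x. - v x"]) (auto simp: abs_minus_commute)
qed

lemma near_minimizable_reflect_time:
  assumes "near_minimizable F u a b" and F: "F \<in> borel_measurable borel"
  shows "near_minimizable (reflect_time F) (\<lambda>x. u (- x)) (- b) (- a)"
  unfolding near_minimizable_def
proof (intro allI impI)
  fix c d \<epsilon> :: real assume *: "- b < c \<and> c < d \<and> d < - a \<and> 0 < \<epsilon>"
  then have "a < - d \<and> - d < - c \<and> - c < b \<and> 0 < \<epsilon>" by auto
  then obtain v where v: "near_minimizer F \<epsilon> v (- d) (- c)" "\<forall>t\<in>{- d..- c}. \<bar>v t - u t\<bar> < \<epsilon>"
    using assms unfolding near_minimizable_def by blast
  then show "\<exists>v. near_minimizer (reflect_time F) \<epsilon> v c d \<and> (\<forall>t\<in>{c..d}. \<bar>v t - u (- t)\<bar> < \<epsilon>)"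
    using * near_minimizer_reflect_time[OF v(1) _ F]
    by (intro exI[of _ "\<lambda>x. v (- x)"]) auto
qed

definition steep_from_left :: "(real \<times> real \<times> real \<Rightarrow> real) \<Rightarrow> real \<Rightarrow> real \<Rightarrow> bool" where
  "steep_from_left F x y \<longleftrightarrow> (\<exists>a u. a < x \<and> continuous_on {a..x} u \<and> u x = y \<and>
     filterlim (\<lambda>z. (u z - u x) / (z - x)) at_top (at_left x) \<and> near_minimizable F u a x)"

lemma near_minimizable_subinterval:
  "near_minimizable F u a b \<Longrightarrow> a \<le> c \<Longrightarrow> d \<le> b \<Longrightarrow> near_minimizable F u c d"
  unfolding near_minimizable_def by (meson le_less_trans less_le_trans)

text \<open>The four cases are the two signs of the infinite derivative and, for each, the side of \<open>x\<close> from
which the minimizer is looked at: from the left unless \<open>x\<close> is the left endpoint of its interval.\<close>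

lemma universal_singular_set_steep:
  assumes xy: "(x, y) \<in> universal_singular_set L" and L: "L \<in> borel_measurable borel"
    and c: "c \<ge> 0" "\<And>z. L z \<ge> - c"
  defines "F \<equiv> \<lambda>z. L z + c"
  shows "steep_from_left F x y \<or> steep_from_left (reflect_value F) x (- y) \<or>
    steep_from_left (reflect_time F) (- x) y \<or>
    steep_from_left (reflect_value (reflect_time F)) (- x) (- y)"
proof -
  obtain a b u where u: "a \<le> x" "x \<le> b" "a < b" "generalized_minimizer L u a b" "u x = y"
    "has_infinite_derivative_within u x {a..b}"
    using xy unfolding universal_singular_set_def by blast
  have cont: "continuous_on {a..b} u" using u(4) by (simp add: generalized_minimizer_def)
  have nm: "near_minimizable F u a b"
    unfolding F_def by (rule generalized_minimizer_near_minimizable[OF u(4) L c])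
  have F: "F \<in> borel_measurable borel" unfolding F_def using L by measurable
  let ?q = "\<lambda>u x z. (u z - u x) / (z - x) :: real"
  have left: "steep_from_left F x y \<or> steep_from_left (reflect_value F) x (- y)" if "a < x"
  proof -
    have le: "at_left x \<le> at x within {a..b}"
    proof -
      have "at x within {a..x} \<le> at x within {a..b}" using u(2) by (intro at_le) auto
      then show ?thesis using that by (simp add: at_within_Icc_at_left)
    qed
    have cont': "continuous_on {a..x} u" using cont by (rule continuous_on_subset) (use u in auto)
    have nm': "near_minimizable F u a x" using nm by (rule near_minimizable_subinterval) (use u in auto)
    from u(6) consider "filterlim (?q u x) at_top (at_left x)" | "filterlim (?q u x) at_bot (at_left x)"
      unfolding has_infinite_derivative_within_def using filterlim_mono[OF _ order.refl le] by blast
    then show ?thesis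
    proof cases
      case 1
      with that cont' nm' u(5) show ?thesis unfolding steep_from_left_def by blast
    next
      case 2
      have "filterlim (\<lambda>z. - ?q u x z) at_top (at_left x)"
        using 2 by (simp add: filterlim_uminus_at_bot)
      then have "filterlim (?q (\<lambda>z. - u z) x) at_top (at_left x)"
        by (simp add: minus_divide_left)
      then have "steep_from_left (reflect_value F) x (- y)"
        unfolding steep_from_left_def using that cont' near_minimizable_reflect_value[OF nm'] u(5)
        by (intro exI[of _ a] exI[of _ "\<lambda>z. - u z"]) (auto intro: continuous_intros)
      then show ?thesis by blast
    qed
  qed
  have right: "steep_from_left (reflect_time F) (- x) y \<or>
    steep_from_left (reflect_value (reflect_time F)) (- x) (- y)" if "x = a"
  proof -
    define w where "w z = u (- z)" for z
    have cont': "continuous_on {- b..- x} w" unfolding w_def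
      by (rule continuous_on_compose2[OF cont]) (use that in \<open>auto intro!: continuous_intros\<close>)
    have nm': "near_minimizable (reflect_time F) w (- b) (- x)"
      unfolding w_def using near_minimizable_reflect_time[OF nm F] that by simp
    have w: "w (- x) = y" using u(5) by (simp add: w_def)
    have bx: "- b < - x" using that u(3) by simp
    have at: "at x within {a..b} = at_right x" using that u(3) by (simp add: at_within_Icc_at_right)
    have eq: "?q w (- x) z = - ?q u x (- z)" for z
    proof -
      have "?q u x (- z) = (u (- z) - u x) / (- (z + x))" by simp
      also have "\<dots> = - ((u (- z) - u x) / (z + x))" by (rule divide_minus_right)
      finally show ?thesis by (simp add: w_def)
    qed
    have refl: "at_right x = filtermap uminus (at_left (- x))" 
      using at_left_minus[of "- x"] by (simp add: filtermap_filtermap)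
    from u(6) consider "filterlim (?q u x) at_top (at_right x)" | "filterlim (?q u x) at_bot (at_right x)"
      unfolding has_infinite_derivative_within_def at by blast
    then show ?thesis
    proof cases
      case 1
      then have "filterlim (\<lambda>z. ?q u x (- z)) at_top (at_left (- x))"
        unfolding refl filterlim_filtermap .
      moreover have "?q (\<lambda>z. - w z) (- x) z = ?q u x (- z)" for z
      proof -
        have "?q (\<lambda>z. - w z) (- x) z = - ?q w (- x) z" by (simp add: minus_divide_left)
        then show ?thesis unfolding eq minus_minus .
      qed
      ultimately have "filterlim (?q (\<lambda>z. - w z) (- x)) at_top (at_left (- x))" by simp
      then have "steep_from_left (reflect_value (reflect_time F)) (- x) (- y)"
        unfolding steep_from_left_def using bx cont' near_minimizable_reflect_value[OF nm'] w
        by (intro exI[of _ "- b"] exI[of _ "\<lambda>z. - w z"]) (auto intro: continuous_intros)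
      then show ?thesis by blast
    next
      case 2
      then have "filterlim (\<lambda>z. ?q u x (- z)) at_bot (at_left (- x))"
        unfolding refl filterlim_filtermap .
      then have "filterlim (?q w (- x)) at_top (at_left (- x))"
        unfolding eq by (simp add: filterlim_uminus_at_bot)
      then have "steep_from_left (reflect_time F) (- x) y"
        unfolding steep_from_left_def using bx cont' nm' w by blast
      then show ?thesis by blast
    qed
  qed
  show ?thesis using left right u(1) by (cases "x = a") auto
qed


section \<open>Arriving near a steep point\<close>

lemma locally_bounded_above_compact:
  assumes "locally_bounded_above F" "compact S"
  shows "bdd_above (F ` S)"
proof -
  obtain U where U: "\<And>x. open (U x) \<and> x \<in> U x \<and> bdd_above (F ` U x)"
    using assms(1) unfolding locally_bounded_above_def by metis
  have cover: "S \<subseteq> (\<Union>x\<in>S. U x)" using U by blast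
  obtain D where D: "D \<subseteq> S" "finite D" "S \<subseteq> (\<Union>x\<in>D. U x)"
    using compactE_image[OF assms(2) _ cover] U by metis
  have "bdd_above (\<Union>x\<in>D. F ` U x)" using D(2) U by (subst bdd_above_UN) auto
  then show ?thesis by (rule bdd_above_mono) (use D(3) in blast)
qed

lemma locally_bounded_above_box:
  fixes F :: "real \<times> real \<times> real \<Rightarrow> real"
  assumes "locally_bounded_above F"
  obtains B where "B \<ge> 0" "\<And>t z p. t \<in> {a..b} \<Longrightarrow> z \<in> {c..d} \<Longrightarrow> \<bar>p\<bar> \<le> m \<Longrightarrow> F (t, z, p) \<le> B"
proof -
  have "compact ({a..b} \<times> {c..d} \<times> {- m..m})" by (intro compact_Times compact_Icc)
  then obtain B where "\<And>w. w \<in> {a..b} \<times> {c..d} \<times> {- m..m} \<Longrightarrow> F w \<le> B"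
    using locally_bounded_above_compact[OF assms] unfolding bdd_above_def by (metis image_eqI)
  then show ?thesis by (intro that[of "max B 0"]) (auto simp: le_max_iff_disj abs_le_iff minus_le_iff)
qed

text \<open>The waiting period at the end makes it possible to lead an arriving path back to a minimizer \<open>u\<close>
with \<open>u x = y\<close>, with small slopes and before time \<open>x\<close>, where the domain of \<open>u\<close> may end.\<close>

definition arrival_path :: "real \<Rightarrow> real \<Rightarrow> real \<Rightarrow> real \<Rightarrow> (real \<Rightarrow> real) \<Rightarrow> bool" where
  "arrival_path q s x y v \<longleftrightarrow> absolutely_continuous_on q x v \<and> v q = s \<and>
     (\<exists>\<tau>. q \<le> \<tau> \<and> \<tau> < x \<and> (\<forall>t\<in>{\<tau>..x}. v t = y))"

definition arrival_cost :: "(real \<times> real \<times> real \<Rightarrow> real) \<Rightarrow> real \<Rightarrow> real \<Rightarrow> real \<Rightarrow> real \<Rightarrow> ennreal" where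
  "arrival_cost F q s x y = (INF v\<in>{v. arrival_path q s x y v}. cost F v q x)"

text \<open>What takes the place of an arriving path within the budget \<open>b\<close>: dropping the climb \<open>g\<close> leaves a path to the lower
height, and the cost of \<open>g\<close> is what is gained.  Only half of the climb from \<open>y - d\<close> to \<open>y\<close> is demanded of
\<open>g\<close>, because near-minimizers reach the height \<open>y\<close> only approximately.\<close>

definition splits_below ::
  "(real \<times> real \<times> real \<Rightarrow> real) \<Rightarrow> real \<Rightarrow> real \<Rightarrow> real \<Rightarrow> real \<Rightarrow> real \<Rightarrow> real \<Rightarrow> ennreal \<Rightarrow> bool" where
  "splits_below F q s x0 x y d b \<longleftrightarrow> (\<exists>\<tau> t w g. q \<le> \<tau> \<and> x0 \<le> \<tau> \<and> \<tau> < t \<and> t \<le> x \<and>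
     absolutely_continuous_on q \<tau> w \<and> w q = s \<and> w \<tau> = y - d \<and>
     absolutely_continuous_on \<tau> t g \<and> g \<tau> = y - d \<and> g t \<ge> y - d / 2 \<and>
     cost F w q \<tau> + cost F g \<tau> t \<le> b)"

text \<open>All that is retained of a steep point, relative to a source: the minimizer is no longer mentioned,
and arbitrarily small \<open>\<kappa>\<close> express the infinite derivative.\<close>

definition descends :: "(real \<times> real \<times> real \<Rightarrow> real) \<Rightarrow> real \<Rightarrow> real \<Rightarrow> real \<Rightarrow> real \<Rightarrow> bool" where
  "descends F q s x y \<longleftrightarrow> (\<forall>\<kappa>>0. \<exists>d0>0. \<forall>d v. 0 < d \<and> d < d0 \<and> arrival_path q s x y v \<longrightarrow>
     (\<forall>\<epsilon>>0. splits_below F q s (x - \<kappa> * d) x y d (cost F v q x + ennreal \<epsilon>)))"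

lemma affine_absolutely_continuous: "absolutely_continuous_on a b (\<lambda>x. y0 + m * (x - x0))"
proof (rule lipschitz_imp_absolutely_continuous_on)
  fix x y :: real assume "x \<le> y"
  have "y0 + m * (y - x0) - (y0 + m * (x - x0)) = m * (y - x)" by (simp add: algebra_simps)
  with \<open>x \<le> y\<close> show "\<bar>y0 + m * (y - x0) - (y0 + m * (x - x0))\<bar> \<le> \<bar>m\<bar> * (y - x)"
    by (simp add: abs_mult)
qed

text \<open>The comparison of an arriving path \<open>v\<close> with the minimizer \<open>u\<close>, at the time \<open>x0\<close> up to which \<open>u\<close>
stays below \<open>y - 2 * d\<close>.  If \<open>v\<close> is below \<open>y - d\<close> at time \<open>x0\<close>, then \<open>v\<close> itself is split where it
passes the height \<open>y - d\<close>.  Otherwise \<open>v\<close>, which starts below \<open>u\<close>, has crossed a near-minimizer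
\<open>n\<close> close to \<open>u\<close> at some time \<open>xs \<le> x0\<close>.  After \<open>xs\<close> the near-minimizer is at most slightly
more expensive than \<open>v\<close> followed by a short segment \<open>l\<close> that leads from the waiting part of
\<open>v\<close> back to \<open>n\<close>; so \<open>v\<close> up to \<open>xs\<close> followed by \<open>n\<close> is the path to be split.\<close>

lemma descent_step:
  assumes F: "F \<in> borel_measurable borel" "locally_bounded_above F"
    and u: "a < q" "continuous_on {q..x} u" "u x = y" "near_minimizable F u a x"
    and low: "q \<le> x0" "x0 < x" "d > 0" "\<And>t. t \<in> {q..x0} \<Longrightarrow> u t \<le> y - 2 * d"
    and s: "s < u q" and v: "arrival_path q s x y v" and "\<epsilon> > 0"
  shows "splits_below F q s x0 x y d (cost F v q x + ennreal \<epsilon>)"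
proof -
  have v_ac: "absolutely_continuous_on q x v" and vq: "v q = s"
    using v by (auto simp: arrival_path_def)
  obtain \<tau>v where \<tau>v: "q \<le> \<tau>v" "\<tau>v < x" "\<And>t. t \<in> {\<tau>v..x} \<Longrightarrow> v t = y"
    using v by (auto simp: arrival_path_def)
  have vx: "v x = y" using \<tau>v by auto
  have v_cont: "continuous_on {q..x} v" using v_ac by (rule absolutely_continuous_on_imp_continuous_on)
  have v_sub: "absolutely_continuous_on c e v" if "q \<le> c" "e \<le> x" for c e
    using v_ac that by (rule absolutely_continuous_on_subinterval)
  show ?thesis
  proof (cases "v x0 \<le> y - d")
    case True
    have "continuous_on {x0..x} v" using v_cont by (rule continuous_on_subset) (use low in auto)
    then obtain \<tau> where \<tau>: "x0 \<le> \<tau>" "\<tau> \<le> x" "v \<tau> = y - d"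
      using IVT'[of v x0 "y - d" x] True vx low by auto
    then have "\<tau> \<noteq> x" using vx low(3) by auto
    then have \<tau>': "\<tau> < x" "q \<le> \<tau>" using \<tau> low by auto
    have "cost F v q x = cost F v q \<tau> + cost F v \<tau> x"
      using \<tau>' by (intro cost_split v_ac F) auto
    then have "cost F v q \<tau> + cost F v \<tau> x \<le> cost F v q x + ennreal \<epsilon>" by simp
    moreover have "absolutely_continuous_on q \<tau> v" "absolutely_continuous_on \<tau> x v"
      using \<tau>' by (auto intro: v_sub)
    ultimately show ?thesis using \<tau> \<tau>' vx vq low(3) unfolding splits_below_def
      by (intro exI[of _ \<tau>] exI[of _ x] exI[of _ v]) auto
  next
    case False
    obtain B where B: "B \<ge> 0"
      "\<And>t z p. t \<in> {q..x} \<Longrightarrow> z \<in> {y - (x - q)..y + (x - q)} \<Longrightarrow> \<bar>p\<bar> \<le> 1 \<Longrightarrow> F (t, z, p) \<le> B"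
      using locally_bounded_above_box[OF F(2), of q x "y - (x - q)" "y + (x - q)" 1] by metis
    \<comment> \<open>The length \<open>m\<close> of the final piece in which \<open>v\<close> is led back to \<open>u\<close>; its cost \<open>B * m\<close> is at most
      \<open>\<epsilon> / 2\<close>.\<close>
    define m where "m = min ((x - max \<tau>v x0) / 2) (\<epsilon> / (2 * (B + 1)))"
    have m: "m > 0" "x - m > \<tau>v" "x - m > x0" "B * m \<le> \<epsilon> / 2"
    proof -
      show "m > 0" using \<tau>v(2) low(2) \<open>\<epsilon> > 0\<close> B(1) by (auto simp: m_def)
      have "m \<le> (x - max \<tau>v x0) / 2" unfolding m_def by (rule min.cobounded1)
      then show "x - m > \<tau>v" "x - m > x0" using \<tau>v(2) low(2) by auto
      have "m \<le> \<epsilon> / (2 * (B + 1))" unfolding m_def by (rule min.cobounded2)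
      then have "(B + 1) * m \<le> \<epsilon> / 2" using B(1) by (simp add: field_simps)
      then show "B * m \<le> \<epsilon> / 2" using \<open>m > 0\<close> by (simp add: algebra_simps)
    qed
    define xa where "xa = x - m"
    have xa: "q \<le> xa" "x0 < xa" "xa < x" "v xa = y" using m low \<tau>v by (auto simp: xa_def)
    have e1: "min (m / 8) (d / 4) > 0" using m low by auto
    obtain \<delta> where \<delta>: "\<delta> > 0" "\<And>t. t \<in> {q..x} \<Longrightarrow> dist t x < \<delta> \<Longrightarrow> dist (u t) y < min (m / 8) (d / 4)"
    proof -
      have "x \<in> {q..x}" using low by auto
      then show thesis using u(2,3) e1 that unfolding continuous_on_iff by metis
    qed
    \<comment> \<open>The segment will run from \<open>xa\<close>, where \<open>v\<close> waits at the height \<open>y\<close>, to \<open>xb\<close>.  As \<open>xb\<close> is so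
      close to \<open>x\<close> that \<open>u\<close> is within \<open>m / 8\<close> of \<open>y\<close> there, the segment has slope at most 1.\<close>
    define xb where "xb = x - min (m / 4) (\<delta> / 2)"
    have xb: "xa < xb" "xb < x" "xb - xa \<ge> m / 2" "dist xb x < \<delta>"
      using m \<delta>(1) by (auto simp: xb_def xa_def dist_real_def)
    have ub: "\<bar>u xb - y\<bar> < min (m / 8) (d / 4)"
      using \<delta>(2)[of xb] xb xa by (simp add: dist_real_def)
    define e where "e = Min {\<epsilon> / 2, m / 8, d / 4, u q - s}"
    have e: "e > 0" "e \<le> \<epsilon> / 2" "e \<le> m / 8" "e \<le> d / 4" "e \<le> u q - s"
    proof -
      show "e > 0" using \<open>\<epsilon> > 0\<close> m low s by (auto simp: e_def)
      show "e \<le> \<epsilon> / 2" "e \<le> m / 8" "e \<le> d / 4" "e \<le> u q - s"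
        unfolding e_def by (rule Min_le; simp)+
    qed
    have "q < xb" using xa(1) xb(1) by linarith
    then have "a < q \<and> q < xb \<and> xb < x \<and> 0 < e" using u(1) xb(2) e(1) by blast
    then have "\<exists>n. near_minimizer F e n q xb \<and> (\<forall>t\<in>{q..xb}. \<bar>n t - u t\<bar> < e)"
      by (rule u(4)[unfolded near_minimizable_def, rule_format])
    then obtain n where n: "near_minimizer F e n q xb" "\<And>t. t \<in> {q..xb} \<Longrightarrow> \<bar>n t - u t\<bar> < e" by blast
    have n_ac: "absolutely_continuous_on q xb n" using n(1) by (simp add: near_minimizer_def)
    have n_cont: "continuous_on {q..xb} n" using n_ac by (rule absolutely_continuous_on_imp_continuous_on)
    have n_sub: "absolutely_continuous_on c e n" if "q \<le> c" "e \<le> xb" for c e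
      using n_ac that by (rule absolutely_continuous_on_subinterval)
    have n_low: "n t < y - d" if "t \<in> {q..x0}" for t
      using n(2)[of t] low(4)[OF that] that e xa xb low(3) by auto
    have "\<exists>xs. q \<le> xs \<and> xs \<le> x0 \<and> v xs - n xs = 0"
    proof (rule IVT')
      show "v q - n q \<le> 0" using n(2)[of q] e vq xa xb by auto
      show "0 \<le> v x0 - n x0" using n_low[of x0] False low by auto
      show "continuous_on {q..x0} (\<lambda>t. v t - n t)"
        by (intro continuous_on_diff continuous_on_subset[OF v_cont] continuous_on_subset[OF n_cont])
          (use low xa xb in auto)
    qed (use low in auto)
    then obtain xs where xs: "q \<le> xs" "xs \<le> x0" "v xs = n xs" by auto
    have nb: "\<bar>n xb - y\<bar> \<le> m / 4" "n xb \<ge> y - d / 2"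
    proof -
      have "\<bar>n xb - u xb\<bar> < e" using n(2)[of xb] \<open>q < xb\<close> by simp
      moreover have "\<bar>u xb - y\<bar> < m / 8" "\<bar>u xb - y\<bar> < d / 4" using ub by simp_all
      ultimately show "\<bar>n xb - y\<bar> \<le> m / 4" "n xb \<ge> y - d / 2" using e(3,4) by linarith+
    qed
    define k where "k = (n xb - y) / (xb - xa)"
    have k: "k * (xb - xa) = n xb - y" using xb(1) by (simp add: k_def)
    have k1: "\<bar>k\<bar> \<le> 1"
    proof -
      have "\<bar>n xb - y\<bar> \<le> xb - xa" using nb(1) xb(3) m(1) by linarith
      then show ?thesis using xb(1) by (simp add: k_def abs_divide)
    qed
    define l where "l t = y + k * (t - xa)" for t
    have l_end: "l xa = y" "l xb = n xb" using k by (simp_all add: l_def)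
    have l_ac: "absolutely_continuous_on c e l" for c e
      unfolding l_def by (rule affine_absolutely_continuous)
    have l_cost: "cost F l xa xb \<le> ennreal (\<epsilon> / 2)"
    proof -
      have "cost F l xa xb \<le> ennreal (B * (xb - xa))"
      proof (rule cost_affine_le)
        show "l t = y + k * (t - xa)" for t by (simp add: l_def)
        fix t assume t: "xa < t" "t < xb"
        have "\<bar>k * (t - xa)\<bar> \<le> 1 * (t - xa)"
          unfolding abs_mult using k1 t by (intro mult_mono) auto
        also have "\<dots> \<le> x - q" using t xa xb by simp
        finally have "y + k * (t - xa) \<in> {y - (x - q)..y + (x - q)}" unfolding abs_le_iff by auto
        then show "F (t, y + k * (t - xa), k) \<le> B"
          using t xa xb k1 by (intro B(2)) auto
      qed (use xb in auto)
      also have "B * (xb - xa) \<le> \<epsilon> / 2"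
      proof -
        have "B * (xb - xa) \<le> B * m" using B(1) xb by (intro mult_left_mono) (auto simp: xa_def)
        with m(4) show ?thesis by linarith
      qed
      finally show ?thesis by (simp add: ennreal_leI)
    qed
    let ?z = "\<lambda>t. if t \<le> xa then v t else l t"
    have z_cost: "cost F ?z xs xb = cost F v xs xa + cost F l xa xb"
      using xs xa xb low by (intro cost_glue v_sub l_ac F) (auto simp: l_end)
    have "absolutely_continuous_on xs xb ?z"
      using xs xa xb low by (intro absolutely_continuous_on_glue v_sub l_ac) (auto simp: l_end)
    moreover have "?z xs = n xs" "?z xb = n xb" using xs xa xb low by (auto simp: l_end)
    moreover have "near_minimizer F e n xs xb"
      using xs xa xb low by (intro near_minimizer_subinterval[OF n(1)] F) auto
    ultimately have "cost F n xs xb \<le> cost F ?z xs xb + ennreal e"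
      unfolding near_minimizer_def by blast
    also have "\<dots> \<le> cost F v xs xa + ennreal (\<epsilon> / 2) + ennreal (\<epsilon> / 2)"
      unfolding z_cost using l_cost e(2) by (intro add_mono ennreal_leI) auto
    also have "\<dots> = cost F v xs xa + ennreal \<epsilon>"
      using \<open>\<epsilon> > 0\<close> by (simp add: add.assoc ennreal_plus[symmetric] del: ennreal_plus)
    also have "\<dots> \<le> cost F v xs x + ennreal \<epsilon>"
      using xa by (intro add_mono cost_mono_interval) auto
    finally have n_cost: "cost F n xs xb \<le> cost F v xs x + ennreal \<epsilon>" .
    have "continuous_on {xs..xb} n" using n_cont by (rule continuous_on_subset) (use xs in auto)
    then obtain x1 where x1: "xs \<le> x1" "x1 \<le> xb" "n x1 = y - d"
      using IVT'[of n xs "y - d" xb] n_low[of xs] nb(2) xs xa xb low by auto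
    have x1': "x0 < x1" using n_low[of x1] x1 xs by force
    have "n x1 \<noteq> n xb" using x1 nb(2) low(3) by auto
    then have x1'': "x1 < xb" using x1 by (cases "x1 = xb") auto
    let ?w = "\<lambda>t. if t \<le> xs then v t else n t"
    have w_cost: "cost F ?w q x1 = cost F v q xs + cost F n xs x1"
      using xs xa xb low x1 by (intro cost_glue v_sub n_sub F) auto
    have w_ac: "absolutely_continuous_on q x1 ?w"
      using xs xa xb low x1 by (intro absolutely_continuous_on_glue v_sub n_sub) auto
    have "cost F ?w q x1 + cost F n x1 xb = cost F v q xs + cost F n xs xb"
      unfolding w_cost using cost_split[OF n_sub[of xs xb], of x1 F] xs x1 F by (simp add: add.assoc)
    also have "\<dots> \<le> cost F v q xs + (cost F v xs x + ennreal \<epsilon>)"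
      by (intro add_left_mono n_cost)
    also have "\<dots> = cost F v q x + ennreal \<epsilon>"
      using cost_split[OF v_ac, of xs F] xs low F by (simp add: add.assoc)
    finally have total: "cost F ?w q x1 + cost F n x1 xb \<le> cost F v q x + ennreal \<epsilon>" .
    have w_ends: "?w q = s" "?w x1 = y - d" using vq xs x1 x1' by auto
    have n1_ac: "absolutely_continuous_on x1 xb n" using xs x1 by (intro n_sub) auto
    have ord: "q \<le> x1" "x0 \<le> x1" "xb \<le> x" using x1' low(1) xb(2) by auto
    show ?thesis
      unfolding splits_below_def
      by (rule exI[of _ x1], rule exI[of _ xb], rule exI[of _ ?w], rule exI[of _ n], intro conjI)
        (fact ord x1'' w_ac w_ends n1_ac x1(3) nb(2) total)+
  qed
qed

text \<open>The source is placed at a time \<open>q\<close> after which \<open>u\<close> stays below the line of slope 1 through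
\<open>(x, y)\<close>.  The bound \<open>u \<le> y - 2 * d\<close> up to time \<open>x - \<kappa> * d\<close> comes from that line far from \<open>x\<close>, and
near \<open>x\<close> from the line of slope \<open>2 / \<kappa>\<close>.\<close>

lemma steep_from_left_descends:
  assumes F: "F \<in> borel_measurable borel" "locally_bounded_above F"
    and steep: "steep_from_left F x y"
  obtains q s where "q \<in> \<rat>" "s \<in> \<rat>" "q < x" "s < y" "descends F q s x y"
proof -
  obtain a u where u: "a < x" "continuous_on {a..x} u" "u x = y"
     "filterlim (\<lambda>z. (u z - u x) / (z - x)) at_top (at_left x)" "near_minimizable F u a x"
    using steep unfolding steep_from_left_def by blast
  have steep_A: "\<exists>\<delta>>0. \<forall>t. x - \<delta> < t \<and> t < x \<longrightarrow> u t \<le> y - A * (x - t)" for A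
  proof -
    have "\<forall>\<^sub>F z in at_left x. A \<le> (u z - u x) / (z - x)"
      using u(4) unfolding filterlim_at_top by blast
    then obtain b where b: "b < x" "\<And>z. b < z \<Longrightarrow> z < x \<Longrightarrow> A \<le> (u z - u x) / (z - x)"
      unfolding eventually_at_left_field by blast
    show ?thesis
    proof (intro exI conjI allI impI)
      show "x - b > 0" using b by simp
      fix t assume "x - (x - b) < t \<and> t < x"
      then have "A \<le> (u t - y) / (t - x)" "t < x" using b(2)[of t] u(3) by auto
      then have "A * (t - x) \<ge> u t - y" by (simp add: neg_le_divide_eq)
      then show "u t \<le> y - A * (x - t)" by (simp add: algebra_simps)
    qed
  qed
  obtain \<delta>1 where \<delta>1: "\<delta>1 > 0" "\<And>t. x - \<delta>1 < t \<Longrightarrow> t < x \<Longrightarrow> u t \<le> y - (x - t)"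
    using steep_A[of 1] by auto
  obtain q where q: "q \<in> \<rat>" "max a (x - \<delta>1) < q" "q < x"
    using Rats_dense_in_real[of "max a (x - \<delta>1)" x] u(1) \<delta>1(1) by auto
  obtain s where s: "s \<in> \<rat>" "s < u q" using Rats_no_bot_less by blast
  have "descends F q s x y"
    unfolding descends_def
  proof (intro allI impI)
    fix \<kappa> :: real assume "\<kappa> > 0"
    obtain \<delta> where \<delta>: "\<delta> > 0" "\<And>t. x - \<delta> < t \<Longrightarrow> t < x \<Longrightarrow> u t \<le> y - (2 / \<kappa>) * (x - t)"
      using steep_A[of "2 / \<kappa>"] by auto
    show "\<exists>d0>0. \<forall>d v. 0 < d \<and> d < d0 \<and> arrival_path q s x y v \<longrightarrow>
     (\<forall>\<epsilon>>0. splits_below F q s (x - \<kappa> * d) x y d (cost F v q x + ennreal \<epsilon>))"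
    proof (rule exI[of _ "min (\<delta> / 2) ((x - q) / \<kappa>)"], intro conjI allI impI)
      show "min (\<delta> / 2) ((x - q) / \<kappa>) > 0" using \<delta>(1) q \<open>\<kappa> > 0\<close> by auto
      fix d v \<epsilon> assume d: "0 < d \<and> d < min (\<delta> / 2) ((x - q) / \<kappa>) \<and> arrival_path q s x y v" and "\<epsilon> > (0 :: real)"
      have \<kappa>d: "\<kappa> * d < x - q" "\<kappa> * d > 0" using d \<open>\<kappa> > 0\<close> by (auto simp: field_simps)
      show "splits_below F q s (x - \<kappa> * d) x y d (cost F v q x + ennreal \<epsilon>)"
      proof (rule descent_step[OF F _ _ u(3) u(5)])
        show "continuous_on {q..x} u" using u(2) by (rule continuous_on_subset) (use q in auto)
        fix t assume t: "t \<in> {q..x - \<kappa> * d}"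
        show "u t \<le> y - 2 * d"
        proof (cases "x - \<delta> < t")
          case True
          have "u t \<le> y - (2 / \<kappa>) * (x - t)" using True t \<kappa>d by (intro \<delta>(2)) auto
          also have "\<dots> \<le> y - (2 / \<kappa>) * (\<kappa> * d)"
            using t \<open>\<kappa> > 0\<close> by (intro diff_left_mono mult_left_mono) auto
          finally show ?thesis using \<open>\<kappa> > 0\<close> by simp
        next
          case False
          have "u t \<le> y - (x - t)" using q t \<kappa>d by (intro \<delta>1(2)) auto
          with False d show ?thesis by auto
        qed
      qed (use d \<kappa>d q s \<open>\<epsilon> > 0\<close> in auto)
    qed
  qed
  moreover have "s < y" using s(2) \<delta>1(2)[of q] q by simp
  ultimately show ?thesis using that[OF q(1) s(1) q(3)] by simp
qed

text \<open>A path that has reached a lower height \<open>w \<tau>\<close> is continued with slope \<open>m\<close> up to the height \<open>y\<close> and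
then waits.\<close>

lemma arrival_cost_le_extension:
  assumes F: "F \<in> borel_measurable borel"
    and w: "absolutely_continuous_on q \<tau> w" "w q = s" "q \<le> \<tau>"
    and m: "m > 0" and up: "w \<tau> \<le> y" "\<tau> + (y - w \<tau>) / m < x"
    and B: "B \<ge> 0" "\<And>t z p. t \<in> {\<tau>..x} \<Longrightarrow> z \<in> {w \<tau>..y} \<Longrightarrow> \<bar>p\<bar> \<le> m \<Longrightarrow> F (t, z, p) \<le> B"
  shows "arrival_cost F q s x y \<le> cost F w q \<tau> + ennreal (B * (x - \<tau>))"
proof -
  define \<tau>1 where "\<tau>1 = \<tau> + (y - w \<tau>) / m"
  have \<tau>1: "\<tau> \<le> \<tau>1" "\<tau>1 < x" using m up by (auto simp: \<tau>1_def)
  define l where "l t = w \<tau> + m * (t - \<tau>)" for t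
  have l_end: "l \<tau> = w \<tau>" "l \<tau>1 = y" using m by (auto simp: l_def \<tau>1_def)
  define c where "c t = y + 0 * (t - x)" for t
  have l_ac: "absolutely_continuous_on p r l" for p r unfolding l_def by (rule affine_absolutely_continuous)
  have c_ac: "absolutely_continuous_on p r c" for p r unfolding c_def by (rule affine_absolutely_continuous)
  let ?h = "\<lambda>t. if t \<le> \<tau>1 then l t else c t"
  let ?v = "\<lambda>t. if t \<le> \<tau> then w t else ?h t"
  have h_ac: "absolutely_continuous_on \<tau> x ?h"
    using \<tau>1 l_end by (intro absolutely_continuous_on_glue l_ac c_ac) (auto simp: c_def)
  have v_ac: "absolutely_continuous_on q x ?v"
    using \<tau>1 l_end w by (intro absolutely_continuous_on_glue h_ac) auto
  have v_const: "?v t = y" if t: "t \<in> {\<tau>1..x}" for t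
  proof -
    consider "t = \<tau>1" | "\<tau>1 < t" using t by force
    then show ?thesis
    proof cases
      case 1
      then show ?thesis using l_end \<tau>1 by (cases "\<tau> < \<tau>1") auto
    qed (use \<tau>1 in \<open>auto simp: c_def\<close>)
  qed
  have "arrival_path q s x y ?v"
    unfolding arrival_path_def using v_ac w(2,3) \<tau>1 v_const
    by (intro conjI exI[of _ \<tau>1]) (auto simp del: if_split)
  then have "arrival_cost F q s x y \<le> cost F ?v q x"
    unfolding arrival_cost_def by (intro INF_lower) simp
  also have "\<dots> = cost F w q \<tau> + (cost F l \<tau> \<tau>1 + cost F c \<tau>1 x)"
  proof -
    have "cost F ?v q x = cost F w q \<tau> + cost F ?h \<tau> x"
      using \<tau>1 l_end w by (intro cost_glue h_ac F) auto
    also have "cost F ?h \<tau> x = cost F l \<tau> \<tau>1 + cost F c \<tau>1 x"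
      using \<tau>1 l_end by (intro cost_glue l_ac c_ac F) (auto simp: c_def)
    finally show ?thesis .
  qed
  also have "cost F l \<tau> \<tau>1 + cost F c \<tau>1 x \<le> ennreal (B * (\<tau>1 - \<tau>)) + ennreal (B * (x - \<tau>1))"
  proof (rule add_mono)
    show "cost F l \<tau> \<tau>1 \<le> ennreal (B * (\<tau>1 - \<tau>))"
    proof (rule cost_affine_le)
      show "l t = w \<tau> + m * (t - \<tau>)" for t by (simp add: l_def)
      fix t assume t: "\<tau> < t" "t < \<tau>1"
      have "m * (t - \<tau>) \<le> m * (\<tau>1 - \<tau>)" using t m by (intro mult_left_mono) auto
      also have "\<dots> = y - w \<tau>" using m by (simp add: \<tau>1_def)
      finally show "F (t, w \<tau> + m * (t - \<tau>), m) \<le> B" using t m \<tau>1 by (intro B(2)) auto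
    qed (rule \<tau>1)
    show "cost F c \<tau>1 x \<le> ennreal (B * (x - \<tau>1))"
    proof (rule cost_affine_le)
      show "c t = y + 0 * (t - x)" for t by (simp add: c_def)
      fix t assume t: "\<tau>1 < t" "t < x"
      show "F (t, y + 0 * (t - x), 0) \<le> B" using t m \<tau>1 up by (intro B(2)) auto
    qed (use \<tau>1 in auto)
  qed
  also have "\<dots> = ennreal (B * (x - \<tau>))"
    using B(1) \<tau>1 by (subst ennreal_plus[symmetric]) (auto simp: algebra_simps mult_left_mono)
  finally show ?thesis by (simp add: add_left_mono)
qed


section \<open>Functions that decrease faster than every linear function\<close>

text \<open>Fix \<open>K\<close>, and let \<open>A n\<close> consist of the points of \<open>T\<close> at which \<open>f\<close> decreases with slope \<open>K\<close> up to the distance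
\<open>1 / (n + 1)\<close>.  A part of \<open>A n\<close> in an interval of shorter length than that has
diameter at most \<open>1 / K\<close> times the drop of \<open>f\<close> across the interval.  As \<open>f\<close> is decreasing, the drops
add up to at most \<open>M\<close>, so the outer measure of \<open>A n\<close> is at most \<open>M / K\<close>.  Outer measure is continuous along
increasing sequences of arbitrary sets, so this bound passes from the \<open>A n\<close> to \<open>T\<close>.\<close>

lemma steep_decrease_negligible_bounded:
  fixes f :: "real \<Rightarrow> real"
  assumes T: "T \<subseteq> {\<alpha>..\<beta>}" "\<alpha> < \<beta>" and f: "\<And>t. t \<in> T \<Longrightarrow> 0 \<le> f t \<and> f t \<le> M"
    and decreasing: "\<And>t t'. t \<in> T \<Longrightarrow> t' \<in> T \<Longrightarrow> t < t' \<Longrightarrow> f t' \<le> f t"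
    and steep: "\<And>K t. K > 0 \<Longrightarrow> t \<in> T \<Longrightarrow> \<exists>r>0. \<forall>t'\<in>T. t < t' \<and> t' < t + r \<longrightarrow> f t' + K * (t' - t) \<le> f t"
  shows "negligible T"
proof (cases "T = {}")
  case False
  then have "M \<ge> 0" using f by force
  \<comment> \<open>A decreasing extension of \<open>f\<close> to the line; the value 0 takes care of empty suprema.\<close>
  define \<phi> where "\<phi> x = Sup (insert 0 (f ` {t\<in>T. x \<le> t}))" for x
  have bdd: "bdd_above (insert 0 (f ` {t\<in>T. x \<le> t}))" for x
    using f \<open>M \<ge> 0\<close> by (auto intro!: bdd_aboveI[where M = M])
  have \<phi>_range: "0 \<le> \<phi> x" "\<phi> x \<le> M" for x
    unfolding \<phi>_def using bdd[of x] f \<open>M \<ge> 0\<close> by (auto intro: cSup_upper cSup_least)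
  have \<phi>_ge: "f t \<le> \<phi> x" if "t \<in> T" "x \<le> t" for t x
    unfolding \<phi>_def using bdd[of x] that by (auto intro: cSup_upper)
  have \<phi>_le: "\<phi> x \<le> f t" if "t \<in> T" "t \<le> x" for t x
    unfolding \<phi>_def
  proof (rule cSup_least)
    fix z assume "z \<in> insert 0 (f ` {t\<in>T. x \<le> t})"
    then consider "z = 0" | t' where "t' \<in> T" "x \<le> t'" "z = f t'" by blast
    then show "z \<le> f t"
    proof cases
      case 1
      then show ?thesis using f[OF that(1)] by simp
    next
      case 2
      then have "t = t' \<or> t < t'" using that(2) by auto
      then show ?thesis using decreasing[OF that(1) 2(1)] 2(3) by auto
    qed
  qed simp
  have \<phi>_anti: "\<phi> x' \<le> \<phi> x" if "x \<le> x'" for x x'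
    unfolding \<phi>_def
  proof (rule cSup_subset_mono)
    show "insert 0 (f ` {t\<in>T. x' \<le> t}) \<subseteq> insert 0 (f ` {t\<in>T. x \<le> t})" using that by fastforce
  qed (use bdd in auto)
  have bound: "outer_measure_of lebesgue T \<le> ennreal (M / K)" if "K > 0" for K
  proof -
    define A where "A n = {t\<in>T. \<forall>t'\<in>T. t < t' \<and> t' < t + inverse (real (Suc n)) \<longrightarrow> f t' + K * (t' - t) \<le> f t}" for n
    have "incseq A"
    proof (rule incseq_SucI)
      fix n
      have le: "inverse (real (Suc (Suc n))) \<le> inverse (real (Suc n))" by (simp add: field_simps)
      show "A n \<subseteq> A (Suc n)"
      proof
        fix t assume t: "t \<in> A n"
        have "f t' + K * (t' - t) \<le> f t" if "t' \<in> T" "t < t'" "t' < t + inverse (real (Suc (Suc n)))" for t'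
        proof -
          have "t' < t + inverse (real (Suc n))" using that(3) le by linarith
          then show ?thesis using t that(1,2) unfolding A_def by blast
        qed
        then show "t \<in> A (Suc n)" using t unfolding A_def by blast
      qed
    qed
    have UA: "(\<Union>n. A n) = T"
    proof
      show "T \<subseteq> (\<Union>n. A n)"
      proof
        fix t assume t: "t \<in> T"
        from steep[OF \<open>K > 0\<close> t] obtain r where
          r: "r > 0" "\<forall>t'\<in>T. t < t' \<and> t' < t + r \<longrightarrow> f t' + K * (t' - t) \<le> f t" by auto
        obtain n where "inverse (real (Suc n)) < r" using reals_Archimedean[OF r(1)] by blast
        then have "t \<in> A n" using r(2) t unfolding A_def by auto
        then show "t \<in> (\<Union>n. A n)" by blast
      qed
    qed (auto simp: A_def)
    have "outer_measure_of lebesgue (A n) \<le> ennreal (M / K)" for n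
    proof -
      obtain N where N: "(\<beta> - \<alpha>) * real (Suc n) < real N"
        using reals_Archimedean2 by blast
      moreover have "0 < (\<beta> - \<alpha>) * real (Suc n)" using T(2) by simp
      ultimately have "N > 0" by (cases N) auto
      define h where "h = (\<beta> - \<alpha>) / real N"
      have h: "h > 0" "h < inverse (real (Suc n))" "real N * h = \<beta> - \<alpha>"
      proof -
        show "h > 0" "real N * h = \<beta> - \<alpha>" using \<open>N > 0\<close> T(2) by (simp_all add: h_def)
        have "h * real (Suc n) < 1" using N \<open>N > 0\<close> unfolding h_def times_divide_eq_left by (subst pos_divide_less_eq) auto
        then show "h < inverse (real (Suc n))" by (simp only: inverse_eq_divide pos_less_divide_eq of_nat_0_less_iff zero_less_Suc)
      qed
      define x where "x j = \<alpha> + real j * h" for j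
      have x_le: "x j \<le> x (Suc j)" for j using h by (simp add: x_def algebra_simps)
      define I where "I j = A n \<inter> {x j..x (Suc j)}" for j
      define \<Delta> where "\<Delta> j = (\<phi> (x j) - \<phi> (x (Suc j))) / K" for j
      have \<Delta>_nonneg: "\<Delta> j \<ge> 0" for j using \<phi>_anti[OF x_le] \<open>K > 0\<close> by (simp add: \<Delta>_def)
      have close: "t' - t \<le> \<Delta> j" if "t \<in> I j" "t' \<in> I j" for t t' j
      proof (cases "t < t'")
        case True
        have tt: "t \<in> T" "t' \<in> T" "t \<in> A n" "x j \<le> t" "t' \<le> x (Suc j)" using that by (auto simp: I_def A_def)
        then have "t' < t + inverse (real (Suc n))" using h by (simp add: x_def algebra_simps)
        then have "f t' + K * (t' - t) \<le> f t" using tt True unfolding A_def by blast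
        moreover have "f t \<le> \<phi> (x j)" "\<phi> (x (Suc j)) \<le> f t'" using tt by (auto intro: \<phi>_ge \<phi>_le)
        ultimately have "K * (t' - t) \<le> \<phi> (x j) - \<phi> (x (Suc j))" by linarith
        then show ?thesis using \<open>K > 0\<close> by (simp add: \<Delta>_def field_simps)
      next
        case False
        then show ?thesis using \<Delta>_nonneg[of j] by linarith
      qed
      have "\<exists>c. I j \<subseteq> {c..c + \<Delta> j}" for j
      proof (cases "I j = {}")
        case False
        have "bdd_below (I j)" by (auto simp: I_def intro: bdd_belowI[where m = "x j"])
        then have "I j \<subseteq> {Inf (I j)..Inf (I j) + \<Delta> j}"
        proof (intro subsetI)
          fix t assume t: "t \<in> I j"
          have "t - \<Delta> j \<le> Inf (I j)" using close[OF _ t] False by (intro cInf_greatest) (auto simp: algebra_simps)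
          then show "t \<in> {Inf (I j)..Inf (I j) + \<Delta> j}" using t \<open>bdd_below (I j)\<close> by (auto intro: cInf_lower)
        qed
        then show ?thesis by blast
      qed simp
      then obtain c where c: "\<And>j. I j \<subseteq> {c j..c j + \<Delta> j}" by metis
      have cover: "A n \<subseteq> (\<Union>j<N. {c j..c j + \<Delta> j})"
      proof
        fix t assume t: "t \<in> A n"
        then have t': "\<alpha> \<le> t" "t \<le> \<beta>" using T(1) by (auto simp: A_def)
        have "\<exists>j<N. x j \<le> t \<and> t \<le> x (Suc j)"
        proof (cases "t = \<beta>")
          case True
          have "x (Suc (N - 1)) = \<beta>" using h(3) \<open>N > 0\<close> by (simp add: x_def)
          then show ?thesis using True x_le[of "N - 1"] \<open>N > 0\<close> by (intro exI[of _ "N - 1"]) auto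
        next
          case False
          define k where "k = (t - \<alpha>) / h"
          have k: "k \<ge> 0" "k < real N" "t = \<alpha> + k * h"
            using t' False h by (auto simp: k_def field_simps)
          have "nat \<lfloor>k\<rfloor> < N" using k by linarith
          moreover have "real (nat \<lfloor>k\<rfloor>) \<le> k" "k \<le> real (Suc (nat \<lfloor>k\<rfloor>))" using k by linarith+
          ultimately show ?thesis using h(1) k(3)
            by (intro exI[of _ "nat \<lfloor>k\<rfloor>"]) (auto simp: x_def mult_right_mono simp del: of_nat_Suc)
        qed
        then obtain j where j: "j < N" "t \<in> I j" using t by (auto simp: I_def)
        then have "t \<in> {c j..c j + \<Delta> j}" using subsetD[OF c[of j]] by blast
        with j(1) show "t \<in> (\<Union>j<N. {c j..c j + \<Delta> j})" by blast
      qed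
      have "outer_measure_of lebesgue (A n) \<le> outer_measure_of lebesgue (\<Union>j<N. {c j..c j + \<Delta> j})"
        using cover by (rule outer_measure_of_mono)
      also have "\<dots> = emeasure lebesgue (\<Union>j<N. {c j..c j + \<Delta> j})"
        by (rule outer_measure_of_eq) auto
      also have "\<dots> \<le> (\<Sum>j<N. emeasure lebesgue {c j..c j + \<Delta> j})"
        by (rule emeasure_subadditive_finite) auto
      also have "\<dots> = ennreal (\<Sum>j<N. \<Delta> j)"
        using \<Delta>_nonneg by (subst sum_ennreal[symmetric]) auto
      also have "(\<Sum>j<N. \<Delta> j) = (\<phi> (x 0) - \<phi> (x N)) / K"
        unfolding \<Delta>_def sum_divide_distrib[symmetric] using sum_lessThan_telescope'[of "\<lambda>j. \<phi> (x j)" N] by simp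
      also have "\<dots> \<le> M / K" using \<phi>_range[of "x 0"] \<phi>_range[of "x N"] \<open>K > 0\<close> by (intro divide_right_mono) auto
      finally show ?thesis by (simp add: ennreal_leI)
    qed
    then have "(SUP n. outer_measure_of lebesgue (A n)) \<le> ennreal (M / K)" by (intro SUP_least)
    then show ?thesis using SUP_outer_measure_of_incseq[OF _ \<open>incseq A\<close>, of lebesgue] UA by simp
  qed
  have "outer_measure_of lebesgue T \<le> 0 + ennreal e" if "e > 0" for e
  proof -
    have "outer_measure_of lebesgue T \<le> ennreal (M / ((M + 1) / e))" using that \<open>M \<ge> 0\<close> by (intro bound) simp
    also have "M / ((M + 1) / e) \<le> e" using that \<open>M \<ge> 0\<close> by (simp add: field_simps)
    finally show ?thesis by (simp add: ennreal_leI)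
  qed
  then have "outer_measure_of lebesgue T = 0" by (metis ennreal_le_epsilon le_zero_eq)
  moreover obtain E where "E \<in> sets lebesgue" "T \<subseteq> E" "outer_measure_of lebesgue T = emeasure lebesgue E"
    using outer_measure_of_attain[of T lebesgue] by auto
  ultimately show ?thesis
    using negligible_subset[of E T] by (simp add: negligible_iff_null_sets null_sets_def)
qed simp

text \<open>Countably many pieces reduce this to the previous lemma: bound \<open>f\<close> by a constant, and take
intervals so short that \<open>f\<close> decreases (with slope 1) on the piece.\<close>

theorem steep_decrease_negligible:
  fixes f :: "real \<Rightarrow> ennreal"
  assumes fin: "\<And>t. t \<in> T \<Longrightarrow> f t < \<infinity>"
    and steep: "\<And>K t. K > 0 \<Longrightarrow> t \<in> T \<Longrightarrow> \<exists>r>0. \<forall>t'\<in>T. t < t' \<and> t' < t + r \<longrightarrow> f t' + ennreal (K * (t' - t)) \<le> f t"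
  shows "negligible T"
proof -
  define g where "g t = enn2real (f t)" for t
  have fg: "f t = ennreal (g t)" if "t \<in> T" for t using fin[OF that] by (simp add: g_def less_top)
  have g0: "g t \<ge> 0" for t by (simp add: g_def)
  have steep': "\<exists>r>0. \<forall>t'\<in>T. t < t' \<and> t' < t + r \<longrightarrow> g t' + K * (t' - t) \<le> g t" if Kt: "K > 0" "t \<in> T" for K t
  proof -
    obtain r where r: "r > 0" "\<forall>t'\<in>T. t < t' \<and> t' < t + r \<longrightarrow> f t' + ennreal (K * (t' - t)) \<le> f t"
      using steep[OF Kt] by blast
    have "g t' + K * (t' - t) \<le> g t" if t': "t' \<in> T" "t < t'" "t' < t + r" for t'
    proof -
      have "ennreal (g t') + ennreal (K * (t' - t)) \<le> ennreal (g t)"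
        using r(2) t' fg[OF \<open>t \<in> T\<close>] fg[OF t'(1)] by auto
      then show ?thesis using g0 \<open>K > 0\<close> t'(2)
        by (simp add: ennreal_plus[symmetric] ennreal_le_iff del: ennreal_plus)
    qed
    with r(1) show ?thesis by blast
  qed
  define P where "P m j M = {t\<in>T. g t \<le> real M \<and> real_of_int j * inverse (real (Suc m)) \<le> t \<and>
      t < (real_of_int j + 1) * inverse (real (Suc m)) \<and>
      (\<forall>t'\<in>T. t < t' \<and> t' < t + inverse (real (Suc m)) \<longrightarrow> g t' + 1 * (t' - t) \<le> g t)}" for m :: nat and j :: int and M :: nat
  have "negligible (P m j M)" for m j M
  proof (rule steep_decrease_negligible_bounded[where f = g and M = "real M"])
    let ?i = "inverse (real (Suc m))"
    show "P m j M \<subseteq> {real_of_int j * ?i..(real_of_int j + 1) * ?i}" by (auto simp: P_def)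
    show "real_of_int j * ?i < (real_of_int j + 1) * ?i" by simp
    show "0 \<le> g t \<and> g t \<le> real M" if "t \<in> P m j M" for t using that g0 by (auto simp: P_def)
    show "g t' \<le> g t" if "t \<in> P m j M" "t' \<in> P m j M" "t < t'" for t t'
    proof -
      have "t' < (real_of_int j + 1) * ?i" "real_of_int j * ?i \<le> t" using that by (auto simp: P_def)
      then have "t' < t + ?i" by (simp add: distrib_right)
      then have "g t' + 1 * (t' - t) \<le> g t" using that unfolding P_def by blast
      then show ?thesis using that(3) by simp
    qed
    show "\<exists>r>0. \<forall>t'\<in>P m j M. t < t' \<and> t' < t + r \<longrightarrow> g t' + K * (t' - t) \<le> g t"
      if "K > 0" "t \<in> P m j M" for K t
      using steep'[of K t] that unfolding P_def by blast
  qed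
  then have "negligible (\<Union>(m, j, M)\<in>UNIV. P m j M)"
    by (intro negligible_countable_Union) (auto simp: case_prod_unfold)
  moreover have "T \<subseteq> (\<Union>(m, j, M)\<in>UNIV. P m j M)"
  proof
    fix t assume t: "t \<in> T"
    obtain r where r: "r > 0" "\<forall>t'\<in>T. t < t' \<and> t' < t + r \<longrightarrow> g t' + 1 * (t' - t) \<le> g t"
      using steep'[of 1 t] t by auto
    obtain m where m: "inverse (real (Suc m)) < r" using reals_Archimedean[OF r(1)] by blast
    obtain M where M: "g t \<le> real M" using real_arch_simple by blast
    let ?s = "real (Suc m)"
    have "real_of_int \<lfloor>t * ?s\<rfloor> \<le> t * ?s" "t * ?s < real_of_int \<lfloor>t * ?s\<rfloor> + 1" by linarith+
    then have "real_of_int \<lfloor>t * ?s\<rfloor> * inverse ?s \<le> t" "t < (real_of_int \<lfloor>t * ?s\<rfloor> + 1) * inverse ?s"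
      by (auto simp: field_simps simp del: of_nat_Suc)
    then have "t \<in> P m \<lfloor>t * ?s\<rfloor> M" using t M r(2) m unfolding P_def by auto
    then show "t \<in> (\<Union>(m, j, M)\<in>UNIV. P m j M)" by auto
  qed
  ultimately show ?thesis by (rule negligible_subset)
qed

section \<open>The gain along a curve\<close>

lemma ennreal_le_all_epsilon:
  fixes x y :: ennreal
  assumes "\<And>\<epsilon> :: real. \<epsilon> > 0 \<Longrightarrow> x \<le> y + ennreal \<epsilon>"
  shows "x \<le> y"
  by (rule ennreal_le_epsilon) (rule assms)

lemma arrival_cost_finite:
  assumes F: "F \<in> borel_measurable borel" "locally_bounded_above F" and "q < x" "s < y"
  shows "arrival_cost F q s x y < \<infinity>"
proof -
  define m where "m = 2 * (y - s) / (x - q)"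
  have m: "m > 0" using assms by (simp add: m_def)
  have "m * ((x - q) / 2) = y - s" using assms by (simp add: m_def)
  then have "(y - s) / m = (x - q) / 2" using m by (simp add: nonzero_divide_eq_eq mult.commute)
  then have "q + (y - s) / m = q + (x - q) / 2" by (simp only:)
  also have "\<dots> < x" using assms(3) by (simp add: field_simps)
  finally have m': "q + (y - s) / m < x" .
  obtain B where B: "B \<ge> 0" "\<And>t z p. t \<in> {q..x} \<Longrightarrow> z \<in> {s..y} \<Longrightarrow> \<bar>p\<bar> \<le> m \<Longrightarrow> F (t, z, p) \<le> B"
    using locally_bounded_above_box[OF F(2), of q x s y m] by metis
  have "absolutely_continuous_on q q (\<lambda>t. s)" using affine_absolutely_continuous[of q q s 0 0] by simp
  then have "arrival_cost F q s x y \<le> cost F (\<lambda>t. s) q q + ennreal (B * (x - q))"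
    by (rule arrival_cost_le_extension[OF F(1) _ _ _ m]) (use m' B assms in auto)
  then show ?thesis by (simp add: order.strict_trans1)
qed

text \<open>Besides the gain, the final climb \<open>g\<close> and a bound for its cost are recorded: \<open>gain_downward\<close>
needs them to see that the height \<open>y - d\<close> is reached early enough.\<close>

definition gain_at_depth ::
  "(real \<times> real \<times> real \<Rightarrow> real) \<Rightarrow> real \<Rightarrow> real \<Rightarrow> real \<Rightarrow> real \<Rightarrow> real \<Rightarrow> real \<Rightarrow> real \<Rightarrow> real \<Rightarrow> real \<Rightarrow> bool" where
  "gain_at_depth F q s x y K C \<kappa> d \<epsilon> \<longleftrightarrow> (\<exists>\<tau> t w g. q \<le> \<tau> \<and> x - \<kappa> * d \<le> \<tau> \<and> \<tau> < t \<and> t \<le> x \<and>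
     absolutely_continuous_on q \<tau> w \<and> w q = s \<and> w \<tau> = y - d \<and>
     absolutely_continuous_on \<tau> t g \<and> g \<tau> = y - d \<and> g t \<ge> y - d / 2 \<and>
     cost F g \<tau> t \<le> arrival_cost F q s x y + ennreal \<epsilon> \<and>
     cost F w q \<tau> + ennreal (K * d / 2) \<le> arrival_cost F q s x y + ennreal (C * \<kappa> * d + \<epsilon>))"

lemma descends_gain:
  assumes F: "F \<in> borel_measurable borel" and desc: "descends F q s x y"
    and fin: "arrival_cost F q s x y < \<infinity>"
    and KC: "K \<ge> 0" "C \<ge> 0" "\<And>x y p. F (x, y, p) \<ge> K * \<bar>p\<bar> - C" and "\<kappa> > 0"
  shows "\<exists>d0>0. \<forall>d \<epsilon>. 0 < d \<and> d < d0 \<and> 0 < \<epsilon> \<longrightarrow>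
    gain_at_depth F q s x y K C \<kappa> d \<epsilon>"
proof -
  let ?f = "arrival_cost F q s x y"
  obtain d0 where d0: "d0 > 0" "\<forall>d v. 0 < d \<and> d < d0 \<and> arrival_path q s x y v \<longrightarrow>
     (\<forall>\<epsilon>>0. splits_below F q s (x - \<kappa> * d) x y d (cost F v q x + ennreal \<epsilon>))"
    using desc[unfolded descends_def, rule_format, OF \<open>\<kappa> > 0\<close>] by (elim exE conjE) (rule that)
  show ?thesis
  proof (rule exI[of _ d0], intro conjI allI impI)
    show "d0 > 0" by (rule d0)
    fix d \<epsilon> :: real assume d: "0 < d \<and> d < d0 \<and> 0 < \<epsilon>"
    have "?f < ?f + ennreal (\<epsilon> / 2)" using fin d by (cases ?f) (auto simp: ennreal_plus[symmetric] ennreal_less_iff simp del: ennreal_plus)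
    then obtain v where v: "arrival_path q s x y v" "cost F v q x < ?f + ennreal (\<epsilon> / 2)"
      unfolding arrival_cost_def[of F q s x y] INF_less_iff by auto
    have half: "?f + ennreal (\<epsilon> / 2) + ennreal (\<epsilon> / 2) = ?f + ennreal \<epsilon>"
      using d by (simp add: add.assoc ennreal_plus[symmetric] del: ennreal_plus)
    obtain \<tau> t w g where *: "q \<le> \<tau>" "x - \<kappa> * d \<le> \<tau>" "\<tau> < t" "t \<le> x"
        "absolutely_continuous_on q \<tau> w" "w q = s" "w \<tau> = y - d"
        "absolutely_continuous_on \<tau> t g" "g \<tau> = y - d" "g t \<ge> y - d / 2"
        "cost F w q \<tau> + cost F g \<tau> t \<le> cost F v q x + ennreal (\<epsilon> / 2)"
    proof -
      have "0 < d \<and> d < d0 \<and> arrival_path q s x y v" "0 < \<epsilon> / 2" using d v(1) by simp_all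
      from d0(2)[rule_format, OF this] show thesis
        unfolding splits_below_def by (elim exE conjE) (rule that)
    qed
    have total: "cost F w q \<tau> + cost F g \<tau> t \<le> ?f + ennreal \<epsilon>"
      using *(11) add_right_mono[OF less_imp_le[OF v(2)], of "ennreal (\<epsilon> / 2)"] half by simp
    have g_le: "cost F g \<tau> t \<le> ?f + ennreal \<epsilon>"
      using total by (meson add_increasing order.refl order.trans zero_le)
    have "cost F w q \<tau> + ennreal (K * d / 2) \<le> cost F w q \<tau> + (cost F g \<tau> t + ennreal (C * \<kappa> * d))"
    proof (rule add_left_mono)
      have "ennreal (K * d / 2) \<le> ennreal (K * \<bar>g t - g \<tau>\<bar>)"
      proof (rule ennreal_leI)
        have "d / 2 \<le> \<bar>g t - g \<tau>\<bar>" using *(9,10) by linarith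
        then have "K * (d / 2) \<le> K * \<bar>g t - g \<tau>\<bar>" using KC(1) by (rule mult_left_mono)
        then show "K * d / 2 \<le> K * \<bar>g t - g \<tau>\<bar>" by simp
      qed
      also have "\<dots> \<le> cost F g \<tau> t + ennreal (C * (t - \<tau>))"
        using *(3) by (intro cost_ge_climb *(8) F KC) auto
      also have "\<dots> \<le> cost F g \<tau> t + ennreal (C * \<kappa> * d)"
      proof (intro add_left_mono ennreal_leI)
        have "C * (t - \<tau>) \<le> C * (\<kappa> * d)" using *(2,4) KC(2) by (intro mult_left_mono) auto
        then show "C * (t - \<tau>) \<le> C * \<kappa> * d" by (simp add: mult.assoc)
      qed
      finally show "ennreal (K * d / 2) \<le> cost F g \<tau> t + ennreal (C * \<kappa> * d)" .
    qed
    also have "\<dots> \<le> ?f + ennreal \<epsilon> + ennreal (C * \<kappa> * d)"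
      using add_right_mono[OF total, of "ennreal (C * \<kappa> * d)"] by (simp add: add.assoc)
    also have "\<dots> = ?f + ennreal (C * \<kappa> * d + \<epsilon>)"
      using d KC(2) \<open>\<kappa> > 0\<close> by (simp add: add.assoc add.commute ennreal_plus)
    finally show "gain_at_depth F q s x y K C \<kappa> d \<epsilon>"
      using * g_le unfolding gain_at_depth_def by (intro exI[of _ \<tau>] exI[of _ t] exI[of _ w] exI[of _ g]) blast
  qed
qed

text \<open>The bookkeeping common to \<open>gain_forward\<close> and \<open>gain_downward\<close>: the budget \<open>K + 1 + 2 * B\<close> for the
slope of the climb pays for the gain \<open>K\<close>, for the error of \<open>cost_ge_climb\<close>, and for reaching the
new point in time at most \<open>2 * d\<close> at cost \<open>B\<close> per unit of time.\<close>

lemma gain_transfer: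
  fixes f f' W :: ennreal
  assumes "f' \<le> W + ennreal (B * l)" "W + ennreal (2 * (K + 1 + 2 * B) * d / 2) \<le> f + ennreal (C * \<kappa> * d + \<epsilon>)"
    and "l \<le> 2 * d" "C * \<kappa> \<le> 1" "0 \<le> B" "0 \<le> K" "0 < d" "0 < \<epsilon>" "0 \<le> C" "0 < \<kappa>"
  shows "f' + ennreal (K * d) \<le> f + ennreal \<epsilon>"
proof -
  have e1: "ennreal (2 * (K + 1 + 2 * B) * d / 2) = ennreal (K * d) + ennreal ((1 + 2 * B) * d)"
  proof -
    have eq: "2 * (K + 1 + 2 * B) * d / 2 = K * d + (1 + 2 * B) * d" by (simp add: algebra_simps)
    show ?thesis unfolding eq by (rule ennreal_plus) (use assms in simp_all)
  qed
  have e2: "ennreal ((1 + 2 * B) * d) = ennreal (2 * B * d) + ennreal d"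
    using assms by (subst ennreal_plus[symmetric]) (auto simp: algebra_simps)
  have "f' + ennreal (K * d) + ennreal d \<le> W + ennreal (2 * B * d) + ennreal (K * d) + ennreal d"
  proof (intro add_right_mono)
    have "B * l \<le> 2 * B * d" using mult_left_mono[OF assms(3) assms(5)] by simp
    then show "f' \<le> W + ennreal (2 * B * d)" using assms(1) by (meson add_left_mono ennreal_leI order.trans)
  qed
  also have "\<dots> = W + (ennreal (K * d) + ennreal ((1 + 2 * B) * d))"
    unfolding e2 by (simp add: add_ac)
  also have "\<dots> \<le> f + ennreal (C * \<kappa> * d + \<epsilon>)"
    by (rule ord_eq_le_trans[OF _ assms(2)]) (simp only: e1)
  also have "\<dots> \<le> f + ennreal (d + \<epsilon>)"
    using assms mult_right_mono[OF assms(4), of d] by (intro add_left_mono ennreal_leI) simp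
  also have "\<dots> = f + ennreal \<epsilon> + ennreal d"
    using assms by (simp add: ac_simps ennreal_plus)
  finally have "ennreal d + (f' + ennreal (K * d)) \<le> ennreal d + (f + ennreal \<epsilon>)"
    by (simp add: ac_simps)
  then show ?thesis by (simp add: ennreal_add_left_cancel_le)
qed

text \<open>With \<open>d = (\<Lambda> + 1) * (x' - x)\<close> the height \<open>y - d\<close> lies below the new height \<open>y'\<close> by at most
\<open>(2 * \<Lambda> + 1) * (x' - x)\<close>, so it is left with slope \<open>2 * \<Lambda> + 2\<close> after time \<open>\<tau> \<le> x\<close> early enough to be at \<open>y'\<close>
before time \<open>x'\<close>.\<close>

lemma gain_forward:
  assumes F: "F \<in> borel_measurable borel" "locally_bounded_above F"
    and growth: "\<And>K. K \<ge> 0 \<Longrightarrow> \<exists>C\<ge>0. \<forall>x y p. F (x, y, p) \<ge> K * \<bar>p\<bar> - C"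
    and desc: "descends F q s x y" "q < x" "s < y" and "\<Lambda> \<ge> 0" "K \<ge> 0"
  shows "\<exists>\<rho>>0. \<forall>x' y'. x < x' \<and> x' < x + \<rho> \<and> \<bar>y' - y\<bar> \<le> \<Lambda> * (x' - x) \<longrightarrow>
    arrival_cost F q s x' y' + ennreal (K * (x' - x)) \<le> arrival_cost F q s x y"
proof -
  let ?f = "arrival_cost F q s"
  define m where "m = 2 * \<Lambda> + 2"
  obtain B where B: "B \<ge> 0" "\<And>t z p. t \<in> {q..x + 1} \<Longrightarrow> z \<in> {y - 1..y + 1} \<Longrightarrow> \<bar>p\<bar> \<le> m \<Longrightarrow> F (t, z, p) \<le> B"
    using locally_bounded_above_box[OF F(2), of q "x + 1" "y - 1" "y + 1" m] by metis
  define K1 where "K1 = 2 * (K + 1 + 2 * B)"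
  have K1: "K1 \<ge> 0" using B \<open>K \<ge> 0\<close> by (simp add: K1_def)
  obtain C where C: "C \<ge> 0" "\<And>x y p. F (x, y, p) \<ge> K1 * \<bar>p\<bar> - C" using growth[OF K1] by blast
  define \<kappa> where "\<kappa> = 1 / (C + 1)"
  have \<kappa>: "\<kappa> > 0" "\<kappa> \<le> 1" "C * \<kappa> \<le> 1" using C(1) by (auto simp: \<kappa>_def)
  have fin: "?f x y < \<infinity>" by (rule arrival_cost_finite[OF F desc(2,3)])
  obtain d0 where d0: "d0 > 0" "\<forall>d \<epsilon>. 0 < d \<and> d < d0 \<and> 0 < \<epsilon> \<longrightarrow>
    gain_at_depth F q s x y K1 C \<kappa> d \<epsilon>"
    using descends_gain[OF F(1) desc(1) fin K1 C \<kappa>(1)] by blast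
  show ?thesis
  proof (rule exI[of _ "min d0 1 / (\<Lambda> + 1)"], intro conjI allI impI)
    show "min d0 1 / (\<Lambda> + 1) > 0" using d0(1) \<open>\<Lambda> \<ge> 0\<close> by simp
    fix x' y' assume *: "x < x' \<and> x' < x + min d0 1 / (\<Lambda> + 1) \<and> \<bar>y' - y\<bar> \<le> \<Lambda> * (x' - x)"
    define D where "D = x' - x"
    define d where "d = (\<Lambda> + 1) * D"
    have D: "D > 0" "D \<le> d" "d < d0" "d < 1" "\<bar>y' - y\<bar> \<le> \<Lambda> * D"
    proof -
      show "D > 0" using * by (simp add: D_def)
      then show "D \<le> d" using \<open>\<Lambda> \<ge> 0\<close> by (simp add: d_def algebra_simps)
      have "D < min d0 1 / (\<Lambda> + 1)" using * by (simp add: D_def)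
      then have "d < min d0 1" using \<open>\<Lambda> \<ge> 0\<close> by (simp add: d_def field_simps)
      then show "d < d0" "d < 1" by auto
    qed (use * in \<open>simp add: D_def\<close>)
    have d_pos: "d > 0" using D by linarith
    have "?f x' y' + ennreal (K * d) \<le> ?f x y + ennreal \<epsilon>" if "\<epsilon> > 0" for \<epsilon>
    proof -
      obtain \<tau> t w g where w: "q \<le> \<tau>" "x - \<kappa> * d \<le> \<tau>" "\<tau> < t" "t \<le> x"
        "absolutely_continuous_on q \<tau> w" "w q = s" "w \<tau> = y - d"
        "cost F w q \<tau> + ennreal (K1 * d / 2) \<le> ?f x y + ennreal (C * \<kappa> * d + \<epsilon>)"
        using d0(2)[rule_format, of d \<epsilon>] d_pos D(3) \<open>\<epsilon> > 0\<close> unfolding gain_at_depth_def by blast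
      have climb: "D \<le> y' - w \<tau>" "y' - w \<tau> < m * D" "y' \<le> y + d"
        using D(1,5) w(7) by (auto simp: d_def m_def algebra_simps abs_le_iff)
      have in_time: "\<tau> + (y' - w \<tau>) / m < x'"
      proof -
        have "(y' - w \<tau>) / m < D" using climb(2) \<open>\<Lambda> \<ge> 0\<close> by (simp add: m_def field_simps)
        then show ?thesis using w(3,4) by (simp add: D_def)
      qed
      have "?f x' y' \<le> cost F w q \<tau> + ennreal (B * (x' - \<tau>))"
      proof (rule arrival_cost_le_extension[OF F(1) w(5,6,1) _ _ in_time B(1)])
        show "m > 0" using \<open>\<Lambda> \<ge> 0\<close> by (simp add: m_def)
        show "w \<tau> \<le> y'" using climb D(1) by simp
        fix t z p assume "t \<in> {\<tau>..x'}" "z \<in> {w \<tau>..y'}" "\<bar>p\<bar> \<le> m"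
        then show "F (t, z, p) \<le> B" using w(1,7) climb(3) D by (intro B(2)) (auto simp: D_def)
      qed
      moreover have "x' - \<tau> \<le> 2 * d"
      proof -
        have "\<kappa> * d \<le> d" using \<kappa>(2) d_pos by simp
        then show ?thesis using w(2) D(2) by (simp add: D_def)
      qed
      ultimately show ?thesis
        using w(8)[unfolded K1_def] \<kappa> B(1) \<open>K \<ge> 0\<close> d_pos \<open>\<epsilon> > 0\<close> C(1) by (intro gain_transfer)
    qed
    then have "?f x' y' + ennreal (K * d) \<le> ?f x y" by (rule ennreal_le_all_epsilon)
    moreover have "?f x' y' + ennreal (K * (x' - x)) \<le> ?f x' y' + ennreal (K * d)"
      using mult_left_mono[OF D(2) \<open>K \<ge> 0\<close>] unfolding D_def by (intro add_left_mono ennreal_leI)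
    ultimately show "?f x' y' + ennreal (K * (x' - x)) \<le> ?f x y" by (rule order.trans[rotated])
  qed
qed

text \<open>Here \<open>d = y - y'\<close>, and the path that has been stopped at the height \<open>y'\<close> only waits, provided that it
arrives before time \<open>x'\<close>.  If it did not, the final climb by \<open>d / 2\<close> would take place in time at
most \<open>d / (4 * k + 4)\<close>, and by the choice of \<open>G k\<close> would cost at least \<open>G k * d / 4\<close>, which exceeds
the bound \<open>M + 1\<close> for it.\<close>

lemma gain_downward:
  assumes F: "F \<in> borel_measurable borel" "locally_bounded_above F"
    and growth: "\<And>K. K \<ge> 0 \<Longrightarrow> \<exists>C\<ge>0. \<forall>x y p. F (x, y, p) \<ge> K * \<bar>p\<bar> - C"
    and G: "\<And>k. G k \<ge> 0" "\<And>k x y p. F (x, y, p) \<ge> G k * \<bar>p\<bar> - real k * G k"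
    and desc: "descends F q s x y" "q < x" "s < y" and "K \<ge> 0"
    and M: "arrival_cost F q s x y \<le> ennreal M" "M \<ge> 0"
  shows "\<exists>\<rho>>0. \<forall>x' y' k. y - \<rho> < y' \<and> y' < y \<and> \<bar>x' - x\<bar> \<le> (y - y') / (4 * real k + 4) \<and>
      4 * (M + 2) \<le> G k * (y - y') \<longrightarrow>
    arrival_cost F q s x' y' + ennreal (K * (y - y')) \<le> arrival_cost F q s x y"
proof -
  let ?f = "arrival_cost F q s"
  obtain B where B: "B \<ge> 0" "\<And>t z p. t \<in> {q..x + 1} \<Longrightarrow> z \<in> {y - 1..y + 1} \<Longrightarrow> \<bar>p\<bar> \<le> 1 \<Longrightarrow> F (t, z, p) \<le> B"
    using locally_bounded_above_box[OF F(2), of q "x + 1" "y - 1" "y + 1" 1] by metis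
  define K1 where "K1 = 2 * (K + 1 + 2 * B)"
  have K1: "K1 \<ge> 0" using B \<open>K \<ge> 0\<close> by (simp add: K1_def)
  obtain C where C: "C \<ge> 0" "\<And>x y p. F (x, y, p) \<ge> K1 * \<bar>p\<bar> - C" using growth[OF K1] by blast
  define \<kappa> where "\<kappa> = 1 / (C + 1)"
  have \<kappa>: "\<kappa> > 0" "\<kappa> \<le> 1" "C * \<kappa> \<le> 1" using C(1) by (auto simp: \<kappa>_def)
  have fin: "?f x y < \<infinity>" by (rule arrival_cost_finite[OF F desc(2,3)])
  obtain d0 where d0: "d0 > 0" "\<forall>d \<epsilon>. 0 < d \<and> d < d0 \<and> 0 < \<epsilon> \<longrightarrow>
    gain_at_depth F q s x y K1 C \<kappa> d \<epsilon>"
    using descends_gain[OF F(1) desc(1) fin K1 C \<kappa>(1)] by blast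
  show ?thesis
  proof (rule exI[of _ "min d0 1"], intro conjI allI impI)
    show "min d0 1 > 0" using d0(1) by simp
    fix x' y' k
    assume *: "y - min d0 1 < y' \<and> y' < y \<and> \<bar>x' - x\<bar> \<le> (y - y') / (4 * real k + 4) \<and> 4 * (M + 2) \<le> G k * (y - y')"
    define d where "d = y - y'"
    have d: "d > 0" "d < d0" "d < 1" "\<bar>x' - x\<bar> \<le> d / (4 * real k + 4)" "4 * (M + 2) \<le> G k * d"
      using * by (auto simp: d_def)
    have dx: "\<bar>x' - x\<bar> \<le> d"
    proof -
      have "d / (4 * real k + 4) \<le> d / 1" using d(1) by (intro divide_left_mono) auto
      then show ?thesis using d(4) by simp
    qed
    have small: "?f x' y' + ennreal (K * d) \<le> ?f x y + ennreal \<epsilon>" if "\<epsilon> > 0" "\<epsilon> \<le> 1" for \<epsilon>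
    proof -
      obtain \<tau> t w g where w: "q \<le> \<tau>" "x - \<kappa> * d \<le> \<tau>" "\<tau> < t" "t \<le> x"
        "absolutely_continuous_on q \<tau> w" "w q = s" "w \<tau> = y - d"
        "cost F w q \<tau> + ennreal (K1 * d / 2) \<le> ?f x y + ennreal (C * \<kappa> * d + \<epsilon>)"
        and g: "absolutely_continuous_on \<tau> t g" "g \<tau> = y - d" "g t \<ge> y - d / 2"
        "cost F g \<tau> t \<le> ?f x y + ennreal \<epsilon>"
        using d0(2)[rule_format, of d \<epsilon>] d \<open>\<epsilon> > 0\<close> unfolding gain_at_depth_def by blast
      have in_time: "\<tau> < x'"
      proof (rule ccontr)
        assume "\<not> \<tau> < x'"
        then have short: "t - \<tau> \<le> d / (4 * real k + 4)" using w(4) d(4) by linarith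
        have "ennreal (G k * (d / 2)) \<le> ennreal (G k * \<bar>g t - g \<tau>\<bar>)"
        proof (intro ennreal_leI mult_left_mono)
          show "d / 2 \<le> \<bar>g t - g \<tau>\<bar>" using g(2,3) by linarith
        qed (rule G(1))
        also have "\<dots> \<le> cost F g \<tau> t + ennreal (real k * G k * (t - \<tau>))"
          using w(3) G by (intro cost_ge_climb g F) auto
        also have "\<dots> \<le> ennreal M + ennreal 1 + ennreal (G k * d / 4)"
        proof (rule add_mono)
          show "cost F g \<tau> t \<le> ennreal M + ennreal 1"
            using g(4) M(1) \<open>\<epsilon> \<le> 1\<close> by (meson add_mono ennreal_leI order.trans)
          have "real k * G k * (t - \<tau>) \<le> real k * G k * (d / (4 * real k + 4))"
            using short G(1)[of k] by (intro mult_left_mono) auto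
          also have "\<dots> = G k * d * (real k / (4 * real k + 4))" by simp
          also have "\<dots> \<le> G k * d * (1 / 4)"
            using G(1)[of k] d(1) by (intro mult_left_mono) (auto simp: field_simps)
          finally show "ennreal (real k * G k * (t - \<tau>)) \<le> ennreal (G k * d / 4)"
            by (intro ennreal_leI) simp
        qed
        also have "\<dots> = ennreal (M + 1 + G k * d / 4)"
          using M(2) G(1)[of k] d(1) by (simp add: ennreal_plus)
        finally have "G k * (d / 2) \<le> M + 1 + G k * d / 4"
          using M(2) G(1)[of k] d(1) by (subst (asm) ennreal_le_iff) auto
        moreover have "G k * (d / 2) = (G k * d) / 2" by simp
        ultimately have "G k * d / 2 \<le> M + 1 + G k * d / 4" by (simp only:)
        then show False using d(5) M(2) by argo
      qed
      have "?f x' y' \<le> cost F w q \<tau> + ennreal (B * (x' - \<tau>))"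
      proof (rule arrival_cost_le_extension[OF F(1) w(5,6,1), of 1])
        show "F (t, z, p) \<le> B" if "t \<in> {\<tau>..x'}" "z \<in> {w \<tau>..y'}" "\<bar>p\<bar> \<le> 1" for t z p
        proof (rule B(2))
          have "x' \<le> x + 1" using dx d(3) by linarith
          then show "t \<in> {q..x + 1}" using that(1) w(1) by simp
          show "z \<in> {y - 1..y + 1}" using that(2) w(7) d(1,3) by (simp add: d_def)
        qed (rule that(3))
      qed (use w(7) B(1) in_time in \<open>auto simp: d_def\<close>)
      moreover have "x' - \<tau> \<le> 2 * d"
      proof -
        have "\<kappa> * d \<le> d" using \<kappa>(2) d(1) by simp
        then show ?thesis using w(2) dx by linarith
      qed
      ultimately show ?thesis
        using w(8)[unfolded K1_def] \<kappa> B(1) \<open>K \<ge> 0\<close> d(1) \<open>\<epsilon> > 0\<close> C(1) by (intro gain_transfer)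
    qed
    have "?f x' y' + ennreal (K * d) \<le> ?f x y + ennreal \<epsilon>" if "\<epsilon> > 0" for \<epsilon>
    proof -
      have "?f x' y' + ennreal (K * d) \<le> ?f x y + ennreal (min \<epsilon> 1)" using that by (intro small) auto
      also have "\<dots> \<le> ?f x y + ennreal \<epsilon>" by (intro add_left_mono ennreal_leI) simp
      finally show ?thesis .
    qed
    then have "?f x' y' + ennreal (K * d) \<le> ?f x y" by (rule ennreal_le_all_epsilon)
    then show "?f x' y' + ennreal (K * (y - y')) \<le> ?f x y" by (simp add: d_def)
  qed
qed


section \<open>Sets of length zero\<close>

definition length_null :: "'a::metric_space set \<Rightarrow> bool" where
  "length_null A \<longleftrightarrow> (\<forall>\<delta>>0. \<forall>\<epsilon>>0. \<exists>C :: nat \<Rightarrow> 'a set. A \<subseteq> (\<Union>n. C n) \<and>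
     (\<forall>n. bounded (C n) \<and> diameter (C n) \<le> \<delta>) \<and> (\<Sum>n. ennreal (diameter (C n))) \<le> ennreal \<epsilon>)"

lemma length_null_imp_hausdorff_measure_0:
  assumes "length_null A"
  shows "hausdorff_measure_1 A = 0"
proof -
  have "(INF C\<in>{C :: nat \<Rightarrow> 'a set. A \<subseteq> (\<Union>n. C n) \<and>
        (\<forall>n. bounded (C n) \<and> diameter (C n) \<le> \<delta>)}. \<Sum>n. ennreal (diameter (C n))) = 0" (is "?I = 0")
    if "\<delta> \<in> {0<..}" for \<delta> :: real
  proof -
    have "?I \<le> 0 + ennreal \<epsilon>" if "\<epsilon> > 0" for \<epsilon>
    proof -
      obtain C :: "nat \<Rightarrow> 'a set" where C: "A \<subseteq> (\<Union>n. C n)" "\<forall>n. bounded (C n) \<and> diameter (C n) \<le> \<delta>"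
        "(\<Sum>n. ennreal (diameter (C n))) \<le> ennreal \<epsilon>"
        using assms \<open>\<delta> \<in> {0<..}\<close> \<open>\<epsilon> > 0\<close> unfolding length_null_def by (metis greaterThan_iff)
      have "?I \<le> (\<Sum>n. ennreal (diameter (C n)))" by (rule INF_lower) (use C in blast)
      with C(3) show ?thesis by simp
    qed
    then have "?I \<le> 0" by (rule ennreal_le_all_epsilon)
    then show ?thesis by simp
  qed
  then show ?thesis unfolding hausdorff_measure_1_def by (simp add: SUP_eq_const)
qed

lemma length_null_subset: "length_null B \<Longrightarrow> A \<subseteq> B \<Longrightarrow> length_null A"
  unfolding length_null_def by (meson order.trans)

lemma length_null_UN:
  fixes A :: "nat \<Rightarrow> 'a::metric_space set"
  assumes "\<And>i. length_null (A i)"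
  shows "length_null (\<Union>i. A i)"
  unfolding length_null_def
proof (intro allI impI)
  fix \<delta> \<epsilon> :: real assume "\<delta> > 0" "\<epsilon> > 0"
  have "\<exists>C :: nat \<Rightarrow> 'a set. A i \<subseteq> (\<Union>n. C n) \<and> (\<forall>n. bounded (C n) \<and> diameter (C n) \<le> \<delta>) \<and>
      (\<Sum>n. ennreal (diameter (C n))) \<le> ennreal (\<epsilon> * (1 / 2) ^ Suc i)" for i
    using assms[of i, unfolded length_null_def, rule_format, OF \<open>\<delta> > 0\<close>, of "\<epsilon> * (1 / 2) ^ Suc i"] \<open>\<epsilon> > 0\<close> by simp
  then obtain C :: "nat \<Rightarrow> nat \<Rightarrow> 'a set" where C: "\<And>i. A i \<subseteq> (\<Union>n. C i n)"
    "\<And>i n. bounded (C i n)" "\<And>i n. diameter (C i n) \<le> \<delta>"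
    "\<And>i. (\<Sum>n. ennreal (diameter (C i n))) \<le> ennreal (\<epsilon> * (1 / 2) ^ Suc i)"
    by metis
  define D where "D m = (case prod_decode m of (i, n) \<Rightarrow> C i n)" for m
  have "(\<Union>i. A i) \<subseteq> (\<Union>m. D m)"
  proof
    fix z assume "z \<in> (\<Union>i. A i)"
    then obtain i n where "z \<in> C i n" using C(1) by blast
    then have "z \<in> D (prod_encode (i, n))" by (simp add: D_def)
    then show "z \<in> (\<Union>m. D m)" by blast
  qed
  moreover have "bounded (D m) \<and> diameter (D m) \<le> \<delta>" for m
    using C(2,3) by (simp add: D_def split: prod.split)
  moreover have "(\<Sum>m. ennreal (diameter (D m))) \<le> ennreal \<epsilon>"
  proof -
    let ?f = "\<lambda>(i, n). ennreal (diameter (C i n))"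
    have "(\<Sum>m. ennreal (diameter (D m))) = (\<Sum>m. ?f (prod_decode m))"
      by (simp add: D_def case_prod_unfold)
    also have "\<dots> = (\<Sum>i. \<Sum>n. ennreal (diameter (C i n)))"
      by (rule suminf_ennreal_2dimen) simp
    also have "\<dots> \<le> (\<Sum>i. ennreal (\<epsilon> * (1 / 2) ^ Suc i))"
      by (intro suminf_le C(4)) auto
    also have "\<dots> = ennreal (\<Sum>i. \<epsilon> * (1 / 2) ^ Suc i)"
      using \<open>\<epsilon> > 0\<close> power_half_series by (intro suminf_ennreal2) (auto intro: sums_summable summable_mult)
    also have "(\<Sum>i. \<epsilon> * (1 / 2) ^ Suc i) = \<epsilon>"
      using sums_unique[OF sums_mult[OF power_half_series, of \<epsilon>]] by simp
    finally show ?thesis .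
  qed
  ultimately show "\<exists>C. (\<Union>i. A i) \<subseteq> (\<Union>n. C n) \<and> (\<forall>n. bounded (C n) \<and> diameter (C n) \<le> \<delta>) \<and>
      (\<Sum>n. ennreal (diameter (C n))) \<le> ennreal \<epsilon>" by blast
qed

text \<open>Disjoint balls in \<open>U\<close> have radii of total size at most \<open>m / 2\<close>, and by Vitali's lemma the balls
can be chosen such that five times larger ones cover \<open>W\<close>.  The image of a ball of radius
\<open>5 * r\<close> has diameter at most \<open>10 * c * r\<close>.  The lemma is used with a small \<open>m\<close> for null sets
and with a small \<open>c\<close> for sets where the derivative vanishes.\<close>

lemma Vitali_image_cover:
  fixes \<gamma> :: "real \<Rightarrow> 'a::metric_space"
  assumes U: "U \<in> lmeasurable" "measure lebesgue U \<le> m" and "c \<ge> 0" "\<delta> > 0"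
    and local: "\<And>t \<rho>. t \<in> W \<Longrightarrow> \<rho> > 0 \<Longrightarrow>
      \<exists>r. 0 < r \<and> r \<le> \<rho> \<and> cball t r \<subseteq> U \<and> (\<forall>t'\<in>cball t (5 * r). dist (\<gamma> t') (\<gamma> t) \<le> c * (5 * r))"
  shows "\<exists>C :: nat \<Rightarrow> 'a set. \<gamma> ` W \<subseteq> (\<Union>n. C n) \<and> (\<forall>n. bounded (C n) \<and> diameter (C n) \<le> \<delta>) \<and>
     (\<Sum>n. ennreal (diameter (C n))) \<le> ennreal (5 * c * m)"
proof -
  define \<rho> where "\<rho> = \<delta> / (10 * (c + 1))"
  have "\<rho> > 0" using assms by (simp add: \<rho>_def)
  have "\<forall>t\<in>W. \<exists>r. 0 < r \<and> r \<le> \<rho> \<and> cball t r \<subseteq> U \<and> (\<forall>t'\<in>cball t (5 * r). dist (\<gamma> t') (\<gamma> t) \<le> c * (5 * r))"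
    using local \<open>\<rho> > 0\<close> by blast
  then obtain r where r: "\<And>t. t \<in> W \<Longrightarrow> 0 < r t \<and> r t \<le> \<rho>" "\<And>t. t \<in> W \<Longrightarrow> cball t (r t) \<subseteq> U"
    "\<And>t t'. t \<in> W \<Longrightarrow> t' \<in> cball t (5 * r t) \<Longrightarrow> dist (\<gamma> t') (\<gamma> t) \<le> c * (5 * r t)"
    by metis
  have sub: "W \<subseteq> (\<Union>t\<in>W. cball t (r t))"
  proof
    fix t assume "t \<in> W"
    then show "t \<in> (\<Union>t\<in>W. cball t (r t))" using r(1)[of t] by (intro UN_I[of t]) auto
  qed
  obtain J where J: "countable J" "J \<subseteq> W"
     "pairwise (\<lambda>i j. disjnt (cball i (r i)) (cball j (r j))) J"
     "W \<subseteq> (\<Union>i\<in>J. cball i (5 * r i))"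
    by (rule Vitali_covering_lemma_cballs[where a = "\<lambda>t. t" and r = r, OF sub r(1)]) (assumption, rule that)
  define K where "K t = \<gamma> ` cball t (5 * r t)" for t
  have diam: "bounded (K t)" "diameter (K t) \<le> 10 * c * r t" if "t \<in> J" for t
  proof -
    have t: "t \<in> W" using that J by blast
    have dist_le: "dist a b \<le> 10 * c * r t" if ab: "a \<in> K t" "b \<in> K t" for a b
    proof -
      have "dist a (\<gamma> t) \<le> c * (5 * r t)" "dist b (\<gamma> t) \<le> c * (5 * r t)"
        using ab r(3)[OF t] by (auto simp: K_def)
      then show ?thesis using dist_triangle2[of a b "\<gamma> t"] by simp
    qed
    have "\<gamma> t \<in> K t" using r(1)[OF t] by (simp add: K_def)
    then show "diameter (K t) \<le> 10 * c * r t"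
      using dist_le by (auto simp: diameter_def intro!: cSUP_least)
    have "K t \<subseteq> cball (\<gamma> t) (c * (5 * r t))"
      using r(3)[OF t] by (auto simp: K_def dist_commute)
    then show "bounded (K t)" by (rule bounded_subset[OF bounded_cball])
  qed
  define C where "C n = (if n \<in> to_nat_on J ` J then K (from_nat_into J n) else {})" for n
  have idx: "from_nat_into J n \<in> J" "to_nat_on J (from_nat_into J n) = n" if "n \<in> to_nat_on J ` J" for n
    using that J(1) by auto
  have diamC: "bounded (C n)" "diameter (C n) \<le> \<delta>" for n
  proof -
    have "10 * c * r t \<le> \<delta>" if "t \<in> J" for t
    proof -
      have "10 * c * r t \<le> 10 * (c + 1) * \<rho>" using r(1)[of t] J(2) that \<open>c \<ge> 0\<close> by (intro mult_mono) auto
      then show ?thesis using \<open>c \<ge> 0\<close> by (simp add: \<rho>_def)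
    qed
    then show "bounded (C n)" "diameter (C n) \<le> \<delta>"
      using idx(1)[of n] diam[of "from_nat_into J n"] \<open>\<delta> > 0\<close> by (auto simp: C_def intro: order.trans)
  qed
  have "\<gamma> ` W \<subseteq> (\<Union>n. C n)"
  proof
    fix z assume "z \<in> \<gamma> ` W"
    then obtain t where t: "t \<in> J" "z \<in> K t" using J(4) unfolding K_def by blast
    then have "z \<in> C (to_nat_on J t)" using J(1) by (simp add: C_def)
    then show "z \<in> (\<Union>n. C n)" by blast
  qed
  moreover have "(\<Sum>n. ennreal (diameter (C n))) \<le> ennreal (5 * c * m)"
    unfolding suminf_eq_SUP
  proof (rule SUP_least)
    fix N
    define I where "I = {n. n < N \<and> n \<in> to_nat_on J ` J}"
    have fin: "finite I" by (simp add: I_def)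
    have inj: "inj_on (from_nat_into J) I" 
      by (rule inj_on_inverseI[where g = "to_nat_on J"]) (use idx(2) in \<open>auto simp: I_def\<close>)
    have sub: "from_nat_into J ` I \<subseteq> J" using idx(1) by (auto simp: I_def)
    have "(\<Sum>n<N. ennreal (diameter (C n))) = (\<Sum>n\<in>I. ennreal (diameter (C n)))"
      by (rule sum.mono_neutral_right) (auto simp: I_def C_def)
    also have "\<dots> \<le> (\<Sum>n\<in>I. ennreal (10 * c * r (from_nat_into J n)))"
      by (rule sum_mono) (use diam idx in \<open>auto simp: I_def C_def intro!: ennreal_leI\<close>)
    also have "\<dots> = (\<Sum>t\<in>from_nat_into J ` I. ennreal (10 * c * r t))"
      by (simp add: sum.reindex[OF inj])
    also have "\<dots> = ennreal (\<Sum>t\<in>from_nat_into J ` I. 10 * c * r t)"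
    proof (rule sum_ennreal)
      fix t assume "t \<in> from_nat_into J ` I"
      then have "r t > 0" using sub J(2) r(1) by blast
      then show "0 \<le> 10 * c * r t" using \<open>c \<ge> 0\<close> by simp
    qed
    also have "(\<Sum>t\<in>from_nat_into J ` I. 10 * c * r t) = 5 * c * (\<Sum>t\<in>from_nat_into J ` I. measure lebesgue (cball t (r t)))"
    proof -
      have "measure lebesgue (cball t (r t)) = 2 * r t" if "t \<in> from_nat_into J ` I" for t
      proof -
        have "r t > 0" using that sub J(2) r(1) by blast
        then show ?thesis by (simp add: cball_eq_atLeastAtMost)
      qed
      then show ?thesis unfolding sum_distrib_left by (intro sum.cong) simp_all
    qed
    also have "(\<Sum>t\<in>from_nat_into J ` I. measure lebesgue (cball t (r t))) = measure lebesgue (\<Union>t\<in>from_nat_into J ` I. cball t (r t))"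
    proof (rule measure_finite_Union[symmetric])
      show "disjoint_family_on (\<lambda>t. cball t (r t)) (from_nat_into J ` I)"
        using J(3) sub unfolding disjoint_family_on_def pairwise_def disjnt_def by blast
      show "emeasure lebesgue (cball t (r t)) \<noteq> \<infinity>" for t
        using fmeasurableD2[OF lmeasurable_cball] by simp
    qed (use fin in auto)
    also have "5 * c * \<dots> \<le> 5 * c * m"
    proof (rule mult_left_mono)
      have "measure lebesgue (\<Union>t\<in>from_nat_into J ` I. cball t (r t)) \<le> measure lebesgue U"
      proof (rule measure_mono_fmeasurable)
        show "(\<Union>t\<in>from_nat_into J ` I. cball t (r t)) \<subseteq> U" using sub J(2) r(2) by blast
        show "(\<Union>t\<in>from_nat_into J ` I. cball t (r t)) \<in> sets lebesgue" using fin by auto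
      qed (rule U(1))
      then show "measure lebesgue (\<Union>t\<in>from_nat_into J ` I. cball t (r t)) \<le> m" using U(2) by linarith
    qed (use \<open>c \<ge> 0\<close> in simp)
    finally show "(\<Sum>n<N. ennreal (diameter (C n))) \<le> ennreal (5 * c * m)" by (simp add: ennreal_leI)
  qed
  ultimately show ?thesis using diamC by blast
qed

lemma length_null_lipschitz_image_negligible:
  assumes \<gamma>: "C-lipschitz_on UNIV (\<gamma> :: real \<Rightarrow> 'a::metric_space)" and N: "negligible N"
  shows "length_null (\<gamma> ` N)"
  unfolding length_null_def
proof (intro allI impI)
  fix \<delta> \<epsilon> :: real assume "\<delta> > 0" "\<epsilon> > 0"
  have C: "C \<ge> 0" using \<gamma> by (rule lipschitz_on_nonneg)
  define m where "m = \<epsilon> / (5 * (C + 1))"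
  have "m > 0" using C \<open>\<epsilon> > 0\<close> by (simp add: m_def)
  have "N \<in> sets lebesgue" using N by (simp add: negligible_imp_sets)
  then obtain U where U: "open U" "N \<subseteq> U" "U - N \<in> lmeasurable" "emeasure lebesgue (U - N) < ennreal m"
    using \<open>m > 0\<close> by (rule sets_lebesgue_outer_open)
  have "N \<in> lmeasurable" "measure lebesgue N = 0" using N negligible_iff_measure by blast+
  then have Um: "U \<in> lmeasurable" using U(2,3) by (metis Diff_partition fmeasurable.Un)
  have "measure lebesgue U \<le> measure lebesgue (U - N) + measure lebesgue N"
    using measure_Un_le[of "U - N" lebesgue N] U \<open>N \<in> sets lebesgue\<close> by (auto simp: Un_absorb2)
  moreover have "measure lebesgue (U - N) \<le> m"
    using U(3,4) \<open>m > 0\<close> by (simp add: emeasure_eq_measure2 ennreal_less_iff less_imp_le)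
  ultimately have Um': "measure lebesgue U \<le> m" using \<open>measure lebesgue N = 0\<close> by simp
  have local: "\<exists>r. 0 < r \<and> r \<le> \<rho> \<and> cball t r \<subseteq> U \<and> (\<forall>t'\<in>cball t (5 * r). dist (\<gamma> t') (\<gamma> t) \<le> C * (5 * r))"
    if t: "t \<in> N" and "\<rho> > 0" for t \<rho>
  proof -
    obtain e where e: "e > 0" "cball t e \<subseteq> U" using U(1,2) t open_contains_cball by blast
    have "dist (\<gamma> t') (\<gamma> t) \<le> C * (5 * min e \<rho>)" if "t' \<in> cball t (5 * min e \<rho>)" for t'
    proof -
      have "dist (\<gamma> t') (\<gamma> t) \<le> C * dist t' t" using \<gamma> by (auto dest: lipschitz_onD)
      also have "\<dots> \<le> C * (5 * min e \<rho>)" using that C by (intro mult_left_mono) (auto simp: dist_commute)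
      finally show ?thesis .
    qed
    moreover have "cball t (min e \<rho>) \<subseteq> U" using e(2) by auto
    ultimately show ?thesis using e(1) \<open>\<rho> > 0\<close> by (intro exI[of _ "min e \<rho>"]) auto
  qed
  have "5 * C * m \<le> \<epsilon>" using C \<open>\<epsilon> > 0\<close> by (simp add: m_def field_simps)
  then show "\<exists>C. \<gamma> ` N \<subseteq> (\<Union>n. C n) \<and> (\<forall>n. bounded (C n) \<and> diameter (C n) \<le> \<delta>) \<and>
      (\<Sum>n. ennreal (diameter (C n))) \<le> ennreal \<epsilon>"
    using Vitali_image_cover[OF Um Um' C \<open>\<delta> > 0\<close> local] by (meson ennreal_leI order.trans)
qed

lemma length_null_critical_image:
  fixes \<gamma> :: "real \<Rightarrow> 'a::metric_space"
  assumes crit: "\<And>t e. t \<in> Z \<Longrightarrow> e > 0 \<Longrightarrow> \<exists>\<delta>>0. \<forall>t'. \<bar>t' - t\<bar> < \<delta> \<longrightarrow> dist (\<gamma> t') (\<gamma> t) \<le> e * \<bar>t' - t\<bar>"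
  shows "length_null (\<gamma> ` Z)"
proof -
  have "length_null (\<gamma> ` (Z \<inter> {- real R..real R}))" for R
    unfolding length_null_def
  proof (intro allI impI)
    fix \<delta> \<epsilon> :: real assume "\<delta> > 0" "\<epsilon> > 0"
    define m where "m = 2 * real R + 2"
    define c where "c = \<epsilon> / (5 * m)"
    have "m > 0" by (simp add: m_def)
    then have c: "c > 0" "5 * c * m = \<epsilon>" using \<open>\<epsilon> > 0\<close> by (auto simp: c_def)
    have local: "\<exists>r. 0 < r \<and> r \<le> \<rho> \<and> cball t r \<subseteq> {- real R - 1..real R + 1} \<and>
        (\<forall>t'\<in>cball t (5 * r). dist (\<gamma> t') (\<gamma> t) \<le> c * (5 * r))"
      if t: "t \<in> Z \<inter> {- real R..real R}" and "\<rho> > 0" for t \<rho>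
    proof -
      obtain d where d: "d > 0" "\<And>t'. \<bar>t' - t\<bar> < d \<Longrightarrow> dist (\<gamma> t') (\<gamma> t) \<le> c * \<bar>t' - t\<bar>"
        using crit[of t c] t c(1) by blast
      define r where "r = Min {\<rho>, 1, d / 6}"
      have r: "r > 0" "r \<le> \<rho>" "r \<le> 1" "5 * r < d" 
      proof -
        show "r > 0" using \<open>\<rho> > 0\<close> d(1) by (simp add: r_def)
        show "r \<le> \<rho>" "r \<le> 1" unfolding r_def by (rule Min_le; simp)+
        have "r \<le> d / 6" unfolding r_def by (rule Min_le; simp)
        then show "5 * r < d" using d(1) by linarith
      qed
      have "dist (\<gamma> t') (\<gamma> t) \<le> c * (5 * r)" if "t' \<in> cball t (5 * r)" for t'
      proof -
        have t': "\<bar>t' - t\<bar> \<le> 5 * r" using that by (simp add: dist_real_def abs_minus_commute)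
        then have "dist (\<gamma> t') (\<gamma> t) \<le> c * \<bar>t' - t\<bar>" using r(4) by (intro d(2)) linarith
        also have "\<dots> \<le> c * (5 * r)" using t' c(1) by (intro mult_left_mono) auto
        finally show ?thesis .
      qed
      moreover have "cball t r \<subseteq> {- real R - 1..real R + 1}"
        using t r(3) by (auto simp: cball_eq_atLeastAtMost)
      ultimately show ?thesis using r(1,2) by blast
    qed
    have "{- real R - 1..real R + 1} \<in> lmeasurable" "measure lebesgue {- real R - 1..real R + 1} \<le> m"
      by (auto simp: m_def)
    from Vitali_image_cover[OF this less_imp_le[OF c(1)] \<open>\<delta> > 0\<close> local, unfolded c(2)]
    show "\<exists>C. \<gamma> ` (Z \<inter> {- real R..real R}) \<subseteq> (\<Union>n. C n) \<and> (\<forall>n. bounded (C n) \<and> diameter (C n) \<le> \<delta>) \<and>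
      (\<Sum>n. ennreal (diameter (C n))) \<le> ennreal \<epsilon>" .
  qed
  then have "length_null (\<Union>R. \<gamma> ` (Z \<inter> {- real R..real R}))" by (rule length_null_UN)
  moreover have "\<gamma> ` Z \<subseteq> (\<Union>R. \<gamma> ` (Z \<inter> {- real R..real R}))"
  proof
    fix z assume "z \<in> \<gamma> ` Z"
    then obtain t where t: "t \<in> Z" "z = \<gamma> t" by blast
    obtain R where "\<bar>t\<bar> \<le> real R" using real_arch_simple by blast
    then have "z \<in> \<gamma> ` (Z \<inter> {- real R..real R})" using t by (intro image_eqI[of _ _ t]) auto
    then show "z \<in> (\<Union>R. \<gamma> ` (Z \<inter> {- real R..real R}))" by blast
  qed
  ultimately show ?thesis by (rule length_null_subset)
qed


section \<open>Parameters of steep points\<close>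

definition regular_cost :: "(real \<times> real \<times> real \<Rightarrow> real) \<Rightarrow> bool" where
  "regular_cost F \<longleftrightarrow> F \<in> borel_measurable borel \<and> locally_bounded_above F \<and>
     (\<forall>K\<ge>0. \<exists>C\<ge>0. \<forall>x y p. F (x, y, p) \<ge> K * \<bar>p\<bar> - C)"

lemma locally_bounded_above_compose:
  assumes F: "locally_bounded_above F" and h: "continuous_on UNIV h"
  shows "locally_bounded_above (\<lambda>z. F (h z))"
  unfolding locally_bounded_above_def
proof
  fix z
  obtain U where U: "open U" "h z \<in> U" "bdd_above (F ` U)"
    using spec[OF F[unfolded locally_bounded_above_def], of "h z"] by blast
  have "open (h -` U)" using U(1) h by (simp add: continuous_on_open_vimage)
  moreover have "bdd_above ((\<lambda>z. F (h z)) ` (h -` U))"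
    using U(3) by (rule bdd_above_mono) auto
  ultimately show "\<exists>U. open U \<and> z \<in> U \<and> bdd_above ((\<lambda>z. F (h z)) ` U)" using U(2) by blast
qed

lemma regular_cost_reflect:
  assumes "regular_cost F"
  shows "regular_cost (reflect_value F)" "regular_cost (reflect_time F)"
proof -
  have v: "reflect_value F = (\<lambda>z. F (fst z, - fst (snd z), - snd (snd z)))"
    and t: "reflect_time F = (\<lambda>z. F (- fst z, fst (snd z), - snd (snd z)))"
    by (auto simp: reflect_value_def reflect_time_def)
  have lba: "locally_bounded_above F" using assms by (simp add: regular_cost_def)
  have "locally_bounded_above (reflect_value F)"
    unfolding v by (rule locally_bounded_above_compose[OF lba]) (intro continuous_intros)
  moreover have "locally_bounded_above (reflect_time F)"
    unfolding t by (rule locally_bounded_above_compose[OF lba]) (intro continuous_intros)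
  moreover have "\<exists>C\<ge>0. \<forall>x y p. reflect_value F (x, y, p) \<ge> K * \<bar>p\<bar> - C"
    "\<exists>C\<ge>0. \<forall>x y p. reflect_time F (x, y, p) \<ge> K * \<bar>p\<bar> - C" if K: "K \<ge> 0" for K
  proof -
    have "\<forall>K\<ge>0. \<exists>C\<ge>0. \<forall>x y p. F (x, y, p) \<ge> K * \<bar>p\<bar> - C"
      using assms by (simp add: regular_cost_def)
    with K obtain C where C: "C \<ge> 0" "\<And>x y p. F (x, y, p) \<ge> K * \<bar>p\<bar> - C" by blast
    have "reflect_value F (x, y, p) \<ge> K * \<bar>p\<bar> - C" "reflect_time F (x, y, p) \<ge> K * \<bar>p\<bar> - C" for x y p
      using C(2)[of "- p" x "- y"] C(2)[of "- p" "- x" y] by (simp_all add: reflect_value_def reflect_time_def)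
    with \<open>C \<ge> 0\<close> show "\<exists>C\<ge>0. \<forall>x y p. reflect_value F (x, y, p) \<ge> K * \<bar>p\<bar> - C"
    "\<exists>C\<ge>0. \<forall>x y p. reflect_time F (x, y, p) \<ge> K * \<bar>p\<bar> - C" by blast+
  qed
  ultimately show "regular_cost (reflect_value F)" "regular_cost (reflect_time F)"
    using assms reflect_measurable[of F] by (auto simp: regular_cost_def)
qed

lemma lagrangian_regular_cost:
  assumes L: "lagrangian L"
  obtains c where "c \<ge> 0" "\<And>z. L z \<ge> - c" "regular_cost (\<lambda>z. L z + c)"
proof -
  have meas: "L \<in> borel_measurable borel" and lba: "locally_bounded_above L"
    using L by (auto simp: lagrangian_def)
  obtain m where m: "\<And>z. L z \<ge> m" using L unfolding lagrangian_def bdd_below_def by auto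
  define c where "c = \<bar>m\<bar>"
  have c: "c \<ge> 0" "L z \<ge> - c" for z using m[of z] by (auto simp: c_def)
  obtain \<omega> where \<omega>: "superlinear \<omega>" "\<And>x y p. L (x, y, p) \<ge> \<omega> p"
    using L by (auto simp: lagrangian_def)
  have "locally_bounded_above (\<lambda>z. L z + c)"
    unfolding locally_bounded_above_def
  proof
    fix z
    obtain U where U: "open U" "z \<in> U" "bdd_above (L ` U)"
      using spec[OF lba[unfolded locally_bounded_above_def], of z] by blast
    then obtain B where "\<And>w. w \<in> U \<Longrightarrow> L w \<le> B" unfolding bdd_above_def by blast
    then have "bdd_above ((\<lambda>z. L z + c) ` U)" by (auto intro!: bdd_aboveI[where M = "B + c"])
    with U show "\<exists>U. open U \<and> z \<in> U \<and> bdd_above ((\<lambda>z. L z + c) ` U)" by blast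
  qed
  moreover have "\<exists>C\<ge>0. \<forall>x y p. L (x, y, p) + c \<ge> K * \<bar>p\<bar> - C" if "K \<ge> 0" for K
  proof -
    have "\<forall>\<^sub>F p in at_infinity. K \<le> \<omega> p / \<bar>p\<bar>"
      using \<omega>(1) unfolding superlinear_def filterlim_at_top by blast
    then obtain R where R: "\<And>p. norm p \<ge> R \<Longrightarrow> K \<le> \<omega> p / \<bar>p\<bar>"
      unfolding eventually_at_infinity by blast
    have "L (x, y, p) + c \<ge> K * \<bar>p\<bar> - K * max R 1" for x y p
    proof (cases "\<bar>p\<bar> \<ge> max R 1")
      case True
      then have "\<bar>p\<bar> > 0" "K \<le> \<omega> p / \<bar>p\<bar>" using R[of p] by auto
      then have "K * \<bar>p\<bar> \<le> \<omega> p" by (simp only: pos_le_divide_eq)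
      moreover have "0 \<le> K * max R 1" using that by simp
      ultimately show ?thesis using \<omega>(2)[of p x y] c(1) by linarith
    next
      case False
      then have "K * \<bar>p\<bar> \<le> K * max R 1" using that by (intro mult_left_mono) auto
      then show ?thesis using c(2)[of "(x, y, p)"] by linarith
    qed
    moreover have "K * max R 1 \<ge> 0" using that by simp
    ultimately show ?thesis by blast
  qed
  ultimately have "regular_cost (\<lambda>z. L z + c)"
    unfolding regular_cost_def using meas by (intro conjI allI impI borel_measurable_add) auto
  with c show ?thesis using that by blast
qed

lemma negligible_by_sources:
  assumes F: "regular_cost F" and steep: "\<And>t. t \<in> T \<Longrightarrow> steep_from_left F (X t) (Y t)"
    and sources: "\<And>q s. negligible {t\<in>T. q < X t \<and> s < Y t \<and> descends F q s (X t) (Y t)}"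
  shows "negligible (T :: real set)"
proof -
  let ?P = "\<lambda>q s. {t\<in>T. q < X t \<and> s < Y t \<and> descends F q s (X t) (Y t)}"
  let ?\<P> = "(\<lambda>(q, s). ?P q s) ` (\<rat> \<times> \<rat>)"
  have "countable ?\<P>" by (intro countable_image countable_SIGMA countable_rat)
  then have "negligible (\<Union>?\<P>)" by (rule negligible_countable_Union) (use sources in auto)
  moreover have "T \<subseteq> \<Union>?\<P>"
  proof
    fix t assume t: "t \<in> T"
    have F': "F \<in> borel_measurable borel" "locally_bounded_above F" using F by (auto simp: regular_cost_def)
    obtain q s where qs: "q \<in> \<rat>" "s \<in> \<rat>" "q < X t" "s < Y t" "descends F q s (X t) (Y t)"
      using steep_from_left_descends[OF F' steep[OF t]] by metis
    then have "t \<in> ?P q s" using t by blast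
    with qs(1,2) show "t \<in> \<Union>?\<P>" by blast
  qed
  ultimately show ?thesis by (rule negligible_subset)
qed

lemma negligible_moving_forward:
  assumes F: "regular_cost F" and steep: "\<And>t. t \<in> T \<Longrightarrow> steep_from_left F (X t) (Y t)"
    and lip: "\<And>t t'. \<bar>X t' - X t\<bar> \<le> C * \<bar>t' - t\<bar>" "\<And>t t'. \<bar>Y t' - Y t\<bar> \<le> C * \<bar>t' - t\<bar>"
    and fwd: "\<And>t. t \<in> T \<Longrightarrow> \<exists>c>0. \<exists>r>0. \<forall>t'. t < t' \<and> t' < t + r \<longrightarrow> c * (t' - t) \<le> X t' - X t"
  shows "negligible T"
proof (rule negligible_by_sources[OF F steep])
  fix q s
  have F': "F \<in> borel_measurable borel" "locally_bounded_above F"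
    "\<And>K. K \<ge> 0 \<Longrightarrow> \<exists>C\<ge>0. \<forall>x y p. F (x, y, p) \<ge> K * \<bar>p\<bar> - C" using F by (auto simp: regular_cost_def)
  have C: "C \<ge> 0" using lip(1)[of 1 0] by simp
  let ?T = "{t\<in>T. q < X t \<and> s < Y t \<and> descends F q s (X t) (Y t)}"
  show "negligible ?T"
  proof (rule steep_decrease_negligible[where f = "\<lambda>t. arrival_cost F q s (X t) (Y t)"])
    show "arrival_cost F q s (X t) (Y t) < \<infinity>" if "t \<in> ?T" for t
      using that by (intro arrival_cost_finite F') auto
    fix K :: real and t assume "K > 0" and t: "t \<in> ?T"
    obtain c r where cr: "c > 0" "r > 0" "\<And>t'. t < t' \<Longrightarrow> t' < t + r \<Longrightarrow> c * (t' - t) \<le> X t' - X t"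
      using fwd[of t] t by blast
    have "\<exists>\<rho>>0. \<forall>x' y'. X t < x' \<and> x' < X t + \<rho> \<and> \<bar>y' - Y t\<bar> \<le> (C / c) * (x' - X t) \<longrightarrow>
      arrival_cost F q s x' y' + ennreal ((K / c) * (x' - X t)) \<le> arrival_cost F q s (X t) (Y t)"
      using t C cr(1) \<open>K > 0\<close> by (intro gain_forward F') auto
    then obtain \<rho> where \<rho>: "\<rho> > 0" "\<And>x' y'. X t < x' \<Longrightarrow> x' < X t + \<rho> \<Longrightarrow> \<bar>y' - Y t\<bar> \<le> (C / c) * (x' - X t) \<Longrightarrow>
      arrival_cost F q s x' y' + ennreal ((K / c) * (x' - X t)) \<le> arrival_cost F q s (X t) (Y t)"
      by blast
    show "\<exists>r>0. \<forall>t'\<in>?T. t < t' \<and> t' < t + r \<longrightarrow>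
      arrival_cost F q s (X t') (Y t') + ennreal (K * (t' - t)) \<le> arrival_cost F q s (X t) (Y t)"
    proof (rule exI[of _ "min r (\<rho> / (C + 1))"], intro conjI ballI impI)
      show "min r (\<rho> / (C + 1)) > 0" using cr \<rho>(1) C by simp
      fix t' assume "t' \<in> ?T" and t': "t < t' \<and> t' < t + min r (\<rho> / (C + 1))"
      have X: "c * (t' - t) \<le> X t' - X t" using t' by (intro cr(3)) auto
      have pos: "0 < t' - t" using t' by simp
      have "X t < X t'" using X mult_pos_pos[OF cr(1) pos] by linarith
      moreover have "X t' < X t + \<rho>"
      proof -
        have "min r (\<rho> / (C + 1)) \<le> \<rho> / (C + 1)" by (rule min.cobounded2)
        then have "t' - t < \<rho> / (C + 1)" using t' by linarith
        then have "(C + 1) * (t' - t) < \<rho>" using C by (simp add: less_divide_eq mult.commute)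
        moreover have "X t' - X t \<le> C * (t' - t)" using lip(1)[of t' t] pos by simp
        ultimately show ?thesis using pos by (simp add: distrib_right)
      qed
      moreover have "\<bar>Y t' - Y t\<bar> \<le> (C / c) * (X t' - X t)"
      proof -
        have "\<bar>Y t' - Y t\<bar> \<le> C * (t' - t)" using lip(2)[of t' t] pos by simp
        also have "\<dots> = (C / c) * (c * (t' - t))" using cr(1) by simp
        also have "\<dots> \<le> (C / c) * (X t' - X t)" using X C cr(1) by (intro mult_left_mono) auto
        finally show ?thesis .
      qed
      ultimately have "arrival_cost F q s (X t') (Y t') + ennreal ((K / c) * (X t' - X t)) \<le> arrival_cost F q s (X t) (Y t)"
        by (rule \<rho>(2))
      moreover have "K * (t' - t) \<le> (K / c) * (X t' - X t)"
      proof -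
        have "K * (t' - t) = (K / c) * (c * (t' - t))" using cr(1) by simp
        also have "\<dots> \<le> (K / c) * (X t' - X t)" using X \<open>K > 0\<close> cr(1) by (intro mult_left_mono) auto
        finally show ?thesis .
      qed
      ultimately show "arrival_cost F q s (X t') (Y t') + ennreal (K * (t' - t)) \<le> arrival_cost F q s (X t) (Y t)"
        by (meson add_left_mono ennreal_leI order.trans)
    qed
  qed
qed

text \<open>The parameters at which the curve is vertical with a prescribed rate \<open>r\<close>: closer than \<open>r k\<close> it
deviates in time by at most the fraction \<open>1 / (4 * k + 4)\<close> of the change in height, as
\<open>gain_downward\<close> requires.\<close>

definition vertical_at_scales :: "(nat \<Rightarrow> real) \<Rightarrow> (real \<Rightarrow> real) \<Rightarrow> (real \<Rightarrow> real) \<Rightarrow> real set" where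
  "vertical_at_scales r X Y = {t. \<forall>k t'. \<bar>t' - t\<bar> < r k \<longrightarrow> (4 * real k + 4) * \<bar>X t' - X t\<bar> \<le> \<bar>Y t' - Y t\<bar>}"

text \<open>Given \<open>t' > t\<close> close to \<open>t\<close>, the index for \<open>gain_downward\<close> is the \<open>k\<close> with
\<open>r (Suc k) \<le> t' - t < r k\<close>; it is large because \<open>t'\<close> is close to \<open>t\<close>.  Then \<open>G k * (Y t - Y t')\<close> is at
least \<open>c * k\<close> by the choice of \<open>G\<close>, hence eventually exceeds the constant in that lemma.\<close>

lemma negligible_moving_down:
  assumes F: "regular_cost F" and steep: "\<And>t. t \<in> T \<Longrightarrow> steep_from_left F (X t) (Y t)"
    and lip: "\<And>t t'. \<bar>Y t' - Y t\<bar> \<le> C * \<bar>t' - t\<bar>"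
    and G: "\<And>k. G k \<ge> 0" "\<And>k x y p. F (x, y, p) \<ge> G k * \<bar>p\<bar> - real k * G k"
    and r: "\<And>k. r k > 0" "r \<longlonglongrightarrow> 0" "\<And>k. real k \<le> G k * r (Suc k)"
    and vert: "T \<subseteq> vertical_at_scales r X Y"
    and down: "\<And>t. t \<in> T \<Longrightarrow> \<exists>c>0. \<exists>\<delta>>0. \<forall>t'. t < t' \<and> t' < t + \<delta> \<longrightarrow> c * (t' - t) \<le> Y t - Y t'"
  shows "negligible T"
proof (rule negligible_by_sources[OF F steep])
  fix q s
  have F': "F \<in> borel_measurable borel" "locally_bounded_above F"
    "\<And>K. K \<ge> 0 \<Longrightarrow> \<exists>C\<ge>0. \<forall>x y p. F (x, y, p) \<ge> K * \<bar>p\<bar> - C" using F by (auto simp: regular_cost_def)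
  have C: "C \<ge> 0" using lip[of 1 0] by simp
  let ?T = "{t\<in>T. q < X t \<and> s < Y t \<and> descends F q s (X t) (Y t)}"
  let ?f = "arrival_cost F q s"
  show "negligible ?T"
  proof (rule steep_decrease_negligible[where f = "\<lambda>t. ?f (X t) (Y t)"])
    show fin: "?f (X t) (Y t) < \<infinity>" if "t \<in> ?T" for t
      using that by (intro arrival_cost_finite F') auto
    fix K :: real and t assume "K > 0" and t: "t \<in> ?T"
    obtain c \<delta> where c: "c > 0" "\<delta> > 0" "\<And>t'. t < t' \<Longrightarrow> t' < t + \<delta> \<Longrightarrow> c * (t' - t) \<le> Y t - Y t'"
      using down[of t] t by blast
    define M where "M = enn2real (?f (X t) (Y t))"
    have M: "?f (X t) (Y t) \<le> ennreal M" "M \<ge> 0" using fin[OF t] by (simp_all add: M_def less_top)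
    have "\<exists>\<rho>>0. \<forall>x' y' k. Y t - \<rho> < y' \<and> y' < Y t \<and> \<bar>x' - X t\<bar> \<le> (Y t - y') / (4 * real k + 4) \<and>
        4 * (M + 2) \<le> G k * (Y t - y') \<longrightarrow>
        ?f x' y' + ennreal ((K / c) * (Y t - y')) \<le> ?f (X t) (Y t)"
      using t c(1) \<open>K > 0\<close> M by (intro gain_downward[where G = G and M = M] F' G) auto
    then obtain \<rho> where \<rho>: "\<rho> > 0" "\<And>x' y' k. Y t - \<rho> < y' \<Longrightarrow> y' < Y t \<Longrightarrow>
        \<bar>x' - X t\<bar> \<le> (Y t - y') / (4 * real k + 4) \<Longrightarrow> 4 * (M + 2) \<le> G k * (Y t - y') \<Longrightarrow>
        ?f x' y' + ennreal ((K / c) * (Y t - y')) \<le> ?f (X t) (Y t)"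
      by blast
    obtain k0 where k0: "4 * (M + 2) / c \<le> real k0" using real_arch_simple by blast
    \<comment> \<open>Closer than all of \<open>r 0, \<dots>, r k0\<close>, so that the index of the scale of \<open>t' - t\<close> is at least \<open>k0\<close>.\<close>
    define e where "e = Min {\<delta>, \<rho> / (C + 1), Min (r ` {..k0})}"
    have e: "e > 0" "e \<le> \<delta>" "e \<le> \<rho> / (C + 1)" "\<And>k. k \<le> k0 \<Longrightarrow> e \<le> r k"
    proof -
      have "Min (r ` {..k0}) > 0" using r(1) by (subst Min_gr_iff) auto
      then show "e > 0" using c(2) \<rho>(1) C by (simp add: e_def)
      show "e \<le> \<delta>" "e \<le> \<rho> / (C + 1)" unfolding e_def by (rule Min_le; simp)+
      fix k assume "k \<le> k0"
      have "e \<le> Min (r ` {..k0})" unfolding e_def by (rule Min_le; simp)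
      also have "\<dots> \<le> r k" using \<open>k \<le> k0\<close> by (intro Min_le) auto
      finally show "e \<le> r k" .
    qed
    show "\<exists>e>0. \<forall>t'\<in>?T. t < t' \<and> t' < t + e \<longrightarrow> ?f (X t') (Y t') + ennreal (K * (t' - t)) \<le> ?f (X t) (Y t)"
    proof (rule exI[of _ e], intro conjI ballI impI)
      show "e > 0" by (rule e)
      fix t' assume "t' \<in> ?T" and t': "t < t' \<and> t' < t + e"
      have pos: "t' - t > 0" using t' by simp
      have "\<exists>n. r n \<le> t' - t"
      proof -
        have "\<forall>\<^sub>F n in sequentially. r n < t' - t" using r(2) pos by (intro order_tendstoD) auto
        then show ?thesis unfolding eventually_sequentially by (meson less_imp_le order.refl)
      qed
      then obtain n where n: "r n \<le> t' - t" "\<And>m. m < n \<Longrightarrow> \<not> r m \<le> t' - t"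
        using exists_least_iff[of "\<lambda>n. r n \<le> t' - t"] by blast
      have "k0 < n"
      proof (rule ccontr)
        assume "\<not> k0 < n"
        then have "e \<le> r n" by (intro e(4)) simp
        then show False using n(1) t' by linarith
      qed
      then obtain k where k: "n = Suc k" "k0 \<le> k" by (cases n) auto
      have rk: "r (Suc k) \<le> t' - t" "t' - t < r k" using n(1) n(2)[of k] k by auto
      have Y: "c * (t' - t) \<le> Y t - Y t'" using t' e(2) by (intro c(3)) auto
      have Ypos: "Y t' < Y t" using Y mult_pos_pos[OF c(1) pos] by linarith
      have near: "Y t - \<rho> < Y t'"
      proof -
        have "t' - t < \<rho> / (C + 1)" using t' e(3) by linarith
        then have "(C + 1) * (t' - t) < \<rho>" using C by (simp add: less_divide_eq mult.commute)
        moreover have "Y t - Y t' \<le> C * (t' - t)" using lip[of t' t] pos by simp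
        ultimately show ?thesis using pos by (simp add: distrib_right)
      qed
      have "(4 * real k + 4) * \<bar>X t' - X t\<bar> \<le> \<bar>Y t' - Y t\<bar>"
        using vert t rk(2) pos unfolding vertical_at_scales_def by auto
      then have dx: "\<bar>X t' - X t\<bar> \<le> (Y t - Y t') / (4 * real k + 4)"
        using Ypos by (simp add: le_divide_eq mult.commute)
      have big: "4 * (M + 2) \<le> G k * (Y t - Y t')"
      proof -
        have "4 * (M + 2) \<le> c * real k0" using k0 c(1) by (simp add: divide_le_eq mult.commute)
        also have "\<dots> \<le> c * real k" using k(2) c(1) by simp
        also have "\<dots> \<le> c * (G k * r (Suc k))" using r(3)[of k] c(1) by (intro mult_left_mono) auto
        also have "\<dots> \<le> c * (G k * (t' - t))" using rk(1) G(1)[of k] c(1) by (intro mult_left_mono) auto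
        also have "\<dots> = G k * (c * (t' - t))" by simp
        also have "\<dots> \<le> G k * (Y t - Y t')" using Y G(1)[of k] by (rule mult_left_mono)
        finally show ?thesis .
      qed
      have "?f (X t') (Y t') + ennreal ((K / c) * (Y t - Y t')) \<le> ?f (X t) (Y t)"
        by (rule \<rho>(2)[OF near Ypos dx big])
      moreover have "K * (t' - t) \<le> (K / c) * (Y t - Y t')"
      proof -
        have "K * (t' - t) = (K / c) * (c * (t' - t))" using c(1) by simp
        also have "\<dots> \<le> (K / c) * (Y t - Y t')" using Y \<open>K > 0\<close> c(1) by (intro mult_left_mono) auto
        finally show ?thesis .
      qed
      ultimately show "?f (X t') (Y t') + ennreal (K * (t' - t)) \<le> ?f (X t) (Y t)"
        by (meson add_left_mono ennreal_leI order.trans)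
    qed
  qed
qed

lemma derivative_pos_increase:
  assumes "(f has_real_derivative l) (at t)" "l > 0"
  shows "\<exists>c>0. \<exists>r>0. \<forall>t'. t < t' \<and> t' < t + r \<longrightarrow> c * (t' - t) \<le> f t' - f t"
proof -
  have "(\<lambda>h. (f (t + h) - f t) / h) \<midarrow>0\<rightarrow> l" using assms(1) by (simp add: DERIV_def)
  then obtain r where r: "r > 0" "\<And>h. h \<noteq> 0 \<Longrightarrow> norm h < r \<Longrightarrow> norm ((f (t + h) - f t) / h - l) < l / 2"
    using assms(2) unfolding LIM_eq by (metis diff_zero half_gt_zero)
  have "l / 2 * (t' - t) \<le> f t' - f t" if "t < t'" "t' < t + r" for t'
  proof -
    have "\<bar>(f t' - f t) / (t' - t) - l\<bar> < l / 2" using r(2)[of "t' - t"] that by simp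
    then have "l / 2 \<le> (f t' - f t) / (t' - t)" unfolding abs_less_iff by linarith
    then show ?thesis using that by (simp add: pos_le_divide_eq)
  qed
  with r(1) assms(2) show ?thesis by (intro exI[of _ "l / 2"]) auto
qed

lemma negligible_uminus_image: "negligible (uminus ` (S :: real set)) \<Longrightarrow> negligible S"
proof -
  assume "negligible (uminus ` S)"
  then have "negligible (uminus ` uminus ` S)"
    by (rule negligible_differentiable_image_negligible[rotated]) (auto intro!: derivative_intros)
  then show ?thesis by (simp add: image_image)
qed

text \<open>The sign of the derivative decides whether the parameter is to be increased or decreased.\<close>

lemma negligible_steep_points:
  assumes F: "regular_cost F" and steep: "\<And>t. t \<in> T \<Longrightarrow> steep_from_left F (X t) (Y t)"
    and lip: "\<And>t t'. \<bar>X t' - X t\<bar> \<le> C * \<bar>t' - t\<bar>" "\<And>t t'. \<bar>Y t' - Y t\<bar> \<le> C * \<bar>t' - t\<bar>"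
    and G: "\<And>k. G k \<ge> 0" "\<And>k x y p. F (x, y, p) \<ge> G k * \<bar>p\<bar> - real k * G k"
    and r: "\<And>k. r k > 0" "r \<longlonglongrightarrow> 0" "\<And>k. real k \<le> G k * r (Suc k)"
    and der: "\<And>t. t \<in> T \<Longrightarrow> \<exists>l\<noteq>0. (X has_real_derivative l) (at t) \<or>
      (Y has_real_derivative l) (at t) \<and> t \<in> vertical_at_scales r X Y"
  shows "negligible T"
proof -
  define X' where "X' t = X (- t)" for t
  define Y' where "Y' t = Y (- t)" for t
  define TX where "TX \<sigma> = {t\<in>T. \<exists>l>0. (X has_real_derivative \<sigma> * l) (at t)}" for \<sigma> :: real
  define TY where "TY \<sigma> = {t\<in>T. t \<in> vertical_at_scales r X Y \<and> (\<exists>l>0. (Y has_real_derivative \<sigma> * l) (at t))}" for \<sigma> :: real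
  have lip': "\<bar>X' t' - X' t\<bar> \<le> C * \<bar>t' - t\<bar>" "\<bar>Y' t' - Y' t\<bar> \<le> C * \<bar>t' - t\<bar>" for t t'
    using lip(1)[of "- t'" "- t"] lip(2)[of "- t'" "- t"] by (simp_all add: X'_def Y'_def abs_minus_commute)
  have "negligible (TX 1)"
    by (rule negligible_moving_forward[OF F _ lip])
      (auto simp: TX_def intro: steep derivative_pos_increase)
  moreover have "negligible (TX (-1))"
  proof (rule negligible_uminus_image, rule negligible_moving_forward[OF F _ lip'])
    fix t assume "t \<in> uminus ` TX (- 1)"
    then have t: "- t \<in> TX (- 1)" by auto
    then show "steep_from_left F (X' t) (Y' t)" by (auto simp: X'_def Y'_def TX_def intro: steep)
    obtain l where "l > 0" "(X has_real_derivative - l) (at (- t))" using t by (auto simp: TX_def)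
    then have "(X' has_real_derivative l) (at t)"
      using DERIV_mirror[of X "- l" t] unfolding X'_def by simp
    then show "\<exists>c>0. \<exists>r>0. \<forall>t'. t < t' \<and> t' < t + r \<longrightarrow> c * (t' - t) \<le> X' t' - X' t"
      using \<open>l > 0\<close> by (rule derivative_pos_increase)
  qed
  moreover have "negligible (TY (-1))"
  proof (rule negligible_moving_down[OF F _ lip(2) G r])
    fix t assume t: "t \<in> TY (- 1)"
    then show "steep_from_left F (X t) (Y t)" by (auto simp: TY_def intro: steep)
    obtain l where l: "l > 0" "(Y has_real_derivative - l) (at t)" using t by (auto simp: TY_def)
    then have "((\<lambda>t. - Y t) has_real_derivative l) (at t)" by (auto intro!: derivative_eq_intros)
    from derivative_pos_increase[OF this l(1)]
    show "\<exists>c>0. \<exists>\<delta>>0. \<forall>t'. t < t' \<and> t' < t + \<delta> \<longrightarrow> c * (t' - t) \<le> Y t - Y t'" by simp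
  qed (auto simp: TY_def)
  moreover have "negligible (TY 1)"
  proof (rule negligible_uminus_image, rule negligible_moving_down[OF F _ lip'(2) G r])
    have vertical': "- t \<in> vertical_at_scales r X Y \<Longrightarrow> t \<in> vertical_at_scales r X' Y'" for t
      unfolding vertical_at_scales_def X'_def Y'_def mem_Collect_eq
    proof (intro allI impI)
      fix k t' assume *: "\<forall>k t'. \<bar>t' - - t\<bar> < r k \<longrightarrow> (4 * real k + 4) * \<bar>X t' - X (- t)\<bar> \<le> \<bar>Y t' - Y (- t)\<bar>"
        and "\<bar>t' - t\<bar> < r k"
      then have "\<bar>- t' - - t\<bar> < r k" by linarith
      with * show "(4 * real k + 4) * \<bar>X (- t') - X (- t)\<bar> \<le> \<bar>Y (- t') - Y (- t)\<bar>" by blast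
    qed
    then show "uminus ` TY 1 \<subseteq> vertical_at_scales r X' Y'" by (auto simp: TY_def)
    fix t assume "t \<in> uminus ` TY 1"
    then have t: "- t \<in> TY 1" by auto
    then show "steep_from_left F (X' t) (Y' t)" by (auto simp: X'_def Y'_def TY_def intro: steep)
    obtain l where l: "l > 0" "(Y has_real_derivative l) (at (- t))" using t by (auto simp: TY_def)
    then have "(Y' has_real_derivative - l) (at t)"
      using DERIV_mirror[of Y l t] unfolding Y'_def by simp
    then have "((\<lambda>t. - Y' t) has_real_derivative l) (at t)" by (auto intro!: derivative_eq_intros)
    from derivative_pos_increase[OF this l(1)]
    show "\<exists>c>0. \<exists>\<delta>>0. \<forall>t'. t < t' \<and> t' < t + \<delta> \<longrightarrow> c * (t' - t) \<le> Y' t - Y' t'" by simp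
  qed
  ultimately have "negligible (TX 1 \<union> TX (-1) \<union> (TY (-1) \<union> TY 1))" by (intro negligible_Un)
  moreover have "T \<subseteq> TX 1 \<union> TX (-1) \<union> (TY (-1) \<union> TY 1)"
  proof
    fix t assume t: "t \<in> T"
    obtain l where l: "l \<noteq> 0" "(X has_real_derivative l) (at t) \<or>
      (Y has_real_derivative l) (at t) \<and> t \<in> vertical_at_scales r X Y" using der[OF t] by blast
    have "\<exists>\<sigma>\<in>{1, -1}. \<exists>m>0. l = \<sigma> * m"
      using l(1) by (cases "l > 0") (auto intro: exI[of _ "- l"])
    then obtain \<sigma> m where "\<sigma> \<in> {1, -1}" "m > 0" "l = \<sigma> * m" by blast
    then have "t \<in> TX \<sigma> \<or> t \<in> TY \<sigma>" using l t unfolding TX_def TY_def by blast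
    then show "t \<in> TX 1 \<union> TX (-1) \<union> (TY (-1) \<union> TY 1)" using \<open>\<sigma> \<in> {1, -1}\<close> by auto
  qed
  ultimately show ?thesis by (rule negligible_subset)
qed


section \<open>The choice of the growth\<close>

text \<open>For each \<open>n\<close>, the sets where the condition with index \<open>n\<close> holds up to the distance \<open>1 / (m + 1)\<close> are closed
and increase with \<open>m\<close> to a set that contains all vertical parameters; so for a suitable \<open>m n\<close> only a set of
measure less than \<open>\<eta> / 2 ^ (n + 1)\<close> is lost.  The set \<open>E\<close> does not enter, hence \<open>r\<close> may be used to choose the
Lagrangian.\<close>

lemma vertical_scales:
  fixes X Y :: "real \<Rightarrow> real"
  assumes X: "continuous_on UNIV X" and Y: "continuous_on UNIV Y" and "\<eta> > 0"
  obtains r W where "\<And>k. r k > 0" "decseq r" "\<And>k. r k \<le> 1" "r \<longlonglongrightarrow> 0" "W \<in> lmeasurable" "measure lebesgue W \<le> \<eta>"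
    "\<And>t l. t \<in> {- R..R} \<Longrightarrow> (X has_real_derivative 0) (at t) \<Longrightarrow> (Y has_real_derivative l) (at t) \<Longrightarrow> l \<noteq> 0 \<Longrightarrow>
      t \<in> vertical_at_scales r X Y \<union> W"
proof -
  define A where "A n \<rho> = {t. \<forall>s. \<bar>s\<bar> < \<rho> \<longrightarrow> (4 * real n + 4) * \<bar>X (t + s) - X t\<bar> \<le> \<bar>Y (t + s) - Y t\<bar>}" for n \<rho>
  define a where "a n m = A n (inverse (real (Suc m)))" for n m
  have cont: "continuous_on UNIV (\<lambda>t. f (t + s))" if "continuous_on UNIV f" for f :: "real \<Rightarrow> real" and s
    by (rule continuous_on_compose2[OF that]) (auto intro!: continuous_intros)
  have "closed (A n \<rho>)" for n \<rho>
  proof -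
    have "A n \<rho> = (\<Inter>s\<in>{s. \<bar>s\<bar> < \<rho>}. {t. (4 * real n + 4) * \<bar>X (t + s) - X t\<bar> \<le> \<bar>Y (t + s) - Y t\<bar>})"
      by (auto simp: A_def)
    then show ?thesis
      by (auto intro!: closed_INT closed_Collect_le continuous_intros cont X Y)
  qed
  then have a_meas: "a n m \<in> sets borel" for n m by (simp add: a_def borel_closed)
  define B where "B = {- R..R} \<inter> (\<Inter>n. \<Union>m. a n m)"
  have B_meas: "B \<in> sets borel" unfolding B_def using a_meas by auto
  have "\<exists>m. emeasure lborel (B - a n m) < ennreal (\<eta> * (1 / 2) ^ Suc n)" for n
  proof -
    have "decseq (\<lambda>m. B - a n m)"
    proof (rule decseq_SucI)
      fix m
      have "inverse (real (Suc (Suc m))) \<le> inverse (real (Suc m))" by (simp add: field_simps)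
      then have "a n m \<subseteq> a n (Suc m)" unfolding a_def A_def by (smt (verit) mem_Collect_eq subsetI)
      then show "B - a n (Suc m) \<subseteq> B - a n m" by blast
    qed
    moreover have "emeasure lborel (B - a n m) \<noteq> \<infinity>" for m
    proof -
      have "emeasure lborel (B - a n m) \<le> emeasure lborel {- R..R}"
        by (rule emeasure_mono) (auto simp: B_def)
      also have "\<dots> < \<infinity>" by (simp add: emeasure_lborel_Icc_eq)
      finally show ?thesis by simp
    qed
    moreover have "range (\<lambda>m. B - a n m) \<subseteq> sets lborel" using B_meas a_meas by auto
    ultimately have lim: "(\<lambda>m. emeasure lborel (B - a n m)) \<longlonglongrightarrow> emeasure lborel (\<Inter>m. B - a n m)"
      by (intro Lim_emeasure_decseq)
    have "(\<Inter>m. B - a n m) = {}" unfolding B_def by blast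
    from lim[unfolded this] have "(\<lambda>m. emeasure lborel (B - a n m)) \<longlonglongrightarrow> 0" by simp
    moreover have "0 < ennreal (\<eta> * (1 / 2) ^ Suc n)" using \<open>\<eta> > 0\<close> by simp
    ultimately have "\<forall>\<^sub>F m in sequentially. emeasure lborel (B - a n m) < ennreal (\<eta> * (1 / 2) ^ Suc n)"
      by (rule order_tendstoD)
    then show ?thesis unfolding eventually_sequentially by blast
  qed
  then obtain m where m: "\<And>n. emeasure lborel (B - a n (m n)) < ennreal (\<eta> * (1 / 2) ^ Suc n)" by metis
  define W where "W = (\<Union>n. B - a n (m n))"
  have W_meas: "W \<in> sets borel" unfolding W_def using B_meas a_meas by auto
  have W_le: "emeasure lborel W \<le> ennreal \<eta>"
  proof -
    have "emeasure lborel W \<le> (\<Sum>n. emeasure lborel (B - a n (m n)))"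
      unfolding W_def using B_meas a_meas by (intro emeasure_subadditive_countably) auto
    also have "\<dots> \<le> (\<Sum>n. ennreal (\<eta> * (1 / 2) ^ Suc n))"
      by (intro suminf_le less_imp_le[OF m]) auto
    also have "\<dots> = ennreal (\<Sum>n. \<eta> * (1 / 2) ^ Suc n)"
      using \<open>\<eta> > 0\<close> power_half_series by (intro suminf_ennreal2) (auto intro: sums_summable summable_mult)
    also have "(\<Sum>n. \<eta> * (1 / 2) ^ Suc n) = \<eta>"
      using sums_unique[OF sums_mult[OF power_half_series, of \<eta>]] by simp
    finally show ?thesis .
  qed
  \<comment> \<open>The reciprocals of these numbers are decreasing rates below the \<open>1 / (m n + 1)\<close> found above.\<close>
  define d where "d n = real (Suc n + (\<Sum>i\<le>n. m i))" for n
  define r where "r n = inverse (d n)" for n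
  have d: "d n \<ge> real (Suc n)" "d n \<ge> real (Suc (m n))" for n
  proof -
    show "d n \<ge> real (Suc n)" unfolding d_def of_nat_le_iff by simp
    have "m n \<le> (\<Sum>i\<le>n. m i)" by (rule member_le_sum) auto
    then show "d n \<ge> real (Suc (m n))" unfolding d_def of_nat_le_iff by simp
  qed
  have d_pos: "d n > 0" for n using d(1)[of n] by (meson less_le_trans of_nat_0_less_iff zero_less_Suc)
  show ?thesis
  proof (rule that[of r W])
    show "r k > 0" for k using d_pos by (simp add: r_def)
    show "decseq r"
    proof (rule decseq_SucI)
      fix n
      have "d n \<le> d (Suc n)" unfolding d_def of_nat_le_iff by simp
      then show "r (Suc n) \<le> r n" unfolding r_def using d_pos by (intro le_imp_inverse_le) auto
    qed
    have r_le: "r k \<le> inverse (real (Suc k))" for k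
      unfolding r_def using d(1) by (intro le_imp_inverse_le) auto
    moreover have "inverse (real (Suc k)) \<le> 1" for k by (simp add: field_simps)
    ultimately show "r k \<le> 1" for k by (meson order.trans)
    show "r \<longlonglongrightarrow> 0"
    proof (rule tendsto_sandwich[OF _ _ tendsto_const LIMSEQ_inverse_real_of_nat])
      show "\<forall>\<^sub>F n in sequentially. 0 \<le> r n" using d_pos by (simp add: r_def less_imp_le)
      show "\<forall>\<^sub>F n in sequentially. r n \<le> inverse (real (Suc n))" using r_le by (intro always_eventually allI)
    qed
    show "W \<in> lmeasurable" using W_meas W_le by (auto simp: fmeasurable_def intro: order.strict_trans1)
    show "measure lebesgue W \<le> \<eta>"
      using W_meas W_le \<open>\<eta> > 0\<close> by (simp add: measure_def enn2real_leI)
    fix t l assume t: "t \<in> {- R..R}" and der: "(X has_real_derivative 0) (at t)" "(Y has_real_derivative l) (at t)" "l \<noteq> 0"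
    have "\<exists>m. t \<in> a n m" for n
    proof -
      define e where "e = \<bar>l\<bar> / (2 * (4 * real n + 4))"
      have e: "e > 0" "(4 * real n + 4) * e = \<bar>l\<bar> / 2" using \<open>l \<noteq> 0\<close> by (auto simp: e_def field_simps)
      have "(\<lambda>h. (X (t + h) - X t) / h) \<midarrow>0\<rightarrow> 0" using der(1) by (simp add: DERIV_def)
      then obtain s1 where s1: "s1 > 0" "\<And>h. h \<noteq> 0 \<Longrightarrow> norm h < s1 \<Longrightarrow> norm ((X (t + h) - X t) / h) < e"
        using e(1) unfolding LIM_eq by (metis diff_zero)
      have "(\<lambda>h. (Y (t + h) - Y t) / h) \<midarrow>0\<rightarrow> l" using der(2) by (simp add: DERIV_def)
      moreover have "\<bar>l\<bar> / 2 > 0" using \<open>l \<noteq> 0\<close> by simp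
      ultimately obtain s2 where s2: "s2 > 0" "\<And>h. h \<noteq> 0 \<Longrightarrow> norm h < s2 \<Longrightarrow> norm ((Y (t + h) - Y t) / h - l) < \<bar>l\<bar> / 2"
        unfolding LIM_eq by (metis diff_zero)
      obtain j where j: "inverse (real (Suc j)) < min s1 s2" using reals_Archimedean s1(1) s2(1) by (metis min_less_iff_conj)
      have "(4 * real n + 4) * \<bar>X (t + s) - X t\<bar> \<le> \<bar>Y (t + s) - Y t\<bar>" if s: "\<bar>s\<bar> < inverse (real (Suc j))" for s
      proof (cases "s = 0")
        case False
        have "\<bar>X (t + s) - X t\<bar> / \<bar>s\<bar> < e" using s1(2)[OF False] s j by simp
        then have "\<bar>X (t + s) - X t\<bar> \<le> e * \<bar>s\<bar>" using False by (simp add: pos_divide_less_eq)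
        then have "(4 * real n + 4) * \<bar>X (t + s) - X t\<bar> \<le> (4 * real n + 4) * (e * \<bar>s\<bar>)"
          by (intro mult_left_mono) auto
        also have "\<dots> = \<bar>l\<bar> / 2 * \<bar>s\<bar>" using e(2) by (simp add: mult.assoc[symmetric])
        also have "\<dots> \<le> \<bar>Y (t + s) - Y t\<bar>"
        proof -
          have "\<bar>(Y (t + s) - Y t) / s - l\<bar> < \<bar>l\<bar> / 2" using s2(2)[OF False] s j by simp
          then have "\<bar>l\<bar> / 2 \<le> \<bar>(Y (t + s) - Y t) / s\<bar>" by linarith
          then show ?thesis using False by (simp add: abs_divide pos_le_divide_eq)
        qed
        finally show ?thesis .
      qed simp
      then have "t \<in> a n j" by (simp add: a_def A_def)
      then show ?thesis by blast
    qed
    then have tB: "t \<in> B" using t unfolding B_def by blast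
    show "t \<in> vertical_at_scales r X Y \<union> W"
    proof (cases "t \<in> W")
      case False
      then have ta: "t \<in> a n (m n)" for n using tB unfolding W_def by blast
      have "(4 * real k + 4) * \<bar>X t' - X t\<bar> \<le> \<bar>Y t' - Y t\<bar>" if "\<bar>t' - t\<bar> < r k" for k t'
      proof -
        have "r k \<le> inverse (real (Suc (m k)))"
          unfolding r_def using d(2) by (intro le_imp_inverse_le) auto
        then have "\<bar>t' - t\<bar> < inverse (real (Suc (m k)))" using that by linarith
        moreover have "\<forall>s. \<bar>s\<bar> < inverse (real (Suc (m k))) \<longrightarrow> (4 * real k + 4) * \<bar>X (t + s) - X t\<bar> \<le> \<bar>Y (t + s) - Y t\<bar>"
          using ta[of k] by (simp add: a_def A_def)
        ultimately have "(4 * real k + 4) * \<bar>X (t + (t' - t)) - X t\<bar> \<le> \<bar>Y (t + (t' - t)) - Y t\<bar>" by blast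
        then show ?thesis by simp
      qed
      then show ?thesis by (simp add: vertical_at_scales_def)
    qed simp
  qed
qed

text \<open>Superlinear of slope at least \<open>G k\<close> beyond \<open>\<bar>p\<bar> = k\<close>.\<close>

definition staircase_growth :: "(nat \<Rightarrow> real) \<Rightarrow> real \<Rightarrow> real" where
  "staircase_growth G p = \<bar>p\<bar> * G (nat \<lfloor>\<bar>p\<bar>\<rfloor>)"

lemma staircase_growth_properties:
  assumes G: "mono G" "\<And>k. real k \<le> G k"
  shows "locally_bounded (staircase_growth G)" "superlinear (staircase_growth G)"
    "staircase_growth G p \<ge> G k * \<bar>p\<bar> - real k * G k"
proof -
  have G0: "G k \<ge> 0" for k using G(2)[of k] by (meson of_nat_0_le_iff order.trans)
  show "locally_bounded (staircase_growth G)"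
    unfolding locally_bounded_def
  proof
    fix x :: real
    have "\<bar>staircase_growth G p\<bar> \<le> (\<bar>x\<bar> + 1) * G (nat \<lfloor>\<bar>x\<bar> + 1\<rfloor>)" if "p \<in> ball x 1" for p
    proof -
      have p: "\<bar>p\<bar> \<le> \<bar>x\<bar> + 1" using that by (auto simp: dist_real_def)
      have "\<bar>staircase_growth G p\<bar> = \<bar>p\<bar> * G (nat \<lfloor>\<bar>p\<bar>\<rfloor>)" using G0 by (simp add: staircase_growth_def abs_mult)
      also have "\<dots> \<le> (\<bar>x\<bar> + 1) * G (nat \<lfloor>\<bar>x\<bar> + 1\<rfloor>)"
        using p G0 by (intro mult_mono monoD[OF G(1)] nat_mono floor_mono) auto
      finally show ?thesis .
    qed
    then have "bounded (staircase_growth G ` ball x 1)" by (auto simp: bounded_real intro!: exI)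
    then show "\<exists>U. open U \<and> x \<in> U \<and> bounded (staircase_growth G ` U)" by (intro exI[of _ "ball x 1"]) auto
  qed
  show "superlinear (staircase_growth G)"
    unfolding superlinear_def filterlim_at_top
  proof
    fix Z :: real
    show "\<forall>\<^sub>F p in at_infinity. Z \<le> staircase_growth G p / \<bar>p\<bar>"
      unfolding eventually_at_infinity
    proof (intro exI allI impI)
      fix p :: real assume p: "\<bar>Z\<bar> + 1 \<le> norm p"
      then have "staircase_growth G p / \<bar>p\<bar> = G (nat \<lfloor>\<bar>p\<bar>\<rfloor>)" by (auto simp: staircase_growth_def)
      moreover have "Z \<le> real (nat \<lfloor>\<bar>p\<bar>\<rfloor>)" using p by simp linarith
      ultimately show "Z \<le> staircase_growth G p / \<bar>p\<bar>" using G(2) by (metis order.trans)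
    qed
  qed
  show "staircase_growth G p \<ge> G k * \<bar>p\<bar> - real k * G k"
  proof (cases "real k \<le> \<bar>p\<bar>")
    case True
    then have "k \<le> nat \<lfloor>\<bar>p\<bar>\<rfloor>" by (simp add: le_nat_iff le_floor_iff)
    then have "\<bar>p\<bar> * G k \<le> staircase_growth G p"
      unfolding staircase_growth_def by (intro mult_left_mono monoD[OF G(1)]) auto
    moreover have "0 \<le> real k * G k" using G0 by simp
    ultimately show ?thesis by (simp add: mult.commute)
  next
    case False
    then have "G k * \<bar>p\<bar> \<le> real k * G k" using G0[of k] by (simp add: mult.commute mult_left_mono)
    moreover have "0 \<le> staircase_growth G p" using G0 by (simp add: staircase_growth_def)
    ultimately show ?thesis by linarith
  qed
qed

text \<open>For each \<open>\<eta> > 0\<close> a growth, and with it a Lagrangian, is chosen that leaves only a set \<open>W\<close> of measure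
at most \<open>\<eta>\<close> uncontrolled.  Outside of \<open>W\<close> each point of \<open>E\<close> on the curve is steep for one of
the four reflected costs along the correspondingly reflected curve.\<close>

lemma negligible_regular_parameters:
  fixes E :: "(real \<times> real) set"
  assumes E: "\<And>\<omega> :: real \<Rightarrow> real. locally_bounded \<omega> \<Longrightarrow> superlinear \<omega> \<Longrightarrow>
    \<exists>L. lagrangian L \<and> (\<forall>x y p. L (x, y, p) \<ge> \<omega> p) \<and> E \<subseteq> universal_singular_set L"
    and lip: "\<And>t t'. \<bar>X t' - X t\<bar> \<le> C * \<bar>t' - t\<bar>" "\<And>t t'. \<bar>Y t' - Y t\<bar> \<le> C * \<bar>t' - t\<bar>"
    and S: "\<And>t. t \<in> S \<Longrightarrow> t \<in> {- R..R} \<and> (X t, Y t) \<in> E \<and>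
      (\<exists>a b. (X has_real_derivative a) (at t) \<and> (Y has_real_derivative b) (at t) \<and> (a \<noteq> 0 \<or> b \<noteq> 0))"
  shows "negligible S"
  unfolding negligible_outer_le
proof (intro allI impI)
  fix \<eta> :: real assume "\<eta> > 0"
  have cont: "continuous_on UNIV X" "continuous_on UNIV Y"
    using lip by (auto intro!: lipschitz_on_continuous_on[of C] lipschitz_onI simp: dist_real_def)
      (use lip(1)[of 1 0] in simp)+
  obtain r W where r: "\<And>k. r k > 0" "decseq r" "\<And>k. r k \<le> 1" "r \<longlonglongrightarrow> 0"
    and W: "W \<in> lmeasurable" "measure lebesgue W \<le> \<eta>"
      "\<And>t l. t \<in> {- R..R} \<Longrightarrow> (X has_real_derivative 0) (at t) \<Longrightarrow> (Y has_real_derivative l) (at t) \<Longrightarrow> l \<noteq> 0 \<Longrightarrow>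
      t \<in> vertical_at_scales r X Y \<union> W"
    using vertical_scales[OF cont \<open>\<eta> > 0\<close>, of R thesis] by blast
  define G where "G k = real k / r (Suc k)" for k
  have G: "mono G" "\<And>k. real k \<le> G k" "\<And>k. G k \<ge> 0" "\<And>k. real k \<le> G k * r (Suc k)"
  proof -
    show "mono G"
    proof (rule monoI)
      fix i j :: nat assume "i \<le> j"
      then have "r (Suc j) \<le> r (Suc i)" by (intro decseqD[OF r(2)]) simp
      then show "G i \<le> G j" unfolding G_def using \<open>i \<le> j\<close> r(1) by (intro frac_le) auto
    qed
    show "real k \<le> G k" for k
      unfolding G_def using r(1,3)[of "Suc k"] by (simp add: pos_le_divide_eq mult_left_le)
    show "G k \<ge> 0" "real k \<le> G k * r (Suc k)" for k
      using r(1)[of "Suc k"] by (simp_all add: G_def less_imp_le)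
  qed
  obtain L where L: "lagrangian L" "\<And>x y p. L (x, y, p) \<ge> staircase_growth G p" "E \<subseteq> universal_singular_set L"
    using E[OF staircase_growth_properties(1,2)[OF G(1,2)]] by blast
  obtain c where c: "c \<ge> 0" "\<And>z. L z \<ge> - c" "regular_cost (\<lambda>z. L z + c)"
    using lagrangian_regular_cost[OF L(1)] by blast
  define F where "F = (\<lambda>z. L z + c)"
  have F: "regular_cost F" unfolding F_def by (rule c(3))
  have F_G: "F (x, y, p) \<ge> G k * \<bar>p\<bar> - real k * G k" for k x y p
    using staircase_growth_properties(3)[OF G(1,2), of k p] L(2)[of p x y] c(1) by (simp add: F_def)
  define S' where "S' = S - W"
  have der: "\<exists>a b. (X has_real_derivative a) (at t) \<and> (Y has_real_derivative b) (at t) \<and>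
      (a \<noteq> 0 \<or> b \<noteq> 0 \<and> t \<in> vertical_at_scales r X Y)" if t: "t \<in> S'" for t
  proof -
    obtain a b where ab: "(X has_real_derivative a) (at t)" "(Y has_real_derivative b) (at t)" "a \<noteq> 0 \<or> b \<noteq> 0"
      using S[of t] t unfolding S'_def by blast
    have "t \<in> vertical_at_scales r X Y" if "a = 0"
      using W(3)[of t b] ab that S[of t] t unfolding S'_def by blast
    with ab show ?thesis by blast
  qed
  have neg: "negligible {t\<in>S'. steep_from_left F' (\<sigma> * X t) (\<tau> * Y t)}"
    if F': "regular_cost F'" "\<And>k x y p. F' (x, y, p) \<ge> G k * \<bar>p\<bar> - real k * G k" and \<sigma>\<tau>: "\<bar>\<sigma>\<bar> = 1" "\<bar>\<tau>\<bar> = 1"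
    for F' and \<sigma> \<tau> :: real
  proof (rule negligible_steep_points[OF F'(1), where X = "\<lambda>t. \<sigma> * X t" and Y = "\<lambda>t. \<tau> * Y t" and C = C and G = G and r = r])
    have scale: "\<bar>\<rho> * f t' - \<rho> * f t\<bar> = \<bar>f t' - f t\<bar>" if "\<bar>\<rho>\<bar> = 1" for \<rho> t t' and f :: "real \<Rightarrow> real"
    proof -
      have "\<bar>\<rho> * f t' - \<rho> * f t\<bar> = \<bar>\<rho>\<bar> * \<bar>f t' - f t\<bar>" by (simp add: abs_mult[symmetric] right_diff_distrib)
      then show ?thesis using that by simp
    qed
    show "\<bar>\<sigma> * X t' - \<sigma> * X t\<bar> \<le> C * \<bar>t' - t\<bar>" "\<bar>\<tau> * Y t' - \<tau> * Y t\<bar> \<le> C * \<bar>t' - t\<bar>" for t t'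
      using lip scale[OF \<sigma>\<tau>(1)] scale[OF \<sigma>\<tau>(2)] by simp_all
    fix t assume "t \<in> {t\<in>S'. steep_from_left F' (\<sigma> * X t) (\<tau> * Y t)}"
    then have t: "t \<in> S'" "steep_from_left F' (\<sigma> * X t) (\<tau> * Y t)" by auto
    then show "steep_from_left F' (\<sigma> * X t) (\<tau> * Y t)" by simp
    have vt: "vertical_at_scales r (\<lambda>t. \<sigma> * X t) (\<lambda>t. \<tau> * Y t) = vertical_at_scales r X Y"
      unfolding vertical_at_scales_def scale[OF \<sigma>\<tau>(1)] scale[OF \<sigma>\<tau>(2)] by simp
    obtain a b where ab: "(X has_real_derivative a) (at t)" "(Y has_real_derivative b) (at t)"
      "a \<noteq> 0 \<or> b \<noteq> 0 \<and> t \<in> vertical_at_scales r X Y" using der[OF t(1)] by blast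
    have "((\<lambda>t. \<sigma> * X t) has_real_derivative \<sigma> * a) (at t)" "((\<lambda>t. \<tau> * Y t) has_real_derivative \<tau> * b) (at t)"
      using ab(1,2) by (auto intro!: derivative_eq_intros)
    moreover have "\<sigma> \<noteq> 0" "\<tau> \<noteq> 0" using \<sigma>\<tau> by auto
    ultimately show "\<exists>l\<noteq>0. ((\<lambda>t. \<sigma> * X t) has_real_derivative l) (at t) \<or>
      ((\<lambda>t. \<tau> * Y t) has_real_derivative l) (at t) \<and> t \<in> vertical_at_scales r (\<lambda>t. \<sigma> * X t) (\<lambda>t. \<tau> * Y t)"
      unfolding vt using ab(3) by (metis mult_eq_0_iff)
  qed (use F'(2) G r in auto)
  have refl: "regular_cost (reflect_value F)" "regular_cost (reflect_time F)" "regular_cost (reflect_value (reflect_time F))"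
    using regular_cost_reflect F by blast+
  have refl_G: "reflect_value F (x, y, p) \<ge> G k * \<bar>p\<bar> - real k * G k"
    "reflect_time F (x, y, p) \<ge> G k * \<bar>p\<bar> - real k * G k"
    "reflect_value (reflect_time F) (x, y, p) \<ge> G k * \<bar>p\<bar> - real k * G k" for k x y p
    using F_G[of k "- p" x "- y"] F_G[of k "- p" "- x" y] F_G[of k p "- x" "- y"]
    by (simp_all add: reflect_value_def reflect_time_def)
  define N where "N = {t\<in>S'. steep_from_left F (1 * X t) (1 * Y t)} \<union>
    {t\<in>S'. steep_from_left (reflect_value F) (1 * X t) (-1 * Y t)} \<union>
    ({t\<in>S'. steep_from_left (reflect_time F) (-1 * X t) (1 * Y t)} \<union>
     {t\<in>S'. steep_from_left (reflect_value (reflect_time F)) (-1 * X t) (-1 * Y t)})"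
  have "negligible N"
    unfolding N_def by (intro negligible_Un neg F F_G refl refl_G) auto
  moreover have "S' \<subseteq> N"
  proof
    fix t assume t: "t \<in> S'"
    then have "(X t, Y t) \<in> universal_singular_set L" using S[of t] L(3) unfolding S'_def by blast
    moreover have "L \<in> borel_measurable borel" using L(1) by (simp add: lagrangian_def)
    ultimately show "t \<in> N"
      using universal_singular_set_steep[of "X t" "Y t" L c] c(1,2) t unfolding N_def F_def by simp
  qed
  ultimately have "negligible S'" by (rule negligible_subset)
  then have S'_null: "S' \<in> lmeasurable" "measure lebesgue S' = 0" using negligible_iff_measure by blast+
  show "\<exists>T. S \<subseteq> T \<and> T \<in> lmeasurable \<and> measure lebesgue T \<le> \<eta>"
  proof (intro exI conjI)
    show "S \<subseteq> S' \<union> W" by (auto simp: S'_def)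
    show "S' \<union> W \<in> lmeasurable" using S'_null W by (intro fmeasurable.Un)
    have "measure lebesgue (S' \<union> W) \<le> measure lebesgue S' + measure lebesgue W"
      using S'_null W by (intro measure_Un_le) auto
    then show "measure lebesgue (S' \<union> W) \<le> \<eta>" using S'_null W by simp
  qed
qed

lemma lipschitz_negligible_nondifferentiable:
  assumes lip: "\<And>t t'. \<bar>f t' - f t\<bar> \<le> C * \<bar>t' - t\<bar>"
  shows "negligible {t. \<nexists>l. (f has_real_derivative l) (at t)}"
proof -
  let ?N = "{t. \<nexists>l. (f has_real_derivative l) (at t)}"
  have "negligible (?N \<inter> {- real R - 1<..<real R + 1})" for R :: nat
  proof -
    have ac: "absolutely_continuous_on (- real R - 1) (real R + 1) f"
      by (rule lipschitz_imp_absolutely_continuous_on[where C = C]) (use lip in \<open>smt (verit)\<close>)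
    obtain g where "AE t in lebesgue. t \<in> {- real R - 1<..<real R + 1} \<longrightarrow> (f has_real_derivative g t) (at t)"
      using absolutely_continuous_on_derivative[OF ac] by auto
    then have "AE t in lebesgue. t \<notin> ?N \<inter> {- real R - 1<..<real R + 1}"
      by eventually_elim auto
    then obtain M where "M \<in> null_sets lebesgue" "{t. \<not> t \<notin> ?N \<inter> {- real R - 1<..<real R + 1}} \<subseteq> M"
      unfolding eventually_ae_filter by auto
    then have "negligible M" "?N \<inter> {- real R - 1<..<real R + 1} \<subseteq> M"
      by (auto simp: negligible_iff_null_sets)
    then show ?thesis by (rule negligible_subset)
  qed
  then have "negligible (\<Union>R::nat. ?N \<inter> {- real R - 1<..<real R + 1})"
    by (intro negligible_countable_Union) auto
  moreover have "?N \<subseteq> (\<Union>R::nat. ?N \<inter> {- real R - 1<..<real R + 1})"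
  proof
    fix t assume "t \<in> ?N"
    obtain R where "\<bar>t\<bar> \<le> real R" using real_arch_simple by blast
    with \<open>t \<in> ?N\<close> have "t \<in> ?N \<inter> {- real R - 1<..<real R + 1}" by auto
    then show "t \<in> (\<Union>R::nat. ?N \<inter> {- real R - 1<..<real R + 1})" by blast
  qed
  ultimately show ?thesis by (rule negligible_subset)
qed

section \<open>Pure unrectifiability\<close>

theorem theorem3p3:
  fixes E :: "(real \<times> real) set"
  assumes "\<And>\<omega> :: real \<Rightarrow> real. locally_bounded \<omega> \<Longrightarrow> superlinear \<omega> \<Longrightarrow>
    \<exists>L. lagrangian L \<and> (\<forall>x y p. L (x, y, p) \<ge> \<omega> p) \<and> E \<subseteq> universal_singular_set L"
  shows "purely_unrectifiable E"
  unfolding purely_unrectifiable_def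
proof (intro allI impI)
  fix \<gamma> :: "real \<Rightarrow> real \<times> real" and C assume \<gamma>: "C-lipschitz_on UNIV \<gamma>"
  define X where "X t = fst (\<gamma> t)" for t
  define Y where "Y t = snd (\<gamma> t)" for t
  have \<gamma>_lip: "dist (\<gamma> t') (\<gamma> t) \<le> C * \<bar>t' - t\<bar>" for t t'
    using lipschitz_onD[OF \<gamma>, of t' t] by (simp add: dist_real_def)
  have lip: "\<bar>X t' - X t\<bar> \<le> C * \<bar>t' - t\<bar>" "\<bar>Y t' - Y t\<bar> \<le> C * \<bar>t' - t\<bar>" for t t'
    using dist_fst_le[of "\<gamma> t'" "\<gamma> t"] dist_snd_le[of "\<gamma> t'" "\<gamma> t"] \<gamma>_lip[of t' t]
    by (auto simp: X_def Y_def dist_real_def)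
  define Z where "Z = {t. (X has_real_derivative 0) (at t) \<and> (Y has_real_derivative 0) (at t)}"
  define S where "S R = {t\<in>{- real R..real R}. (X t, Y t) \<in> E \<and>
      (\<exists>a b. (X has_real_derivative a) (at t) \<and> (Y has_real_derivative b) (at t) \<and> (a \<noteq> 0 \<or> b \<noteq> 0))}" for R :: nat
  define N where "N = {t. \<nexists>l. (X has_real_derivative l) (at t)} \<union> {t. \<nexists>l. (Y has_real_derivative l) (at t)} \<union> (\<Union>R. S R)"
  have "negligible (S R)" for R
    by (rule negligible_regular_parameters[OF assms lip, where R = "real R"]) (auto simp: S_def)
  then have "negligible (\<Union>R. S R)" by (intro negligible_countable_Union) auto
  then have "negligible N"
    unfolding N_def using lip by (intro negligible_Un lipschitz_negligible_nondifferentiable)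
  then have "length_null (\<gamma> ` N)" by (rule length_null_lipschitz_image_negligible[OF \<gamma>])
  moreover have "length_null (\<gamma> ` Z)"
  proof (rule length_null_critical_image)
    fix t e :: real assume t: "t \<in> Z" and "e > 0"
    have ev: "\<exists>\<delta>>0. \<forall>h. \<bar>h\<bar> < \<delta> \<longrightarrow> \<bar>f (t + h) - f t\<bar> \<le> e / 2 * \<bar>h\<bar>" if "(f has_real_derivative 0) (at t)" for f
    proof -
      have "(\<lambda>h. (f (t + h) - f t) / h) \<midarrow>0\<rightarrow> 0" using that by (simp add: DERIV_def)
      then obtain s where s: "s > 0" "\<And>h. h \<noteq> 0 \<Longrightarrow> norm h < s \<Longrightarrow> norm ((f (t + h) - f t) / h) < e / 2"
        using \<open>e > 0\<close> unfolding LIM_eq by (metis diff_zero half_gt_zero)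
      have "\<bar>f (t + h) - f t\<bar> \<le> e / 2 * \<bar>h\<bar>" if "\<bar>h\<bar> < s" for h
      proof (cases "h = 0")
        case False
        then have "\<bar>f (t + h) - f t\<bar> / \<bar>h\<bar> < e / 2" using s(2)[OF False] that by simp
        then show ?thesis using False by (simp add: pos_divide_less_eq)
      qed simp
      with s(1) show ?thesis by blast
    qed
    obtain d1 where d1: "d1 > 0" "\<And>h. \<bar>h\<bar> < d1 \<Longrightarrow> \<bar>X (t + h) - X t\<bar> \<le> e / 2 * \<bar>h\<bar>"
      using ev[of X] t unfolding Z_def by blast
    obtain d2 where d2: "d2 > 0" "\<And>h. \<bar>h\<bar> < d2 \<Longrightarrow> \<bar>Y (t + h) - Y t\<bar> \<le> e / 2 * \<bar>h\<bar>"
      using ev[of Y] t unfolding Z_def by blast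
    have "dist (\<gamma> t') (\<gamma> t) \<le> e * \<bar>t' - t\<bar>" if "\<bar>t' - t\<bar> < min d1 d2" for t'
    proof -
      have "dist (\<gamma> t') (\<gamma> t) \<le> \<bar>X t' - X t\<bar> + \<bar>Y t' - Y t\<bar>"
        unfolding dist_prod_def X_def Y_def dist_real_def
        using sqrt_sum_squares_le_sum_abs by (metis power2_abs)
      also have "\<dots> \<le> e / 2 * \<bar>t' - t\<bar> + e / 2 * \<bar>t' - t\<bar>"
        using d1(2)[of "t' - t"] d2(2)[of "t' - t"] that by (intro add_mono) auto
      finally show ?thesis by simp
    qed
    then show "\<exists>\<delta>>0. \<forall>t'. \<bar>t' - t\<bar> < \<delta> \<longrightarrow> dist (\<gamma> t') (\<gamma> t) \<le> e * \<bar>t' - t\<bar>"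
      using d1(1) d2(1) by (intro exI[of _ "min d1 d2"]) auto
  qed
  ultimately have "length_null (\<Union>i::nat. if i = 0 then \<gamma> ` N else \<gamma> ` Z)" by (intro length_null_UN) auto
  moreover have "E \<inter> range \<gamma> \<subseteq> (\<Union>i::nat. if i = 0 then \<gamma> ` N else \<gamma> ` Z)"
  proof
    fix z assume "z \<in> E \<inter> range \<gamma>"
    then obtain t where t: "z = \<gamma> t" "(X t, Y t) \<in> E" by (auto simp: X_def Y_def)
    obtain R where R: "\<bar>t\<bar> \<le> real R" using real_arch_simple by blast
    have "t \<in> N \<or> t \<in> Z"
    proof (rule ccontr)
      assume *: "\<not> (t \<in> N \<or> t \<in> Z)"
      then obtain a b where ab: "(X has_real_derivative a) (at t)" "(Y has_real_derivative b) (at t)"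
        unfolding N_def by blast
      moreover have "t \<in> {- real R..real R}" using R by auto
      moreover have "a \<noteq> 0 \<or> b \<noteq> 0" using * ab unfolding Z_def by blast
      ultimately have "t \<in> S R" using t(2) unfolding S_def by blast
      with * show False unfolding N_def by blast
    qed
    then have "z \<in> (if (0::nat) = 0 then \<gamma> ` N else \<gamma> ` Z) \<or> z \<in> (if (1::nat) = 0 then \<gamma> ` N else \<gamma> ` Z)"
      using t(1) by auto
    then show "z \<in> (\<Union>i::nat. if i = 0 then \<gamma> ` N else \<gamma> ` Z)" by blast
  qed
  ultimately have "length_null (E \<inter> range \<gamma>)" by (rule length_null_subset)
  then show "hausdorff_measure_1 (E \<inter> range \<gamma>) = 0" by (rule length_null_imp_hausdorff_measure_0)
qed

end
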